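(* Assume condition (S) below. Then $$n^{1/2}(\hat p_n-p)\xrightarrow{\mathcal D}\mathcal N(0,\sigma^2),$$ with $$\sigma^2=\sum_{k=-\infty}^{\infty}\mathbb{E}\Big[\big(\mathbf 1_{\{\tilde\Pi(Y_1^{(1)},\ldots,Y_h^{(1)})=\tilde\Pi(Y_1^{(2)},\ldots,Y_h^{(2)})\}}-p\big)\big(\mathbf 1_{\{\tilde\Pi(Y_{1+k}^{(1)},\ldots,Y_{h+k}^{(1)})=\tilde\Pi(Y_{1+k}^{(2)},\ldots,Y_{h+k}^{(2)})\}}-p\big)\Big].$$
   Context: Setting: $(X_j^{(1)},X_j^{(2)})_{j}$ is a bivariate time series whose increments $Y_j^{(p)}=X_j^{(p)}-X_{j-1}^{(p)}$ form a bivariate stationary centered Gaussian process $(Y_j)_{j\in\mathbb{Z}}$ with $Y_j^{(p)}\sim\mathcal N(0,1)$ and cross-correlations $r^{(p,q)}(k)=\mathbb{E}(Y_j^{(p)}Y_{j+k}^{(q)})$ with $|r^{(p,q)}(k)|<1$ for $k\ge1$, $p,q=1,2$. Condition (S): $d_1,d_2\in(-\infty,0)\cup(0,\frac14)$ and for $p,q=1,2$, $r^{(p,q)}(k)=k^{d_p+d_q-1}L_{p,q}(k)$ with $L_{p,q}(k)\to L_{p,q}\in\mathbb{R}$ as $k\to\infty$. Ordinal patterns: for $x\in\mathbb{R}^{h+1}$, $\Pi(x)$ is the unique permutation $(\pi_0,\ldots,\pi_h)$ of $\{0,\ldots,h\}$ with $x_{\pi_0}\ge\cdots\ge x_{\pi_h}$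 and $\pi_{i-1}<\pi_i$ when $x_{\pi_{i-1}}=x_{\pi_i}$; $\tilde\Pi(y_1,\ldots,y_h)=\Pi(0,y_1,y_1+y_2,\ldots,y_1+\cdots+y_h)$. $p=\mathbb{P}(\tilde\Pi(Y_1^{(1)},\ldots,Y_h^{(1)})=\tilde\Pi(Y_1^{(2)},\ldots,Y_h^{(2)}))$; $\hat p_n=\frac{1}{n-h}\sum_{j=1}^{n-h}\mathbf 1_{\{\tilde\Pi(Y_j^{(1)},\ldots,Y_{j+h-1}^{(1)})=\tilde\Pi(Y_j^{(2)},\ldots,Y_{j+h-1}^{(2)})\}}$. *)

theory Defs
  imports "HOL-Probability.Probability"
begin

definition normal_distr :: "real \<Rightarrow> real measure" where
  "normal_distr v = (if v = 0 then return borel 0 else density lborel (normal_density 0 (sqrt v)))"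

definition ord_pattern :: "nat \<Rightarrow> (nat \<Rightarrow> real) \<Rightarrow> nat list" where
  "ord_pattern h x = (THE \<pi>. length \<pi> = h + 1 \<and> distinct \<pi> \<and> set \<pi> = {0..h} \<and>
      (\<forall>i\<in>{1..h}. x (\<pi> ! (i - 1)) \<ge> x (\<pi> ! i) \<and>
          (x (\<pi> ! (i - 1)) = x (\<pi> ! i) \<longrightarrow> \<pi> ! (i - 1) < \<pi> ! i)))"

definition ord_pattern_incr :: "nat \<Rightarrow> (nat \<Rightarrow> real) \<Rightarrow> nat list" where
  "ord_pattern_incr h y = ord_pattern h (\<lambda>i. \<Sum>m\<in>{1..i}. y m)"

definition coinc :: "nat \<Rightarrow> (nat \<Rightarrow> int \<Rightarrow> 'a \<Rightarrow> real) \<Rightarrow> int \<Rightarrow> 'a \<Rightarrow> real" where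
  "coinc h Y j \<omega> = (if ord_pattern_incr h (\<lambda>m. Y 1 (j + int m - 1) \<omega>)
                       = ord_pattern_incr h (\<lambda>m. Y 2 (j + int m - 1) \<omega>) then 1 else 0)"

definition p_hat :: "nat \<Rightarrow> (nat \<Rightarrow> int \<Rightarrow> 'a \<Rightarrow> real) \<Rightarrow> nat \<Rightarrow> 'a \<Rightarrow> real" where
  "p_hat h Y n \<omega> = (1 / real (n - h)) * (\<Sum>j\<in>{1..n - h}. coinc h Y (int j) \<omega>)"

definition centered_gaussian_rv :: "'a measure \<Rightarrow> ('a \<Rightarrow> real) \<Rightarrow> bool" where
  "centered_gaussian_rv M X \<longleftrightarrow> X \<in> borel_measurable M \<and> (\<exists>v\<ge>0. distr M borel X = normal_distr v)"

definition centered_gaussian_process :: "'a measure \<Rightarrow> (nat \<Rightarrow> int \<Rightarrow> 'a \<Rightarrow> real) \<Rightarrow> bool" where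
  "centered_gaussian_process M Y \<longleftrightarrow>
     (\<forall>J c. finite J \<and> J \<subseteq> {1,2} \<times> UNIV \<longrightarrow>
        centered_gaussian_rv M (\<lambda>\<omega>. \<Sum>(p,j)\<in>J. c (p,j) * Y p j \<omega>))"

definition stationary_process :: "'a measure \<Rightarrow> (nat \<Rightarrow> int \<Rightarrow> 'a \<Rightarrow> real) \<Rightarrow> bool" where
  "stationary_process M Y \<longleftrightarrow>
     (\<forall>J m. finite J \<and> J \<subseteq> {1,2} \<times> UNIV \<longrightarrow>
        distr M (PiM J (\<lambda>_. borel)) (\<lambda>\<omega>. restrict (\<lambda>(p,j). Y p (j + m) \<omega>) J)
        = distr M (PiM J (\<lambda>_. borel)) (\<lambda>\<omega>. restrict (\<lambda>(p,j). Y p j \<omega>) J))"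

text \<open>Cross-correlation r^{(p,q)}(k) = E(Y^(p)_j Y^(q)_{j+k}) (taken at j = 0; independent of j
  by stationarity).\<close>
definition cross_corr :: "'a measure \<Rightarrow> (nat \<Rightarrow> int \<Rightarrow> 'a \<Rightarrow> real) \<Rightarrow> nat \<Rightarrow> nat \<Rightarrow> int \<Rightarrow> real" where
  "cross_corr M Y p q k = prob_space.expectation M (\<lambda>\<omega>. Y p 0 \<omega> * Y q k \<omega>)"

end

theory Submission
  imports Defs
begin

text \<open>
  Almost surely the coincidence indicator at time k is a product of factors (1 + sgn u sgn v) / 2,
  where u and v are partial sums of the two series. As sgn is a bounded pointwise limit of odd
  trigonometric polynomials, the indicator is a bounded limit of even ones, that is, of sums of
  c cos(W) with W in the Gaussian space of the process. Two facts about such polynomials suffice.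

  Expanding cosh in the formula for the covariance of cos(W) and cos(W'), and using that evenness
  removes the terms of order 0 and 1, the covariance at lag k is at most a constant times
  \<rho>(k)^2 times the variance, with \<rho> square summable by condition (S). Hence normalised sums of
  the approximation error are small in mean square, uniformly in the sample size.

  For a normalised sum F of an even trigonometric polynomial, interpolating along the
  Ornstein-Uhlenbeck semigroup and integrating by parts bounds the distance of the characteristic
  function of F from a Gaussian one by the standard deviation of a quadratic form in sines. Its
  variance is a sum over four times of products of correlations; the odd-degree subgraphs of K4 that
  occur force every term to vanish in the limit when \<rho> is square summable.
\<close>

text \<open>The indicator is discontinuous, so the differential argument for normality cannot be
  applied to it directly, and its Hermite expansion would bring in unbounded polynomials. Cosines of
  Gaussian variables are bounded, and their moments are explicit exponentials of covariances.

  The two estimates differ in uniformity, and this dictates the order of the limits. The constant in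
  the covariance comparison depends on the process alone, so it applies to every error of
  approximation. The constants in the estimate of the characteristic function depend on coefficients
  and frequencies. Hence a polynomial is fixed, the sample size tends to infinity, and only then is
  the approximation refined.

  Condition (S) gives correlations of order k^(d_p + d_q - 1) with d_p + d_q < 1/2: their squares
  are summable, though they themselves may not be. The window of the process may be degenerate, for
  instance when the two series coincide. Orthonormal coordinates are therefore taken modulo
  variables that vanish almost surely, and the limit may be a point mass.\<close>

section \<open>Gaussian spaces and integration by parts\<close>

text \<open>A quadratic remainder is what second moments provide, so expectations can be
  differentiated without dominating difference quotients.\<close>

lemma has_vector_derivativeI_quadratic:
  fixes f :: "real \<Rightarrow> 'b::real_normed_vector"
  assumes "\<And>s. norm (f s - f t - (s - t) *\<^sub>R d) \<le> K * (s - t)\<^sup>2"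
  shows "(f has_vector_derivative d) (at t)"
proof -
  \<comment> \<open>At s = t + 1 the factor (s - t)^2 is 1, so the assumption itself forces K to be
    nonnegative.\<close>
  have K: "K \<ge> 0" using order_trans[OF norm_ge_zero assms[of "t + 1"]] by simp
  show ?thesis
    unfolding has_vector_derivative_def has_derivative_at
  proof (intro conjI)
    show "bounded_linear (\<lambda>x. x *\<^sub>R d)" by (rule bounded_linear_scaleR_left)
    show "(\<lambda>h. norm (f (t + h) - f t - h *\<^sub>R d) / norm h) \<midarrow>0\<rightarrow> 0"
    proof (rule Lim_null_comparison)
      show "\<forall>\<^sub>F h in at 0. norm (norm (f (t + h) - f t - h *\<^sub>R d) / norm h) \<le> K * \<bar>h\<bar>"
      proof (rule always_eventually, rule allI)
        fix h :: real
        show "norm (norm (f (t + h) - f t - h *\<^sub>R d) / norm h) \<le> K * \<bar>h\<bar>"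
          using assms[of "t + h"] K by (cases "h = 0") (simp_all add: field_simps power2_eq_square abs_mult)
      qed
      have "((\<lambda>h. K * \<bar>h\<bar>) \<longlongrightarrow> K * \<bar>0\<bar>) (at (0::real))" by (intro tendsto_intros)
      thus "((\<lambda>h. K * \<bar>h\<bar>) \<longlongrightarrow> 0) (at (0::real))" by simp
    qed
  qed
qed

lemma norm_cis_taylor1: "cmod (cis x - 1 - \<i> * of_real x) \<le> x\<^sup>2 / 2"
proof -
  have "cmod (iexp x - (\<Sum>k\<le>1. (\<i> * x)^k / fact k)) \<le> \<bar>x\<bar>^(Suc 1) / fact (Suc 1)"
    by (rule iexp_approx1)
  thus ?thesis by (simp add: cis_conv_exp power2_eq_square[symmetric] diff_diff_eq)
qed

lemma borel_measurable_cis[measurable]: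
  assumes "f \<in> borel_measurable M" shows "(\<lambda>x. cis (f x)) \<in> borel_measurable M"
proof -
  have "continuous_on UNIV cis" by (intro continuous_intros)
  hence "cis \<in> borel_measurable borel" by (rule borel_measurable_continuous_onI)
  thus ?thesis using assms by measurable
qed

lemma norm_integral_le:
  fixes f :: "'a \<Rightarrow> 'b::{banach, second_countable_topology}"
  assumes "integrable M f" "integrable M g" "\<And>x. norm (f x) \<le> g x"
  shows "norm (integral\<^sup>L M f) \<le> integral\<^sup>L M g"
proof -
  have "norm (integral\<^sup>L M f) \<le> (\<integral>x. norm (f x) \<partial>M)" by (rule integral_norm_bound)
  also have "\<dots> \<le> integral\<^sup>L M g" using assms by (intro integral_mono integrable_norm) auto
  finally show ?thesis .
qed

section \<open>Bounded random variables and differentiation under the expectation\<close>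

context prob_space
begin

text \<open>The bound is required at every point, not almost surely, so sums, products and limits of
  such variables involve no null sets.\<close>

definition bdd_rv :: "('a \<Rightarrow> complex) \<Rightarrow> bool" where
  "bdd_rv f \<longleftrightarrow> f \<in> borel_measurable M \<and> (\<exists>B. \<forall>\<omega>. cmod (f \<omega>) \<le> B)"

lemma bdd_rv_measurable: "bdd_rv f \<Longrightarrow> f \<in> borel_measurable M"
  by (simp add: bdd_rv_def)

lemma bdd_rv_const[simp]: "bdd_rv (\<lambda>\<omega>. c)"
  unfolding bdd_rv_def by auto

lemma bdd_rv_add: "bdd_rv f \<Longrightarrow> bdd_rv g \<Longrightarrow> bdd_rv (\<lambda>\<omega>. f \<omega> + g \<omega>)"
proof -
  assume fg: "bdd_rv f" "bdd_rv g"
  then obtain A B where "\<And>\<omega>. cmod (f \<omega>) \<le> A" "\<And>\<omega>. cmod (g \<omega>) \<le> B"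
    unfolding bdd_rv_def by auto
  hence "cmod (f \<omega> + g \<omega>) \<le> A + B" for \<omega>
    by (intro norm_triangle_le add_mono)
  thus ?thesis using fg unfolding bdd_rv_def by (auto intro!: borel_measurable_add)
qed

lemma bdd_rv_mult:
  assumes "bdd_rv f" "bdd_rv g" shows "bdd_rv (\<lambda>\<omega>. f \<omega> * g \<omega>)"
proof -
  from assms obtain A B where "\<And>\<omega>. cmod (f \<omega>) \<le> A" "\<And>\<omega>. cmod (g \<omega>) \<le> B"
    unfolding bdd_rv_def by auto
  hence "cmod (f \<omega> * g \<omega>) \<le> A * B" for \<omega>
    unfolding norm_mult by (meson mult_mono norm_ge_zero order_trans)
  thus ?thesis using assms unfolding bdd_rv_def by (auto intro!: borel_measurable_times)
qed

lemma bdd_rv_diff: "bdd_rv f \<Longrightarrow> bdd_rv g \<Longrightarrow> bdd_rv (\<lambda>\<omega>. f \<omega> - g \<omega>)"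
  using bdd_rv_add[of f "\<lambda>\<omega>. (-1) * g \<omega>"] bdd_rv_mult[of "\<lambda>_. -1" g] by simp

lemma bdd_rv_sum: "(\<And>i. i \<in> I \<Longrightarrow> bdd_rv (f i)) \<Longrightarrow> bdd_rv (\<lambda>\<omega>. \<Sum>i\<in>I. f i \<omega>)"
  by (induction I rule: infinite_finite_induct) (auto intro: bdd_rv_add)

lemma bdd_rv_power: "bdd_rv f \<Longrightarrow> bdd_rv (\<lambda>\<omega>. f \<omega> ^ n)"
  by (induction n) (auto intro: bdd_rv_mult)

lemma bdd_rv_of_real:
  "f \<in> borel_measurable M \<Longrightarrow> (\<And>\<omega>. \<bar>f \<omega>\<bar> \<le> B) \<Longrightarrow> bdd_rv (\<lambda>\<omega>. of_real (f \<omega>))"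
  unfolding bdd_rv_def by auto

lemma bdd_rv_cis: "f \<in> borel_measurable M \<Longrightarrow> bdd_rv (\<lambda>\<omega>. cis (f \<omega>))"
  unfolding bdd_rv_def by (auto intro!: exI[of _ 1] borel_measurable_cis)

lemma bdd_rv_cos: "f \<in> borel_measurable M \<Longrightarrow> bdd_rv (\<lambda>\<omega>. of_real (cos (f \<omega>)))"
  by (rule bdd_rv_of_real[of _ 1]) auto

lemma bdd_rv_sin: "f \<in> borel_measurable M \<Longrightarrow> bdd_rv (\<lambda>\<omega>. of_real (sin (f \<omega>)))"
  by (rule bdd_rv_of_real[of _ 1]) auto

lemmas bdd_rv_intros = bdd_rv_const bdd_rv_add bdd_rv_diff bdd_rv_mult bdd_rv_sum bdd_rv_power
  bdd_rv_cis bdd_rv_cos bdd_rv_sin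

lemma bdd_rv_integrable: "bdd_rv f \<Longrightarrow> integrable M f"
  unfolding bdd_rv_def by (auto intro: integrable_const_bound)

lemma integrable_mult_bdd_rv:
  fixes U :: "'a \<Rightarrow> real"
  assumes "integrable M U" "bdd_rv G"
  shows "integrable M (\<lambda>\<omega>. of_real (U \<omega>) * G \<omega>)"
proof -
  obtain B where B: "\<And>\<omega>. cmod (G \<omega>) \<le> B" using assms(2) by (auto simp: bdd_rv_def)
  show ?thesis
  proof (rule Bochner_Integration.integrable_bound[of _ "\<lambda>\<omega>. B * U \<omega>"])
    show "integrable M (\<lambda>\<omega>. B * U \<omega>)" using assms by simp
    show "(\<lambda>\<omega>. of_real (U \<omega>) * G \<omega>) \<in> borel_measurable M"
      using assms by (auto simp: bdd_rv_def)
    have "cmod (of_real (U \<omega>) * G \<omega>) \<le> norm (B * U \<omega>)" for \<omega>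
      using mult_right_mono[OF B[of \<omega>], of "\<bar>U \<omega>\<bar>"] B[of \<omega>]
      by (smt (verit) abs_mult mult.commute norm_ge_zero norm_mult norm_of_real real_norm_def)
    thus "AE \<omega> in M. cmod (of_real (U \<omega>) * G \<omega>) \<le> norm (B * U \<omega>)" by simp
  qed
qed

lemma integrable_of_square:
  fixes U :: "'a \<Rightarrow> real"
  assumes "U \<in> borel_measurable M" "integrable M (\<lambda>\<omega>. (U \<omega>)\<^sup>2)"
  shows "integrable M U"
proof (rule Bochner_Integration.integrable_bound[of _ "\<lambda>\<omega>. 1 + (U \<omega>)\<^sup>2"])
  show "integrable M (\<lambda>\<omega>. 1 + (U \<omega>)\<^sup>2)" using assms by simp
  have "\<bar>x\<bar> \<le> 1 + x\<^sup>2" for x :: real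
    using sum_squares_bound[of 1 "\<bar>x\<bar>"] by simp
  thus "AE \<omega> in M. norm (U \<omega>) \<le> norm (1 + (U \<omega>)\<^sup>2)" by (auto intro!: AE_I2)
qed (use assms in auto)

lemma integrable_mult_of_squares:
  fixes U V :: "'a \<Rightarrow> real"
  assumes "U \<in> borel_measurable M" "integrable M (\<lambda>\<omega>. (U \<omega>)\<^sup>2)"
      and "V \<in> borel_measurable M" "integrable M (\<lambda>\<omega>. (V \<omega>)\<^sup>2)"
  shows "integrable M (\<lambda>\<omega>. U \<omega> * V \<omega>)"
proof (rule Bochner_Integration.integrable_bound[of _ "\<lambda>\<omega>. (U \<omega>)\<^sup>2 + (V \<omega>)\<^sup>2"])
  have "\<bar>x * y\<bar> \<le> x\<^sup>2 + y\<^sup>2" for x y :: real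
    using sum_squares_bound[of "\<bar>x\<bar>" "\<bar>y\<bar>"] abs_ge_zero[of "x*y"]
    unfolding abs_mult power2_abs by linarith
  thus "AE \<omega> in M. norm (U \<omega> * V \<omega>) \<le> norm ((U \<omega>)\<^sup>2 + (V \<omega>)\<^sup>2)" by (auto intro!: AE_I2)
qed (use assms in auto)

text \<open>The Taylor remainder of \<open>cis\<close> at first order is at most (s - t)^2 U^2 / 2;
  integrability of U^2 and boundedness of \<open>G\<close> turn this into the quadratic remainder
  required above.\<close>

lemma has_vector_derivative_expectation_cis:
  fixes U :: "'a \<Rightarrow> real"
  assumes U[measurable]: "U \<in> borel_measurable M" and U2: "integrable M (\<lambda>\<omega>. (U \<omega>)\<^sup>2)"
    and G: "bdd_rv G"
  shows "((\<lambda>s. expectation (\<lambda>\<omega>. cis (s * U \<omega>) * G \<omega>)) has_vector_derivative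
          \<i> * expectation (\<lambda>\<omega>. of_real (U \<omega>) * (cis (t * U \<omega>) * G \<omega>))) (at t)"
proof -
  obtain B where B: "\<And>\<omega>. cmod (G \<omega>) \<le> B" using G by (auto simp: bdd_rv_def)
  have Gm[measurable]: "G \<in> borel_measurable M" using G by (rule bdd_rv_measurable)
  have U1: "integrable M U" using U U2 by (rule integrable_of_square)
  have i1: "integrable M (\<lambda>\<omega>. cis (s * U \<omega>) * G \<omega>)" for s
    by (intro bdd_rv_integrable bdd_rv_intros G) auto
  have i2: "integrable M (\<lambda>\<omega>. of_real (U \<omega>) * (cis (s * U \<omega>) * G \<omega>))" for s
    by (intro integrable_mult_bdd_rv U1 bdd_rv_intros G) auto
  show ?thesis
  proof (rule has_vector_derivativeI_quadratic)
    fix s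
    let ?R = "\<lambda>\<omega>. cis (s * U \<omega>) * G \<omega> - cis (t * U \<omega>) * G \<omega> -
                (s - t) *\<^sub>R (\<i> * (of_real (U \<omega>) * (cis (t * U \<omega>) * G \<omega>)))"
    have eq: "?R \<omega> = cis (t * U \<omega>) * G \<omega> * (cis ((s - t) * U \<omega>) - 1 - \<i> * of_real ((s - t) * U \<omega>))" for \<omega>
    proof -
      have "cis (s * U \<omega>) = cis (t * U \<omega>) * cis ((s - t) * U \<omega>)"
        by (simp add: cis_mult algebra_simps)
      thus ?thesis by (simp add: algebra_simps scaleR_conv_of_real)
    qed
    have bd: "cmod (?R \<omega>) \<le> B * (s - t)\<^sup>2 / 2 * (U \<omega>)\<^sup>2" for \<omega>
    proof -
      have "cmod (?R \<omega>) = cmod (G \<omega>) * cmod (cis ((s - t) * U \<omega>) - 1 - \<i> * of_real ((s - t) * U \<omega>))"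
        unfolding eq by (simp add: norm_mult)
      also have "\<dots> \<le> B * (((s - t) * U \<omega>)\<^sup>2 / 2)"
        by (intro mult_mono B norm_cis_taylor1 order_trans[OF norm_ge_zero B]) auto
      finally show ?thesis by (simp add: power_mult_distrib)
    qed
    have "expectation (\<lambda>\<omega>. cis (s * U \<omega>) * G \<omega>) - expectation (\<lambda>\<omega>. cis (t * U \<omega>) * G \<omega>) -
         (s - t) *\<^sub>R (\<i> * expectation (\<lambda>\<omega>. of_real (U \<omega>) * (cis (t * U \<omega>) * G \<omega>))) = expectation ?R"
      using i1[of s] i1[of t] i2[of t] by simp
    also have "cmod \<dots> \<le> expectation (\<lambda>\<omega>. B * (s - t)\<^sup>2 / 2 * (U \<omega>)\<^sup>2)"
      by (rule norm_integral_le)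
        (use i1[of s] i1[of t] i2[of t] U2 bd in auto)
    also have "\<dots> = (B / 2 * expectation (\<lambda>\<omega>. (U \<omega>)\<^sup>2)) * (s - t)\<^sup>2" by simp
    finally show "cmod (expectation (\<lambda>\<omega>. cis (s * U \<omega>) * G \<omega>) - expectation (\<lambda>\<omega>. cis (t * U \<omega>) * G \<omega>) -
         (s - t) *\<^sub>R (\<i> * expectation (\<lambda>\<omega>. of_real (U \<omega>) * (cis (t * U \<omega>) * G \<omega>))))
         \<le> (B / 2 * expectation (\<lambda>\<omega>. (U \<omega>)\<^sup>2)) * (s - t)\<^sup>2" .
  qed
qed

end

text \<open>Gaussianity is encoded by closure under linear combinations and the characteristic
  function at argument 1; scaling gives all other arguments, and the form of the exponent makes the
  elements centred. Variances may be 0.\<close>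

locale gaussian_space = prob_space M for M :: "'a measure" +
  fixes H :: "('a \<Rightarrow> real) set"
  assumes H_add: "X \<in> H \<Longrightarrow> Y \<in> H \<Longrightarrow> (\<lambda>\<omega>. X \<omega> + Y \<omega>) \<in> H"
    and H_scale: "X \<in> H \<Longrightarrow> (\<lambda>\<omega>. c * X \<omega>) \<in> H"
    and H_measurable: "X \<in> H \<Longrightarrow> X \<in> borel_measurable M"
    and H_square: "X \<in> H \<Longrightarrow> integrable M (\<lambda>\<omega>. (X \<omega>)\<^sup>2)"
    and H_char: "X \<in> H \<Longrightarrow> expectation (\<lambda>\<omega>. cis (X \<omega>)) = of_real (exp (- expectation (\<lambda>\<omega>. (X \<omega>)\<^sup>2) / 2))"
begin

text \<open>No means are subtracted, since elements of \<open>H\<close> are centred.\<close>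

definition cov :: "('a \<Rightarrow> real) \<Rightarrow> ('a \<Rightarrow> real) \<Rightarrow> real" where
  "cov X Y = expectation (\<lambda>\<omega>. X \<omega> * Y \<omega>)"

lemma H_diff: "X \<in> H \<Longrightarrow> Y \<in> H \<Longrightarrow> (\<lambda>\<omega>. X \<omega> - Y \<omega>) \<in> H"
  using H_add[of X "\<lambda>\<omega>. (-1) * Y \<omega>"] H_scale[of Y "-1"] by simp

lemma H_integrable: "X \<in> H \<Longrightarrow> integrable M X"
  by (rule integrable_of_square[OF H_measurable H_square])

lemma H_integrable_mult: "X \<in> H \<Longrightarrow> Y \<in> H \<Longrightarrow> integrable M (\<lambda>\<omega>. X \<omega> * Y \<omega>)"
  by (rule integrable_mult_of_squares[OF H_measurable H_square H_measurable H_square])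

lemma cov_commute: "cov X Y = cov Y X"
  by (simp add: cov_def mult.commute)

lemma cov_add: "X \<in> H \<Longrightarrow> Y \<in> H \<Longrightarrow> Z \<in> H \<Longrightarrow> cov (\<lambda>\<omega>. X \<omega> + Y \<omega>) Z = cov X Z + cov Y Z"
  unfolding cov_def by (simp add: distrib_right H_integrable_mult)

lemma cov_scale: "X \<in> H \<Longrightarrow> Y \<in> H \<Longrightarrow> cov (\<lambda>\<omega>. c * X \<omega>) Y = c * cov X Y"
  unfolding cov_def by (simp add: mult.assoc H_integrable_mult)

lemma cov_add_right: "X \<in> H \<Longrightarrow> Y \<in> H \<Longrightarrow> Z \<in> H \<Longrightarrow> cov Z (\<lambda>\<omega>. X \<omega> + Y \<omega>) = cov Z X + cov Z Y"
  unfolding cov_def by (simp add: distrib_left H_integrable_mult)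

lemma cov_scale_right: "X \<in> H \<Longrightarrow> Y \<in> H \<Longrightarrow> cov Y (\<lambda>\<omega>. c * X \<omega>) = c * cov Y X"
  unfolding cov_def by (simp add: mult.left_commute H_integrable_mult)

lemma cov_diff: "X \<in> H \<Longrightarrow> Y \<in> H \<Longrightarrow> Z \<in> H \<Longrightarrow> cov (\<lambda>\<omega>. X \<omega> - Y \<omega>) Z = cov X Z - cov Y Z"
  unfolding cov_def by (simp add: left_diff_distrib H_integrable_mult)

lemma cov_diff_right: "X \<in> H \<Longrightarrow> Y \<in> H \<Longrightarrow> Z \<in> H \<Longrightarrow> cov Z (\<lambda>\<omega>. X \<omega> - Y \<omega>) = cov Z X - cov Z Y"
  unfolding cov_def by (simp add: right_diff_distrib H_integrable_mult)

lemmas cov_simps = cov_add cov_add_right cov_diff cov_diff_right cov_scale cov_scale_right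

lemma cov_self_nonneg: "0 \<le> cov X X"
  unfolding cov_def by (rule integral_nonneg_AE) simp

lemma expectation_cis: "X \<in> H \<Longrightarrow> expectation (\<lambda>\<omega>. cis (X \<omega>)) = of_real (exp (- cov X X / 2))"
  by (simp add: H_char cov_def power2_eq_square)

lemma H_integrable_cos: "X \<in> H \<Longrightarrow> integrable M (\<lambda>\<omega>. cos (X \<omega>))"
  using H_measurable[of X] by (auto intro!: integrable_const_bound[of _ 1])

lemma expectation_cos: assumes "X \<in> H" shows "expectation (\<lambda>\<omega>. cos (X \<omega>)) = exp (- cov X X / 2)"
proof -
  have "integrable M (\<lambda>\<omega>. cis (X \<omega>))"
    by (intro bdd_rv_integrable bdd_rv_cis H_measurable assms)
  hence "Re (expectation (\<lambda>\<omega>. cis (X \<omega>))) = expectation (\<lambda>\<omega>. Re (cis (X \<omega>)))"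
    by (rule integral_Re[symmetric])
  thus ?thesis using expectation_cis[OF assms] by simp
qed

text \<open>Stein's identity for a single exponential, read off from the characteristic function of V + s U.\<close>

lemma expectation_mult_cis:
  assumes U: "U \<in> H" and V: "V \<in> H"
  shows "expectation (\<lambda>\<omega>. of_real (U \<omega>) * cis (V \<omega>)) = \<i> * of_real (cov U V * exp (- cov V V / 2))"
proof -
  note [measurable] = H_measurable[OF U] H_measurable[OF V]
  let ?f = "\<lambda>s. expectation (\<lambda>\<omega>. cis (s * U \<omega>) * cis (V \<omega>))"
  let ?g = "\<lambda>s. exp (- (s * s * cov U U + 2 * s * cov U V + cov V V) / 2)"
  have d1: "(?f has_vector_derivative \<i> * expectation (\<lambda>\<omega>. of_real (U \<omega>) * (cis (0 * U \<omega>) * cis (V \<omega>)))) (at 0)"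
    by (rule has_vector_derivative_expectation_cis) (auto intro!: H_square U bdd_rv_cis)
  have fg: "?f s = of_real (?g s)" for s
  proof -
    have "?f s = expectation (\<lambda>\<omega>. cis (s * U \<omega> + V \<omega>))" by (simp add: cis_mult)
    also have "\<dots> = of_real (exp (- cov (\<lambda>\<omega>. s * U \<omega> + V \<omega>) (\<lambda>\<omega>. s * U \<omega> + V \<omega>) / 2))"
      by (intro expectation_cis H_add H_scale U V)
    also have "cov (\<lambda>\<omega>. s * U \<omega> + V \<omega>) (\<lambda>\<omega>. s * U \<omega> + V \<omega>) = s * s * cov U U + 2 * s * cov U V + cov V V"
      using U V by (simp add: cov_simps H_scale H_add cov_commute[of V U] algebra_simps)
    finally show ?thesis by simp
  qed
  have "(?g has_real_derivative (- cov U V * exp (- cov V V / 2))) (at 0)"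
    by (auto intro!: derivative_eq_intros)
  hence "(?g has_vector_derivative (- cov U V * exp (- cov V V / 2))) (at 0)"
    by (simp add: has_real_derivative_iff_has_vector_derivative)
  hence "((\<lambda>s. complex_of_real (?g s)) has_vector_derivative of_real (- cov U V * exp (- cov V V / 2))) (at 0)"
    by (rule bounded_linear.has_vector_derivative[OF bounded_linear_of_real])
  hence "(?f has_vector_derivative of_real (- cov U V * exp (- cov V V / 2))) (at 0)"
    unfolding fg .
  from vector_derivative_unique_at[OF d1 this]
  have "\<i> * expectation (\<lambda>\<omega>. of_real (U \<omega>) * cis (V \<omega>)) = of_real (- cov U V * exp (- cov V V / 2))"
    by simp
  \<comment> \<open>A second factor i turns the left side into minus the wanted expectation.\<close>
  hence "\<i> * (\<i> * expectation (\<lambda>\<omega>. of_real (U \<omega>) * cis (V \<omega>))) = \<i> * of_real (- cov U V * exp (- cov V V / 2))"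
    by simp
  thus ?thesis by simp
qed

end

context gaussian_space
begin

text \<open>Here G' plays the role of the derivative of G in direction U; quantifying over the factor
  cis V makes the property stable under products with trigonometric functions.\<close>

definition ibp :: "('a \<Rightarrow> real) \<Rightarrow> ('a \<Rightarrow> complex) \<Rightarrow> ('a \<Rightarrow> complex) \<Rightarrow> bool" where
  "ibp U G G' \<longleftrightarrow> bdd_rv G \<and> bdd_rv G' \<and>
     (\<forall>V\<in>H. expectation (\<lambda>\<omega>. of_real (U \<omega>) * (cis (V \<omega>) * G \<omega>)) =
            expectation (\<lambda>\<omega>. cis (V \<omega>) * (G' \<omega> + \<i> * of_real (cov U V) * G \<omega>)))"

lemma ibp_bdd_rv: "ibp U G G' \<Longrightarrow> bdd_rv G" "ibp U G G' \<Longrightarrow> bdd_rv G'"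
  by (simp_all add: ibp_def)

lemma ibp_one:
  assumes U: "U \<in> H" shows "ibp U (\<lambda>\<omega>. 1) (\<lambda>\<omega>. 0)"
proof -
  have "expectation (\<lambda>\<omega>. of_real (U \<omega>) * (cis (V \<omega>) * 1)) =
            expectation (\<lambda>\<omega>. cis (V \<omega>) * (0 + \<i> * of_real (cov U V) * 1))" if V: "V \<in> H" for V
  proof -
    have "integrable M (\<lambda>\<omega>. cis (V \<omega>))" by (intro bdd_rv_integrable bdd_rv_cis H_measurable V)
    thus ?thesis using expectation_mult_cis[OF U V] expectation_cis[OF V] by simp
  qed
  thus ?thesis by (simp add: ibp_def)
qed

lemma ibp_add:
  assumes U: "U \<in> H" and F: "ibp U F F'" and G: "ibp U G G'"
  shows "ibp U (\<lambda>\<omega>. F \<omega> + G \<omega>) (\<lambda>\<omega>. F' \<omega> + G' \<omega>)"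
proof -
  note b = ibp_bdd_rv[OF F] ibp_bdd_rv[OF G]
  have "expectation (\<lambda>\<omega>. of_real (U \<omega>) * (cis (V \<omega>) * (F \<omega> + G \<omega>))) =
        expectation (\<lambda>\<omega>. cis (V \<omega>) * ((F' \<omega> + G' \<omega>) + \<i> * of_real (cov U V) * (F \<omega> + G \<omega>)))"
    if V: "V \<in> H" for V
  proof -
    have i: "integrable M (\<lambda>\<omega>. of_real (U \<omega>) * (cis (V \<omega>) * F \<omega>))"
         "integrable M (\<lambda>\<omega>. of_real (U \<omega>) * (cis (V \<omega>) * G \<omega>))"
      by (intro integrable_mult_bdd_rv H_integrable bdd_rv_intros b U H_measurable V)+
    have j: "integrable M (\<lambda>\<omega>. cis (V \<omega>) * (F' \<omega> + \<i> * of_real (cov U V) * F \<omega>))"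
         "integrable M (\<lambda>\<omega>. cis (V \<omega>) * (G' \<omega> + \<i> * of_real (cov U V) * G \<omega>))"
      by (intro bdd_rv_integrable bdd_rv_intros b H_measurable V)+
    have "expectation (\<lambda>\<omega>. of_real (U \<omega>) * (cis (V \<omega>) * (F \<omega> + G \<omega>))) =
       expectation (\<lambda>\<omega>. of_real (U \<omega>) * (cis (V \<omega>) * F \<omega>) + of_real (U \<omega>) * (cis (V \<omega>) * G \<omega>))"
      by (simp add: algebra_simps)
    also have "\<dots> = expectation (\<lambda>\<omega>. cis (V \<omega>) * (F' \<omega> + \<i> * of_real (cov U V) * F \<omega>) +
        cis (V \<omega>) * (G' \<omega> + \<i> * of_real (cov U V) * G \<omega>))"
      using F G V unfolding ibp_def
      by (simp only: Bochner_Integration.integral_add[OF i] Bochner_Integration.integral_add[OF j])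
    finally show ?thesis by (simp add: algebra_simps)
  qed
  thus ?thesis unfolding ibp_def using b by (auto intro: bdd_rv_add)
qed

lemma ibp_scale:
  assumes U: "U \<in> H" and G: "ibp U G G'"
  shows "ibp U (\<lambda>\<omega>. c * G \<omega>) (\<lambda>\<omega>. c * G' \<omega>)"
proof -
  note b = ibp_bdd_rv[OF G]
  have "expectation (\<lambda>\<omega>. of_real (U \<omega>) * (cis (V \<omega>) * (c * G \<omega>))) =
        expectation (\<lambda>\<omega>. cis (V \<omega>) * ((c * G' \<omega>) + \<i> * of_real (cov U V) * (c * G \<omega>)))"
    if V: "V \<in> H" for V
  proof -
    have "expectation (\<lambda>\<omega>. of_real (U \<omega>) * (cis (V \<omega>) * (c * G \<omega>))) =
       expectation (\<lambda>\<omega>. c * (of_real (U \<omega>) * (cis (V \<omega>) * G \<omega>)))" by (simp add: algebra_simps)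
    also have "\<dots> = c * expectation (\<lambda>\<omega>. of_real (U \<omega>) * (cis (V \<omega>) * G \<omega>))"
      by (rule integral_mult_right_zero)
    also have "\<dots> = c * expectation (\<lambda>\<omega>. cis (V \<omega>) * (G' \<omega> + \<i> * of_real (cov U V) * G \<omega>))"
      using G V by (simp add: ibp_def)
    also have "\<dots> = expectation (\<lambda>\<omega>. c * (cis (V \<omega>) * (G' \<omega> + \<i> * of_real (cov U V) * G \<omega>)))"
      by (rule integral_mult_right_zero[symmetric])
    finally show ?thesis by (simp add: algebra_simps)
  qed
  thus ?thesis unfolding ibp_def using b by (auto intro: bdd_rv_mult)
qed

lemma ibp_zero: "U \<in> H \<Longrightarrow> ibp U (\<lambda>\<omega>. 0) (\<lambda>\<omega>. 0)"
  using ibp_scale[OF _ ibp_one, of U 0] by simp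

lemma ibp_sum:
  assumes "U \<in> H" "\<And>i. i \<in> I \<Longrightarrow> ibp U (F i) (F' i)"
  shows "ibp U (\<lambda>\<omega>. \<Sum>i\<in>I. F i \<omega>) (\<lambda>\<omega>. \<Sum>i\<in>I. F' i \<omega>)"
  using assms(2) by (induction I rule: infinite_finite_induct) (auto intro: ibp_add ibp_zero assms(1))

text \<open>The factor \<open>cis W\<close> is merged into the test factor: \<open>V + W\<close>
  lies in \<open>H\<close>, and bilinearity of \<open>cov\<close> separates the two
  contributions.\<close>

lemma ibp_cis:
  assumes U: "U \<in> H" and G: "ibp U G G'" and W: "W \<in> H"
  shows "ibp U (\<lambda>\<omega>. cis (W \<omega>) * G \<omega>) (\<lambda>\<omega>. cis (W \<omega>) * (G' \<omega> + \<i> * of_real (cov U W) * G \<omega>))"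
proof -
  note b = ibp_bdd_rv[OF G]
  have "expectation (\<lambda>\<omega>. of_real (U \<omega>) * (cis (V \<omega>) * (cis (W \<omega>) * G \<omega>))) =
        expectation (\<lambda>\<omega>. cis (V \<omega>) * (cis (W \<omega>) * (G' \<omega> + \<i> * of_real (cov U W) * G \<omega>)
          + \<i> * of_real (cov U V) * (cis (W \<omega>) * G \<omega>)))"
    if V: "V \<in> H" for V
  proof -
    have "expectation (\<lambda>\<omega>. of_real (U \<omega>) * (cis (V \<omega>) * (cis (W \<omega>) * G \<omega>))) =
          expectation (\<lambda>\<omega>. of_real (U \<omega>) * (cis (V \<omega> + W \<omega>) * G \<omega>))"
      by (simp add: cis_mult[symmetric] mult.assoc)
    also have "\<dots> = expectation (\<lambda>\<omega>. cis (V \<omega> + W \<omega>) * (G' \<omega> + \<i> * of_real (cov U (\<lambda>\<omega>. V \<omega> + W \<omega>)) * G \<omega>))"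
      using G H_add[OF V W] by (simp add: ibp_def)
    also have "cov U (\<lambda>\<omega>. V \<omega> + W \<omega>) = cov U V + cov U W"
      using U V W by (simp add: cov_simps)
    finally show ?thesis by (simp add: cis_mult[symmetric] algebra_simps)
  qed
  thus ?thesis unfolding ibp_def using b by (auto intro!: bdd_rv_intros H_measurable W)
qed

lemma ibp_cos:
  assumes U: "U \<in> H" and G: "ibp U G G'" and W: "W \<in> H"
  shows "ibp U (\<lambda>\<omega>. of_real (cos (W \<omega>)) * G \<omega>)
     (\<lambda>\<omega>. of_real (cos (W \<omega>)) * G' \<omega> - of_real (cov U W) * of_real (sin (W \<omega>)) * G \<omega>)"
proof -
  have W': "(\<lambda>\<omega>. (-1) * W \<omega>) \<in> H" using W by (rule H_scale)
  have c: "cov U (\<lambda>\<omega>. (-1) * W \<omega>) = - cov U W" using cov_scale_right[OF W U, of "-1"] by simp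
  have "ibp U (\<lambda>\<omega>. (1/2) * (cis (W \<omega>) * G \<omega> + cis ((-1) * W \<omega>) * G \<omega>))
     (\<lambda>\<omega>. (1/2) * (cis (W \<omega>) * (G' \<omega> + \<i> * of_real (cov U W) * G \<omega>) +
       cis ((-1) * W \<omega>) * (G' \<omega> + \<i> * of_real (cov U (\<lambda>\<omega>. (-1) * W \<omega>)) * G \<omega>)))"
    by (intro ibp_scale ibp_add ibp_cis U G W W')
  moreover have "(1/2) * (cis w * g + cis ((-1) * w) * g) = of_real (cos w) * g" for w g
    by (simp add: complex_eq_iff field_simps)
  moreover have "(1/2) * (cis w * (g' + \<i> * of_real r * g) + cis ((-1) * w) * (g' + \<i> * of_real (-r) * g))
     = of_real (cos w) * g' - of_real r * of_real (sin w) * g" for w g g' r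
    by (simp add: complex_eq_iff field_simps)
  ultimately show ?thesis unfolding c by (simp only:)
qed

lemma ibp_sin:
  assumes U: "U \<in> H" and G: "ibp U G G'" and W: "W \<in> H"
  shows "ibp U (\<lambda>\<omega>. of_real (sin (W \<omega>)) * G \<omega>)
     (\<lambda>\<omega>. of_real (sin (W \<omega>)) * G' \<omega> + of_real (cov U W) * of_real (cos (W \<omega>)) * G \<omega>)"
proof -
  have W': "(\<lambda>\<omega>. (-1) * W \<omega>) \<in> H" using W by (rule H_scale)
  have c: "cov U (\<lambda>\<omega>. (-1) * W \<omega>) = - cov U W" using cov_scale_right[OF W U, of "-1"] by simp
  have "ibp U (\<lambda>\<omega>. (-\<i>/2) * (cis (W \<omega>) * G \<omega> + (-1) * (cis ((-1) * W \<omega>) * G \<omega>)))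
     (\<lambda>\<omega>. (-\<i>/2) * (cis (W \<omega>) * (G' \<omega> + \<i> * of_real (cov U W) * G \<omega>) +
       (-1) * (cis ((-1) * W \<omega>) * (G' \<omega> + \<i> * of_real (cov U (\<lambda>\<omega>. (-1) * W \<omega>)) * G \<omega>))))"
    by (intro ibp_scale ibp_add ibp_cis U G W W')
  moreover have "(-\<i>/2) * (cis w * g + (-1) * (cis ((-1) * w) * g)) = of_real (sin w) * g" for w g
    by (simp add: complex_eq_iff field_simps)
  moreover have "(-\<i>/2) * (cis w * (g' + \<i> * of_real r * g) + (-1) * (cis ((-1) * w) * (g' + \<i> * of_real (-r) * g)))
     = of_real (sin w) * g' + of_real r * of_real (cos w) * g" for w g g' r
    by (simp add: complex_eq_iff field_simps)
  ultimately show ?thesis unfolding c by (simp only:)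
qed

lemma ibp_expectation:
  assumes U: "U \<in> H" and G: "ibp U G G'"
  shows "expectation (\<lambda>\<omega>. of_real (U \<omega>) * G \<omega>) = expectation G'"
proof -
  \<comment> \<open>A zero element of \<open>H\<close> is produced by scaling \<open>U\<close>; as
    test variable it makes the factor \<open>cis V\<close> equal to 1.\<close>
  have 0: "(\<lambda>\<omega>. 0 * U \<omega>) \<in> H" by (rule H_scale[OF U])
  have c: "cov U (\<lambda>\<omega>. 0 * U \<omega>) = 0" by (simp add: cov_def)
  have "expectation (\<lambda>\<omega>. of_real (U \<omega>) * (cis (0 * U \<omega>) * G \<omega>)) =
            expectation (\<lambda>\<omega>. cis (0 * U \<omega>) * (G' \<omega> + \<i> * of_real (cov U (\<lambda>\<omega>. 0 * U \<omega>)) * G \<omega>))"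
    by (rule bspec[OF conjunct2[OF conjunct2[OF G[unfolded ibp_def]]] 0])
  thus ?thesis unfolding c by simp
qed

text \<open>Dominated convergence: the side containing \<open>U\<close> is dominated by a multiple
  of |U|, the other one by a constant. This carries the property from polynomials in a trigonometric
  functional to its exponential.\<close>

lemma ibp_limit:
  assumes U: "U \<in> H" and G: "\<And>n. ibp U (G n) (G' n)"
    and B: "\<And>n \<omega>. cmod (G n \<omega>) \<le> B" "\<And>n \<omega>. cmod (G' n \<omega>) \<le> B"
    and lim: "\<And>\<omega>. (\<lambda>n. G n \<omega>) \<longlonglongrightarrow> F \<omega>" "\<And>\<omega>. (\<lambda>n. G' n \<omega>) \<longlonglongrightarrow> F' \<omega>"
  shows "ibp U F F'"
proof -
  note b = ibp_bdd_rv[OF G]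
  note [measurable] = bdd_rv_measurable[OF b(1)] bdd_rv_measurable[OF b(2)] H_measurable[OF U]
  have FB: "cmod (F \<omega>) \<le> B" "cmod (F' \<omega>) \<le> B" for \<omega>
    using LIMSEQ_le_const2[OF tendsto_norm[OF lim(1)[of \<omega>]], of B]
      LIMSEQ_le_const2[OF tendsto_norm[OF lim(2)[of \<omega>]], of B] B by auto
  have [measurable]: "F \<in> borel_measurable M" "F' \<in> borel_measurable M"
    by (rule borel_measurable_LIMSEQ_metric[OF _ lim(1)], measurable)
      (rule borel_measurable_LIMSEQ_metric[OF _ lim(2)], measurable)
  have bF: "bdd_rv F" "bdd_rv F'" using FB by (auto simp: bdd_rv_def)
  have "expectation (\<lambda>\<omega>. of_real (U \<omega>) * (cis (V \<omega>) * F \<omega>)) =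
        expectation (\<lambda>\<omega>. cis (V \<omega>) * (F' \<omega> + \<i> * of_real (cov U V) * F \<omega>))"
    if V: "V \<in> H" for V
  proof -
    note [measurable] = H_measurable[OF V]
    have 1: "(\<lambda>n. expectation (\<lambda>\<omega>. of_real (U \<omega>) * (cis (V \<omega>) * G n \<omega>))) \<longlonglongrightarrow>
          expectation (\<lambda>\<omega>. of_real (U \<omega>) * (cis (V \<omega>) * F \<omega>))"
    proof (rule integral_dominated_convergence[where w="\<lambda>\<omega>. B * \<bar>U \<omega>\<bar>"])
      show "integrable M (\<lambda>\<omega>. B * \<bar>U \<omega>\<bar>)" using H_integrable[OF U] by simp
      show "AE \<omega> in M. cmod (of_real (U \<omega>) * (cis (V \<omega>) * G n \<omega>)) \<le> B * \<bar>U \<omega>\<bar>" for n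
        using B(1)[of n] by (auto simp: norm_mult mult.commute[of B] intro!: mult_left_mono)
    qed (auto intro!: tendsto_intros lim)
    have 2: "(\<lambda>n. expectation (\<lambda>\<omega>. cis (V \<omega>) * (G' n \<omega> + \<i> * of_real (cov U V) * G n \<omega>))) \<longlonglongrightarrow>
          expectation (\<lambda>\<omega>. cis (V \<omega>) * (F' \<omega> + \<i> * of_real (cov U V) * F \<omega>))"
    proof (rule integral_dominated_convergence[where w="\<lambda>\<omega>. B + \<bar>cov U V\<bar> * B"])
      show "AE \<omega> in M. cmod (cis (V \<omega>) * (G' n \<omega> + \<i> * of_real (cov U V) * G n \<omega>)) \<le> B + \<bar>cov U V\<bar> * B" for n
        using B by (auto simp: norm_mult intro!: AE_I2 norm_triangle_le add_mono mult_left_mono)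
    qed (auto intro!: tendsto_intros lim)
    have "expectation (\<lambda>\<omega>. of_real (U \<omega>) * (cis (V \<omega>) * G n \<omega>)) =
       expectation (\<lambda>\<omega>. cis (V \<omega>) * (G' n \<omega> + \<i> * of_real (cov U V) * G n \<omega>))" for n
      using G V by (auto simp: ibp_def)
    from LIMSEQ_unique[OF 1[unfolded this] 2] show ?thesis .
  qed
  thus ?thesis using bF by (simp add: ibp_def)
qed

text \<open>The constants centre trig, and dtrig S a U W is its derivative in direction W.\<close>

definition trig :: "'s set \<Rightarrow> ('s \<Rightarrow> real) \<Rightarrow> ('s \<Rightarrow> 'a \<Rightarrow> real) \<Rightarrow> 'a \<Rightarrow> real" where
  "trig S a U \<omega> = (\<Sum>s\<in>S. a s * (cos (U s \<omega>) - exp (- cov (U s) (U s) / 2)))"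

definition dtrig :: "'s set \<Rightarrow> ('s \<Rightarrow> real) \<Rightarrow> ('s \<Rightarrow> 'a \<Rightarrow> real) \<Rightarrow> ('a \<Rightarrow> real) \<Rightarrow> 'a \<Rightarrow> real" where
  "dtrig S a U W \<omega> = - (\<Sum>s\<in>S. a s * cov W (U s) * sin (U s \<omega>))"

lemma trig_measurable[measurable]:
  assumes "\<And>s. s \<in> S \<Longrightarrow> U s \<in> H"
  shows "trig S a U \<in> borel_measurable M" "dtrig S a U W \<in> borel_measurable M"
  unfolding trig_def[abs_def] dtrig_def[abs_def]
  using H_measurable[OF assms] by (auto intro!: borel_measurable_sum)

lemma cos_minus_exp_bound: "\<bar>cos x - exp (- (cov X X / 2))\<bar> \<le> 2"
proof -
  have "exp (- (cov X X / 2)) \<le> 1" using cov_self_nonneg[of X] by simp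
  thus ?thesis using abs_cos_le_one[of x] exp_gt_zero[of "- (cov X X / 2)"] by linarith
qed

lemma trig_bound: "\<bar>trig S a U \<omega>\<bar> \<le> 2 * (\<Sum>s\<in>S. \<bar>a s\<bar>)"
proof -
  have "\<bar>trig S a U \<omega>\<bar> \<le> (\<Sum>s\<in>S. \<bar>a s\<bar> * 2)"
    unfolding trig_def by (rule order_trans[OF sum_abs])
      (auto simp: abs_mult intro!: sum_mono mult_left_mono cos_minus_exp_bound)
  thus ?thesis by (simp add: sum_distrib_left mult.commute)
qed

lemma dtrig_bound: "\<bar>dtrig S a U W \<omega>\<bar> \<le> (\<Sum>s\<in>S. \<bar>a s * cov W (U s)\<bar>)"
  unfolding dtrig_def abs_minus_cancel
  by (rule order_trans[OF sum_abs])
     (auto simp: abs_mult intro!: sum_mono mult_left_le)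

lemma bdd_rv_trig:
  assumes "\<And>s. s \<in> S \<Longrightarrow> U s \<in> H"
  shows "bdd_rv (\<lambda>\<omega>. of_real (trig S a U \<omega>))" "bdd_rv (\<lambda>\<omega>. of_real (dtrig S a U W \<omega>))"
  using assms by (auto intro!: bdd_rv_of_real trig_bound dtrig_bound trig_measurable)

lemma ibp_trig_mult:
  assumes W: "W \<in> H" and U: "\<And>s. s \<in> S \<Longrightarrow> U s \<in> H" and G: "ibp W G G'"
  shows "ibp W (\<lambda>\<omega>. of_real (trig S a U \<omega>) * G \<omega>)
     (\<lambda>\<omega>. of_real (trig S a U \<omega>) * G' \<omega> + of_real (dtrig S a U W \<omega>) * G \<omega>)"
proof -
  let ?e = "\<lambda>s. complex_of_real (exp (- cov (U s) (U s) / 2))"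
  have "ibp W (\<lambda>\<omega>. \<Sum>s\<in>S. of_real (a s) * (of_real (cos (U s \<omega>)) * G \<omega> + (- ?e s) * G \<omega>))
     (\<lambda>\<omega>. \<Sum>s\<in>S. of_real (a s) * ((of_real (cos (U s \<omega>)) * G' \<omega> - of_real (cov W (U s)) * of_real (sin (U s \<omega>)) * G \<omega>) + (- ?e s) * G' \<omega>))"
    by (intro ibp_sum ibp_scale ibp_add ibp_cos W U G) auto
  moreover have "(\<Sum>s\<in>S. of_real (a s) * (of_real (cos (U s \<omega>)) * g + (- ?e s) * g)) = of_real (trig S a U \<omega>) * g" for \<omega> g
    unfolding trig_def of_real_sum sum_distrib_right by (intro sum.cong) (auto simp: algebra_simps)
  moreover have "(\<Sum>s\<in>S. of_real (a s) * ((of_real (cos (U s \<omega>)) * g' - of_real (cov W (U s)) * of_real (sin (U s \<omega>)) * g) + (- ?e s) * g'))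
     = of_real (trig S a U \<omega>) * g' + of_real (dtrig S a U W \<omega>) * g" for \<omega> g g'
    unfolding trig_def dtrig_def of_real_sum sum_distrib_right of_real_minus sum_negf[symmetric] sum.distrib[symmetric]
    by (intro sum.cong) (auto simp: algebra_simps)
  ultimately show ?thesis by simp
qed

lemma ibp_trig:
  assumes W: "W \<in> H" and U: "\<And>s. s \<in> S \<Longrightarrow> U s \<in> H"
  shows "ibp W (\<lambda>\<omega>. of_real (trig S a U \<omega>)) (\<lambda>\<omega>. of_real (dtrig S a U W \<omega>))"
  using ibp_trig_mult[where S=S and U=U and a=a, OF W U ibp_one[OF W]] by simp

lemma ibp_trig_power:
  assumes W: "W \<in> H" and U: "\<And>s. s \<in> S \<Longrightarrow> U s \<in> H"
  shows "ibp W (\<lambda>\<omega>. of_real (trig S a U \<omega>) ^ n)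
     (\<lambda>\<omega>. of_nat n * of_real (trig S a U \<omega>) ^ (n - 1) * of_real (dtrig S a U W \<omega>))"
proof (induction n)
  case 0
  then show ?case using ibp_one[OF W] by simp
next
  case (Suc n)
  have e: "of_real (trig S a U \<omega>) * (of_nat n * of_real (trig S a U \<omega>) ^ (n - 1) * of_real (dtrig S a U W \<omega>))
    + of_real (dtrig S a U W \<omega>) * of_real (trig S a U \<omega>) ^ n =
    (of_nat (Suc n) * of_real (trig S a U \<omega>) ^ (Suc n - 1) * of_real (dtrig S a U W \<omega>) :: complex)" for \<omega>
    by (cases n) (auto simp: algebra_simps)
  show ?case using ibp_trig_mult[where S=S and U=U and a=a, OF W U Suc] unfolding e by simp
qed

text \<open>The chain rule. As \<open>trig S a U\<close> is not an element of \<open>H\<close>,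
  \<open>ibp_cis\<close> does not apply; instead the exponential series is a bounded limit of
  polynomials in the functional, to which the power rule applies.\<close>

lemma ibp_cis_trig:
  assumes W: "W \<in> H" and U: "\<And>s. s \<in> S \<Longrightarrow> U s \<in> H"
  shows "ibp W (\<lambda>\<omega>. cis (\<theta> * trig S a U \<omega>))
     (\<lambda>\<omega>. \<i> * of_real \<theta> * of_real (dtrig S a U W \<omega>) * cis (\<theta> * trig S a U \<omega>))"
proof (rule ibp_limit[OF W])
  let ?z = "\<i> * complex_of_real \<theta>"
  let ?F = "\<lambda>\<omega>. complex_of_real (trig S a U \<omega>)" and ?D = "\<lambda>\<omega>. complex_of_real (dtrig S a U W \<omega>)"
  \<comment> \<open>With \<open>Suc n\<close> terms, differentiation loses the constant term and
    leaves exactly the first \<open>n\<close> terms of the same series.\<close>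
  let ?G = "\<lambda>n \<omega>. \<Sum>r<Suc n. (?z ^ r / fact r) * ?F \<omega> ^ r"
  let ?G' = "\<lambda>n \<omega>. \<Sum>r<Suc n. (?z ^ r / fact r) * (of_nat r * ?F \<omega> ^ (r - 1) * ?D \<omega>)"
  \<comment> \<open>\<open>b\<close> bounds the argument of the exponential, so \<open>exp b\<close>
    dominates all partial sums of its series; \<open>d\<close> bounds the directional
    derivative.\<close>
  define b where "b = \<bar>\<theta>\<bar> * (2 * (\<Sum>s\<in>S. \<bar>a s\<bar>))"
  define d where "d = (\<Sum>s\<in>S. \<bar>a s * cov W (U s)\<bar>)"
  have G: "?G n \<omega> = (\<Sum>r<Suc n. (?z * ?F \<omega>) ^ r /\<^sub>R fact r)" for n \<omega>
    by (intro sum.cong) (auto simp: power_mult_distrib scaleR_conv_of_real field_simps)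
  have G': "?G' n \<omega> = ?z * ?D \<omega> * (\<Sum>r<n. (?z * ?F \<omega>) ^ r /\<^sub>R fact r)" for n \<omega>
  proof -
    have "?G' n \<omega> = (\<Sum>r<n. (?z ^ Suc r / fact (Suc r)) * (of_nat (Suc r) * ?F \<omega> ^ r * ?D \<omega>))"
      by (subst sum.lessThan_Suc_shift) simp
    also have "\<dots> = (\<Sum>r<n. ?z * ?D \<omega> * ((?z * ?F \<omega>) ^ r /\<^sub>R fact r))"
    proof (intro sum.cong refl)
      fix r
      have "(of_nat (Suc r) :: complex) \<noteq> 0" using of_nat_neq_0 by blast
      thus "(?z ^ Suc r / fact (Suc r)) * (of_nat (Suc r) * ?F \<omega> ^ r * ?D \<omega>) = ?z * ?D \<omega> * ((?z * ?F \<omega>) ^ r /\<^sub>R fact r)"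
        by (simp add: power_mult_distrib scaleR_conv_of_real divide_simps del: of_nat_Suc)
    qed
    finally show ?thesis by (simp add: sum_distrib_left)
  qed
  have zF: "cmod (?z * ?F \<omega>) \<le> b" for \<omega>
    using mult_left_mono[OF trig_bound[of S a U \<omega>], of "\<bar>\<theta>\<bar>"] by (simp add: norm_mult b_def)
  have partial: "cmod (\<Sum>r<n. (?z * ?F \<omega>) ^ r /\<^sub>R fact r) \<le> exp b" for n \<omega>
  proof -
    have "cmod (\<Sum>r<n. (?z * ?F \<omega>) ^ r /\<^sub>R fact r) \<le> (\<Sum>r<n. cmod (?z * ?F \<omega>) ^ r /\<^sub>R fact r)"
      by (rule order_trans[OF norm_sum]) (simp add: norm_power norm_mult)
    also have "\<dots> \<le> (\<Sum>r. cmod (?z * ?F \<omega>) ^ r /\<^sub>R fact r)"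
      using exp_converges[of "cmod (?z * ?F \<omega>)"]
      by (intro sum_le_suminf) (auto simp: sums_iff)
    also have "\<dots> = exp (cmod (?z * ?F \<omega>))" by (simp add: exp_def)
    finally show ?thesis using zF[of \<omega>] exp_le_cancel_iff order_trans by blast
  qed
  show "ibp W (?G n) (?G' n)" for n
    by (intro ibp_sum ibp_scale ibp_trig_power W U)
  show "cmod (?G n \<omega>) \<le> exp b + \<bar>\<theta>\<bar> * d * exp b" for n \<omega>
  proof -
    have "0 \<le> \<bar>\<theta>\<bar> * d * exp b" by (auto simp: d_def intro!: mult_nonneg_nonneg sum_nonneg)
    thus ?thesis unfolding G using partial[of \<omega> "Suc n"] by linarith
  qed
  show "cmod (?G' n \<omega>) \<le> exp b + \<bar>\<theta>\<bar> * d * exp b" for n \<omega>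
  proof -
    have "cmod (?G' n \<omega>) \<le> \<bar>\<theta>\<bar> * d * exp b"
      unfolding G' norm_mult using dtrig_bound[of S a U W \<omega>] partial[of \<omega> n]
      by (intro mult_mono) (auto simp: d_def intro!: sum_nonneg)
    thus ?thesis using exp_gt_zero[of b] by linarith
  qed
  have e: "(\<lambda>n. \<Sum>r<n. (?z * ?F \<omega>) ^ r /\<^sub>R fact r) \<longlonglongrightarrow> cis (\<theta> * trig S a U \<omega>)" for \<omega>
    using exp_converges[of "?z * ?F \<omega>"] by (simp add: sums_def cis_conv_exp mult.assoc)
  show "(\<lambda>n. ?G n \<omega>) \<longlonglongrightarrow> cis (\<theta> * trig S a U \<omega>)" for \<omega>
    unfolding G using e[of \<omega>] by (rule LIMSEQ_Suc)
  show "(\<lambda>n. ?G' n \<omega>) \<longlonglongrightarrow> ?z * ?D \<omega> * cis (\<theta> * trig S a U \<omega>)" for \<omega>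
    unfolding G' by (intro tendsto_intros e)
qed

end

section \<open>Characteristic functions of trigonometric functionals\<close>

text \<open>For complex values the mean value theorem survives only as an inequality.\<close>

lemma norm_diff_le_of_vector_derivative_bound:
  fixes f :: "real \<Rightarrow> complex"
  assumes "\<And>t. t \<in> {0..1} \<Longrightarrow> (f has_vector_derivative f' t) (at t)"
    and "\<And>t. t \<in> {0..1} \<Longrightarrow> cmod (f' t) \<le> B"
  shows "cmod (f 1 - f 0) \<le> B"
proof -
  have "\<exists>x\<in>{0<..<1}. norm (f 1 - f 0) \<le> norm ((1 - 0) *\<^sub>R f' x)"
  proof (rule mvt_general)
    show "continuous_on {0..1} f"
      using has_vector_derivative_continuous[OF assms(1)] by (auto intro!: continuous_at_imp_continuous_on)
    show "\<And>x. 0 < x \<Longrightarrow> x < 1 \<Longrightarrow> (f has_derivative (\<lambda>h. h *\<^sub>R f' x)) (at x)"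
      using assms(1) by (auto simp: has_vector_derivative_def)
  qed simp
  then obtain x where "x \<in> {0<..<1}" "cmod (f 1 - f 0) \<le> cmod (f' x)" by auto
  thus ?thesis using assms(2)[of x] by auto
qed

text \<open>Follows from the nonnegative variance of |X|.\<close>

lemma (in prob_space) expectation_abs_le_of_square:
  fixes X :: "'a \<Rightarrow> real"
  assumes X: "X \<in> borel_measurable M" "integrable M (\<lambda>\<omega>. (X \<omega>)\<^sup>2)"
    and le: "expectation (\<lambda>\<omega>. (X \<omega>)\<^sup>2) \<le> \<delta>\<^sup>2" and \<delta>: "0 \<le> \<delta>"
  shows "expectation (\<lambda>\<omega>. \<bar>X \<omega>\<bar>) \<le> \<delta>"
proof -
  have i: "integrable M (\<lambda>\<omega>. \<bar>X \<omega>\<bar>)" using integrable_of_square[OF X] by simp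
  let ?m = "expectation (\<lambda>\<omega>. \<bar>X \<omega>\<bar>)"
  have "0 \<le> expectation (\<lambda>\<omega>. (\<bar>X \<omega>\<bar> - ?m)\<^sup>2)" by (rule integral_nonneg_AE) simp
  also have "\<dots> = expectation (\<lambda>\<omega>. (X \<omega>)\<^sup>2 - 2 * ?m * \<bar>X \<omega>\<bar> + ?m\<^sup>2)"
    by (simp add: power2_diff algebra_simps)
  also have "\<dots> = expectation (\<lambda>\<omega>. (X \<omega>)\<^sup>2) - 2 * ?m * ?m + ?m\<^sup>2"
    using X i by (simp add: prob_space)
  finally have "?m\<^sup>2 \<le> \<delta>\<^sup>2" using le by (simp add: power2_eq_square)
  thus ?thesis using \<delta> by (rule power2_le_imp_le)
qed

context gaussian_space
begin

text \<open>Integrating W sin(t W) G by parts gives a sine against \<open>G'\<close> and t times the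
  variance times a cosine against \<open>G\<close>. The derivative of the Ornstein-Uhlenbeck weight
  cancels the second term, so only the derivative of \<open>G\<close> remains.\<close>

lemma has_vector_derivative_expectation_cos:
  assumes W: "W \<in> H" and G: "ibp W G G'"
  shows "((\<lambda>s. of_real (exp (- (1 - s\<^sup>2) * cov W W / 2)) * expectation (\<lambda>\<omega>. of_real (cos (s * W \<omega>)) * G \<omega>))
    has_vector_derivative
     - of_real (exp (- (1 - t\<^sup>2) * cov W W / 2)) * expectation (\<lambda>\<omega>. of_real (sin (t * W \<omega>)) * G' \<omega>)) (at t)"
proof -
  note b = ibp_bdd_rv[OF G]
  have W': "(\<lambda>\<omega>. (-1) * W \<omega>) \<in> H" using W by (rule H_scale)
  have tW: "(\<lambda>\<omega>. t * W \<omega>) \<in> H" using W by (rule H_scale)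
  note [measurable] = H_measurable[OF W] H_measurable[OF W'] bdd_rv_measurable[OF b(1)] bdd_rv_measurable[OF b(2)]
  let ?f = "\<lambda>s. expectation (\<lambda>\<omega>. cis (s * W \<omega>) * G \<omega>)"
  let ?g = "\<lambda>s. expectation (\<lambda>\<omega>. cis (s * ((-1) * W \<omega>)) * G \<omega>)"
  let ?c = "\<lambda>s. expectation (\<lambda>\<omega>. of_real (cos (s * W \<omega>)) * G \<omega>)"
  let ?D1 = "\<lambda>\<omega>. of_real (W \<omega>) * (cis (t * W \<omega>) * G \<omega>)"
  let ?D2 = "\<lambda>\<omega>. of_real ((-1) * W \<omega>) * (cis (t * ((-1) * W \<omega>)) * G \<omega>)"
  have i1: "integrable M (\<lambda>\<omega>. cis (s * W \<omega>) * G \<omega>)" "integrable M (\<lambda>\<omega>. cis (s * ((-1) * W \<omega>)) * G \<omega>)" for s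
    by (intro bdd_rv_integrable bdd_rv_intros b; measurable)+
  have i2: "integrable M ?D1" "integrable M ?D2"
    by (intro integrable_mult_bdd_rv H_integrable W W' bdd_rv_intros b; measurable)+
  have cos_eq: "?c s = (1/2) * (?f s + ?g s)" for s
  proof -
    have "(1/2) * (?f s + ?g s) = expectation (\<lambda>\<omega>. (1/2) * (cis (s * W \<omega>) * G \<omega> + cis (s * ((-1) * W \<omega>)) * G \<omega>))"
      by (simp only: integral_mult_right_zero Bochner_Integration.integral_add[OF i1])
    moreover have "(1/2) * (cis (s * x) * g + cis (s * ((-1) * x)) * g) = of_real (cos (s * x)) * g" for x g
      by (simp add: complex_eq_iff field_simps)
    ultimately show ?thesis by (simp only:)
  qed
  have sin_eq: "(1/2) * (\<i> * expectation ?D1 + \<i> * expectation ?D2) =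
     - expectation (\<lambda>\<omega>. of_real (W \<omega>) * (of_real (sin (t * W \<omega>)) * G \<omega>))"
  proof -
    have "(1/2) * (\<i> * expectation ?D1 + \<i> * expectation ?D2) = (\<i>/2) * expectation (\<lambda>\<omega>. ?D1 \<omega> + ?D2 \<omega>)"
      by (simp only: Bochner_Integration.integral_add[OF i2]) (simp add: algebra_simps)
    also have "\<dots> = expectation (\<lambda>\<omega>. (\<i>/2) * (?D1 \<omega> + ?D2 \<omega>))"
      by (rule integral_mult_right_zero[symmetric])
    finally have *: "(1/2) * (\<i> * expectation ?D1 + \<i> * expectation ?D2) = expectation (\<lambda>\<omega>. (\<i>/2) * (?D1 \<omega> + ?D2 \<omega>))" .
    have "(\<i>/2) * (of_real x * (cis (t * x) * g) + of_real ((-1) * x) * (cis (t * ((-1) * x)) * g))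
       = - (of_real x * (of_real (sin (t * x)) * g))" for x g
      by (simp add: complex_eq_iff field_simps)
    thus ?thesis unfolding * by (simp only: Bochner_Integration.integral_minus)
  qed
  have "(?f has_vector_derivative \<i> * expectation ?D1) (at t)"
    by (rule has_vector_derivative_expectation_cis) (auto intro!: H_square W b)
  moreover have "(?g has_vector_derivative \<i> * expectation ?D2) (at t)"
    by (rule has_vector_derivative_expectation_cis[OF H_measurable[OF W'] H_square[OF W'] b(1)])
  ultimately have "((\<lambda>s. (1/2) * (?f s + ?g s)) has_vector_derivative (1/2) * (\<i> * expectation ?D1 + \<i> * expectation ?D2)) (at t)"
    by (intro has_vector_derivative_mult_right has_vector_derivative_add)
  hence dc: "(?c has_vector_derivative - expectation (\<lambda>\<omega>. of_real (W \<omega>) * (of_real (sin (t * W \<omega>)) * G \<omega>))) (at t)"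
    unfolding cos_eq sin_eq .
  have i3: "integrable M (\<lambda>\<omega>. of_real (sin (t * W \<omega>)) * G' \<omega>)"
      "integrable M (\<lambda>\<omega>. of_real (t * cov W W) * of_real (cos (t * W \<omega>)) * G \<omega>)"
    by (intro bdd_rv_integrable bdd_rv_intros b; measurable)+
  have "expectation (\<lambda>\<omega>. of_real (W \<omega>) * (of_real (sin (t * W \<omega>)) * G \<omega>)) =
     expectation (\<lambda>\<omega>. of_real (sin (t * W \<omega>)) * G' \<omega> + of_real (t * cov W W) * of_real (cos (t * W \<omega>)) * G \<omega>)"
    using ibp_expectation[OF W ibp_sin[OF W G tW]] cov_scale_right[OF W W, of t] by simp
  also have "\<dots> = expectation (\<lambda>\<omega>. of_real (sin (t * W \<omega>)) * G' \<omega>) + of_real (t * cov W W) * ?c t"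
    by (subst Bochner_Integration.integral_add[OF i3]) (simp only: mult.assoc integral_mult_right_zero)
  finally have E: "expectation (\<lambda>\<omega>. of_real (W \<omega>) * (of_real (sin (t * W \<omega>)) * G \<omega>)) =
      expectation (\<lambda>\<omega>. of_real (sin (t * W \<omega>)) * G' \<omega>) + of_real (t * cov W W) * ?c t" .
  let ?w = "\<lambda>s. exp (- (1 - s\<^sup>2) * cov W W / 2)"
  have "(?w has_real_derivative t * cov W W * ?w t) (at t)"
    by (auto intro!: derivative_eq_intros)
  hence "(?w has_vector_derivative t * cov W W * ?w t) (at t)"
    by (simp add: has_real_derivative_iff_has_vector_derivative)
  hence dw: "((\<lambda>s. complex_of_real (?w s)) has_vector_derivative of_real (t * cov W W * ?w t)) (at t)"
    by (rule bounded_linear.has_vector_derivative[OF bounded_linear_of_real])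
  have "((\<lambda>s. of_real (?w s) * ?c s) has_vector_derivative
      of_real (?w t) * (- expectation (\<lambda>\<omega>. of_real (W \<omega>) * (of_real (sin (t * W \<omega>)) * G \<omega>)))
      + of_real (t * cov W W * ?w t) * ?c t) (at t)"
    by (rule has_vector_derivative_mult[OF dw dc])
  thus ?thesis unfolding E by (simp add: algebra_simps)
qed

text \<open>The Ornstein-Uhlenbeck semigroup maps cos U to exp (- (1 - t^2) v / 2) cos (t U), with v the
  variance of U; carre is the quadratic form that integration by parts produces from its t-derivative.\<close>

definition trig_interp :: "'s set \<Rightarrow> ('s \<Rightarrow> real) \<Rightarrow> ('s \<Rightarrow> 'a \<Rightarrow> real) \<Rightarrow> real \<Rightarrow> 'a \<Rightarrow> real" where
  "trig_interp S a U t \<omega> = (\<Sum>s\<in>S. a s * (exp (- (1 - t\<^sup>2) * cov (U s) (U s) / 2) * cos (t * U s \<omega>)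
      - exp (- cov (U s) (U s) / 2)))"

definition carre :: "'s set \<Rightarrow> ('s \<Rightarrow> real) \<Rightarrow> ('s \<Rightarrow> 'a \<Rightarrow> real) \<Rightarrow> real \<Rightarrow> 'a \<Rightarrow> real" where
  "carre S a U t \<omega> = - (\<Sum>s\<in>S. a s * exp (- (1 - t\<^sup>2) * cov (U s) (U s) / 2) * sin (t * U s \<omega>) * dtrig S a U (U s) \<omega>)"

lemma bdd_rv_carre:
  assumes "\<And>s. s \<in> S \<Longrightarrow> U s \<in> H"
  shows "bdd_rv (\<lambda>\<omega>. of_real (carre S a U t \<omega>))"
proof -
  have "bdd_rv (\<lambda>\<omega>. (-1) * (\<Sum>s\<in>S. of_real (a s) * of_real (exp (- (1 - t\<^sup>2) * cov (U s) (U s) / 2)) * of_real (sin (t * U s \<omega>)) * of_real (dtrig S a U (U s) \<omega>)))"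
    by (intro bdd_rv_intros bdd_rv_trig assms H_measurable H_scale)
  thus ?thesis unfolding carre_def[abs_def] by simp
qed

text \<open>At time 0 the semigroup returns the mean, which is the constant subtracted in the
  definition.\<close>

lemma trig_interp_0: "trig_interp S a U 0 \<omega> = 0"
  by (simp add: trig_interp_def)

lemma trig_interp_1: "trig_interp S a U 1 \<omega> = trig S a U \<omega>"
  by (simp add: trig_interp_def trig_def)

text \<open>\<open>K\<close> is the factor shared by all directional derivatives of
  \<open>G\<close>. With F the functional, it is 1 for G = F and i \<theta> G for G = cis(\<theta>
  F).\<close>

lemma has_vector_derivative_trig_interp:
  assumes U: "\<And>s. s \<in> S \<Longrightarrow> U s \<in> H" and G: "\<And>s. s \<in> S \<Longrightarrow> ibp (U s) G (\<lambda>\<omega>. of_real (dtrig S a U (U s) \<omega>) * K \<omega>)"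
    and K: "bdd_rv K" and bG: "bdd_rv G"
  shows "((\<lambda>t. expectation (\<lambda>\<omega>. of_real (trig_interp S a U t \<omega>) * G \<omega>)) has_vector_derivative
      expectation (\<lambda>\<omega>. of_real (carre S a U t \<omega>) * K \<omega>)) (at t)"
proof -
  let ?w = "\<lambda>s t. complex_of_real (exp (- (1 - t\<^sup>2) * cov (U s) (U s) / 2))"
  let ?e = "\<lambda>s. complex_of_real (exp (- cov (U s) (U s) / 2))"
  have eq: "expectation (\<lambda>\<omega>. of_real (trig_interp S a U r \<omega>) * G \<omega>) =
     (\<Sum>s\<in>S. of_real (a s) * (?w s r * expectation (\<lambda>\<omega>. of_real (cos (r * U s \<omega>)) * G \<omega>) - ?e s * expectation G))" for r
  proof -
    have i: "integrable M (\<lambda>\<omega>. of_real (cos (r * U s \<omega>)) * G \<omega>)" if "s \<in> S" for s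
      by (intro bdd_rv_integrable bdd_rv_intros bG H_measurable H_scale U that)
    have "expectation (\<lambda>\<omega>. of_real (trig_interp S a U r \<omega>) * G \<omega>) =
      expectation (\<lambda>\<omega>. \<Sum>s\<in>S. of_real (a s) * (?w s r * (of_real (cos (r * U s \<omega>)) * G \<omega>) - ?e s * G \<omega>))"
      unfolding trig_interp_def of_real_sum sum_distrib_right
      by (intro Bochner_Integration.integral_cong sum.cong) (auto simp: algebra_simps)
    also have "\<dots> = (\<Sum>s\<in>S. expectation (\<lambda>\<omega>. of_real (a s) * (?w s r * (of_real (cos (r * U s \<omega>)) * G \<omega>) - ?e s * G \<omega>)))"
      using i bdd_rv_integrable[OF bG] by (intro Bochner_Integration.integral_sum) auto
    also have "\<dots> = (\<Sum>s\<in>S. of_real (a s) * (?w s r * expectation (\<lambda>\<omega>. of_real (cos (r * U s \<omega>)) * G \<omega>) - ?e s * expectation G))"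
      using i bdd_rv_integrable[OF bG] by (intro sum.cong) auto
    finally show ?thesis .
  qed
  have eq': "expectation (\<lambda>\<omega>. of_real (carre S a U t \<omega>) * K \<omega>) =
     (\<Sum>s\<in>S. of_real (a s) * (- ?w s t * expectation (\<lambda>\<omega>. of_real (sin (t * U s \<omega>)) * (of_real (dtrig S a U (U s) \<omega>) * K \<omega>))))"
  proof -
    have i: "integrable M (\<lambda>\<omega>. of_real (sin (t * U s \<omega>)) * (of_real (dtrig S a U (U s) \<omega>) * K \<omega>))" if "s \<in> S" for s
      by (intro bdd_rv_integrable bdd_rv_intros bdd_rv_trig K H_measurable H_scale U that)
    have "expectation (\<lambda>\<omega>. of_real (carre S a U t \<omega>) * K \<omega>) =
      expectation (\<lambda>\<omega>. \<Sum>s\<in>S. of_real (a s) * (- ?w s t * (of_real (sin (t * U s \<omega>)) * (of_real (dtrig S a U (U s) \<omega>) * K \<omega>))))"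
      unfolding carre_def of_real_sum of_real_minus sum_negf[symmetric] sum_distrib_right
      by (intro Bochner_Integration.integral_cong sum.cong) (auto simp: algebra_simps)
    also have "\<dots> = (\<Sum>s\<in>S. expectation (\<lambda>\<omega>. of_real (a s) * (- ?w s t * (of_real (sin (t * U s \<omega>)) * (of_real (dtrig S a U (U s) \<omega>) * K \<omega>)))))"
      using i by (intro Bochner_Integration.integral_sum) auto
    also have "\<dots> = (\<Sum>s\<in>S. of_real (a s) * (- ?w s t * expectation (\<lambda>\<omega>. of_real (sin (t * U s \<omega>)) * (of_real (dtrig S a U (U s) \<omega>) * K \<omega>))))"
      by (simp only: integral_mult_right_zero)
    finally show ?thesis .
  qed
  have "((\<lambda>r. \<Sum>s\<in>S. of_real (a s) * (?w s r * expectation (\<lambda>\<omega>. of_real (cos (r * U s \<omega>)) * G \<omega>) - ?e s * expectation G))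
     has_vector_derivative (\<Sum>s\<in>S. of_real (a s) * (- ?w s t * expectation (\<lambda>\<omega>. of_real (sin (t * U s \<omega>)) * (of_real (dtrig S a U (U s) \<omega>) * K \<omega>)) - 0))) (at t)"
    by (intro has_vector_derivative_sum has_vector_derivative_mult_right has_vector_derivative_diff
        has_vector_derivative_expectation_cos U G has_vector_derivative_const)
  thus ?thesis unfolding eq eq' by simp
qed

text \<open>E[F cis(\<theta> F)] and E[F^2] are values at time 1 of interpolations that vanish at
  time 0. The derivative of their combination is i \<theta> E[(T - E T) cis(\<theta> F)] with T the
  form \<open>carre\<close>, so the standard deviation of T controls it.\<close>

lemma stein_trig:
  assumes U: "\<And>s. s \<in> S \<Longrightarrow> U s \<in> H" and \<delta>: "0 \<le> \<delta>"
    and var: "\<And>t. t \<in> {0..1} \<Longrightarrow> expectation (\<lambda>\<omega>. (carre S a U t \<omega> - expectation (carre S a U t))\<^sup>2) \<le> \<delta>\<^sup>2"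
  shows "cmod (expectation (\<lambda>\<omega>. of_real (trig S a U \<omega>) * cis (\<theta> * trig S a U \<omega>))
      - \<i> * of_real \<theta> * of_real (expectation (\<lambda>\<omega>. (trig S a U \<omega>)\<^sup>2)) * expectation (\<lambda>\<omega>. cis (\<theta> * trig S a U \<omega>)))
    \<le> \<bar>\<theta>\<bar> * \<delta>"
proof -
  let ?F = "trig S a U" and ?T = "carre S a U"
  note F[measurable] = trig_measurable(1)[OF U, of S id a, simplified]
  have bC: "bdd_rv (\<lambda>\<omega>. cis (\<theta> * ?F \<omega>))" by (intro bdd_rv_cis) measurable
  have bF: "bdd_rv (\<lambda>\<omega>. of_real (?F \<omega>))" using U by (rule bdd_rv_trig)
  have bT: "bdd_rv (\<lambda>\<omega>. of_real (?T t \<omega>))" for t using U by (rule bdd_rv_carre)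
  have iT: "integrable M (?T t)" for t
    using bdd_rv_integrable[OF bT[of t]] by (simp add: complex_of_real_integrable_eq)
  let ?\<phi> = "expectation (\<lambda>\<omega>. cis (\<theta> * ?F \<omega>))"
  \<comment> \<open>The multiple of the second interpolation is chosen so that after differentiation
    \<open>carre\<close> enters only through its deviation from its mean.\<close>
  let ?g = "\<lambda>t. expectation (\<lambda>\<omega>. of_real (trig_interp S a U t \<omega>) * cis (\<theta> * ?F \<omega>))
      - (\<i> * of_real \<theta> * ?\<phi>) * expectation (\<lambda>\<omega>. of_real (trig_interp S a U t \<omega>) * of_real (?F \<omega>))"
  let ?g' = "\<lambda>t. expectation (\<lambda>\<omega>. of_real (?T t \<omega>) * (\<i> * of_real \<theta> * cis (\<theta> * ?F \<omega>)))
      - (\<i> * of_real \<theta> * ?\<phi>) * expectation (\<lambda>\<omega>. of_real (?T t \<omega>) * 1)"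
  have d: "(?g has_vector_derivative ?g' t) (at t)" for t
  proof (intro has_vector_derivative_diff has_vector_derivative_mult_right has_vector_derivative_trig_interp)
    show "ibp (U s) (\<lambda>\<omega>. cis (\<theta> * ?F \<omega>)) (\<lambda>\<omega>. of_real (dtrig S a U (U s) \<omega>) * (\<i> * of_real \<theta> * cis (\<theta> * ?F \<omega>)))" if "s \<in> S" for s
      using ibp_cis_trig[where S=S and U=U and a=a and \<theta>=\<theta>, OF U[OF that] U] by (simp add: mult_ac)
    show "ibp (U s) (\<lambda>\<omega>. of_real (?F \<omega>)) (\<lambda>\<omega>. of_real (dtrig S a U (U s) \<omega>) * 1)" if "s \<in> S" for s
      using ibp_trig[where S=S and U=U and a=a, OF U[OF that] U] by simp
  qed (use U in \<open>auto intro!: bdd_rv_mult bC bF\<close>)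
  have bound: "cmod (?g' t) \<le> \<bar>\<theta>\<bar> * \<delta>" if t: "t \<in> {0..1}" for t
  proof -
    let ?m = "expectation (?T t)"
    note [measurable] = borel_measurable_integrable[OF iT[of t]]
    have bD: "bdd_rv (\<lambda>\<omega>. of_real (?T t \<omega> - ?m))"
      using bdd_rv_diff[OF bT[of t] bdd_rv_const[of "of_real ?m"]] by simp
    have m: "expectation (\<lambda>\<omega>. complex_of_real (?T t \<omega>) * 1) = of_real ?m" by simp
    have i1: "integrable M (\<lambda>\<omega>. complex_of_real (?T t \<omega>) * cis (\<theta> * ?F \<omega>))"
      by (intro bdd_rv_integrable bdd_rv_mult bT bC)
    have i2: "integrable M (\<lambda>\<omega>. complex_of_real ?m * cis (\<theta> * ?F \<omega>))"
      by (intro bdd_rv_integrable bdd_rv_mult bdd_rv_const bC)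
    have i3: "integrable M (\<lambda>\<omega>. complex_of_real (?T t \<omega> - ?m) * cis (\<theta> * ?F \<omega>))"
      by (intro bdd_rv_integrable bdd_rv_mult bD bC)
    have e1: "expectation (\<lambda>\<omega>. of_real (?T t \<omega>) * (\<i> * of_real \<theta> * cis (\<theta> * ?F \<omega>))) =
        \<i> * of_real \<theta> * expectation (\<lambda>\<omega>. of_real (?T t \<omega>) * cis (\<theta> * ?F \<omega>))"
      unfolding integral_mult_right_zero[symmetric] by (simp add: mult_ac)
    have e2: "expectation (\<lambda>\<omega>. of_real (?T t \<omega> - ?m) * cis (\<theta> * ?F \<omega>)) =
       expectation (\<lambda>\<omega>. of_real (?T t \<omega>) * cis (\<theta> * ?F \<omega>)) - of_real ?m * ?\<phi>"
    proof -
      have "expectation (\<lambda>\<omega>. of_real (?T t \<omega> - ?m) * cis (\<theta> * ?F \<omega>)) =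
         expectation (\<lambda>\<omega>. of_real (?T t \<omega>) * cis (\<theta> * ?F \<omega>) - of_real ?m * cis (\<theta> * ?F \<omega>))"
        by (simp add: algebra_simps)
      also have "\<dots> = expectation (\<lambda>\<omega>. of_real (?T t \<omega>) * cis (\<theta> * ?F \<omega>)) - expectation (\<lambda>\<omega>. of_real ?m * cis (\<theta> * ?F \<omega>))"
        by (rule Bochner_Integration.integral_diff[OF i1 i2])
      finally show ?thesis by (simp only: integral_mult_right_zero)
    qed
    have "?g' t = \<i> * of_real \<theta> * expectation (\<lambda>\<omega>. of_real (?T t \<omega> - ?m) * cis (\<theta> * ?F \<omega>))"
      unfolding m e1 e2 by (simp add: algebra_simps)
    hence "cmod (?g' t) = \<bar>\<theta>\<bar> * cmod (expectation (\<lambda>\<omega>. of_real (?T t \<omega> - ?m) * cis (\<theta> * ?F \<omega>)))"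
      by (simp add: norm_mult)
    also have "cmod (expectation (\<lambda>\<omega>. of_real (?T t \<omega> - ?m) * cis (\<theta> * ?F \<omega>))) \<le> expectation (\<lambda>\<omega>. \<bar>?T t \<omega> - ?m\<bar>)"
      using i3 iT[of t] by (intro norm_integral_le) (auto simp: norm_mult simp flip: of_real_diff)
    also have "\<dots> \<le> \<delta>"
    proof (rule expectation_abs_le_of_square[OF _ _ var[OF t] \<delta>])
      show "integrable M (\<lambda>\<omega>. (?T t \<omega> - ?m)\<^sup>2)"
        using bdd_rv_integrable[OF bdd_rv_power[OF bD, of 2]]
        by (simp add: complex_of_real_integrable_eq flip: of_real_power of_real_diff)
    qed measurable
    finally show ?thesis by (simp add: mult_left_mono)
  qed
  have "cmod (?g 1 - ?g 0) \<le> \<bar>\<theta>\<bar> * \<delta>"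
    by (rule norm_diff_le_of_vector_derivative_bound[OF d bound])
  moreover have "expectation (\<lambda>\<omega>. complex_of_real (?F \<omega>) * of_real (?F \<omega>)) = of_real (expectation (\<lambda>\<omega>. (?F \<omega>)\<^sup>2))"
    by (simp add: power2_eq_square flip: of_real_mult)
  ultimately show ?thesis by (simp add: trig_interp_0 trig_interp_1 mult_ac)
qed

text \<open>By \<open>stein_trig\<close> the characteristic function solves the Gaussian
  differential equation y' = - \<theta> v y up to a small error; an integrating factor along the
  segment from 0 to \<theta> turns this into a bound on the difference.\<close>

lemma char_trig_gaussian_bound:
  assumes U: "\<And>s. s \<in> S \<Longrightarrow> U s \<in> H" and \<delta>: "0 \<le> \<delta>"
    and var: "\<And>t. t \<in> {0..1} \<Longrightarrow> expectation (\<lambda>\<omega>. (carre S a U t \<omega> - expectation (carre S a U t))\<^sup>2) \<le> \<delta>\<^sup>2"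
  shows "cmod (expectation (\<lambda>\<omega>. cis (\<theta> * trig S a U \<omega>)) - of_real (exp (- \<theta>\<^sup>2 * expectation (\<lambda>\<omega>. (trig S a U \<omega>)\<^sup>2) / 2)))
    \<le> \<theta>\<^sup>2 * \<delta>"
proof -
  let ?F = "trig S a U"
  define v where "v = expectation (\<lambda>\<omega>. (?F \<omega>)\<^sup>2)"
  have v0: "0 \<le> v" unfolding v_def by (rule integral_nonneg_AE) simp
  note F[measurable] = trig_measurable(1)[OF U, of S id a, simplified]
  have bF: "bdd_rv (\<lambda>\<omega>. of_real (?F \<omega>))" using U by (rule bdd_rv_trig)
  have F2: "integrable M (\<lambda>\<omega>. (\<theta> * ?F \<omega>)\<^sup>2)"
    using bdd_rv_integrable[OF bdd_rv_power[OF bdd_rv_mult[OF bdd_rv_const[of "of_real \<theta>"] bF], of 2]]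
    by (simp add: complex_of_real_integrable_eq flip: of_real_power of_real_mult)
  let ?\<phi> = "\<lambda>\<theta>. expectation (\<lambda>\<omega>. cis (\<theta> * ?F \<omega>))"
  let ?e = "\<lambda>t. exp ((t * \<theta>)\<^sup>2 * v / 2)"
  \<comment> \<open>For an exactly Gaussian functional this product would be constant in
    \<open>t\<close>.\<close>
  let ?k = "\<lambda>t. of_real (?e t) * expectation (\<lambda>\<omega>. cis (t * (\<theta> * ?F \<omega>)) * 1)"
  let ?X = "\<lambda>t. expectation (\<lambda>\<omega>. of_real (?F \<omega>) * cis ((t * \<theta>) * ?F \<omega>))"
  let ?k' = "\<lambda>t. of_real (?e t) * (\<i> * expectation (\<lambda>\<omega>. of_real (\<theta> * ?F \<omega>) * (cis (t * (\<theta> * ?F \<omega>)) * 1)))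
      + of_real (t * \<theta>\<^sup>2 * v * ?e t) * expectation (\<lambda>\<omega>. cis (t * (\<theta> * ?F \<omega>)) * 1)"
  have d: "(?k has_vector_derivative ?k' t) (at t)" for t
  proof (rule has_vector_derivative_mult)
    have "(?e has_real_derivative t * \<theta>\<^sup>2 * v * ?e t) (at t)"
      by (auto intro!: derivative_eq_intros simp: power2_eq_square)
    hence "(?e has_vector_derivative t * \<theta>\<^sup>2 * v * ?e t) (at t)"
      by (simp add: has_real_derivative_iff_has_vector_derivative)
    thus "((\<lambda>t. complex_of_real (?e t)) has_vector_derivative of_real (t * \<theta>\<^sup>2 * v * ?e t)) (at t)"
      by (rule bounded_linear.has_vector_derivative[OF bounded_linear_of_real])
    show "((\<lambda>t. expectation (\<lambda>\<omega>. cis (t * (\<theta> * ?F \<omega>)) * 1)) has_vector_derivative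
        \<i> * expectation (\<lambda>\<omega>. of_real (\<theta> * ?F \<omega>) * (cis (t * (\<theta> * ?F \<omega>)) * 1))) (at t)"
      by (rule has_vector_derivative_expectation_cis[OF _ F2]) (auto intro!: borel_measurable_times F)
  qed
  have bound: "cmod (?k' t) \<le> \<theta>\<^sup>2 * \<delta> * ?e 1" if t: "t \<in> {0..1}" for t
  proof -
    have e1: "expectation (\<lambda>\<omega>. of_real (\<theta> * ?F \<omega>) * (cis (t * (\<theta> * ?F \<omega>)) * 1)) = of_real \<theta> * ?X t"
      unfolding integral_mult_right_zero[symmetric] by (simp add: mult_ac)
    have e2: "expectation (\<lambda>\<omega>. cis (t * (\<theta> * ?F \<omega>)) * 1) = ?\<phi> (t * \<theta>)"
      by (simp add: mult_ac)
    have "?k' t = of_real (?e t) * \<i> * of_real \<theta> * (?X t - \<i> * of_real (t * \<theta>) * of_real v * ?\<phi> (t * \<theta>))"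
      unfolding e1 e2 by (simp add: algebra_simps power2_eq_square)
    hence "cmod (?k' t) = ?e t * \<bar>\<theta>\<bar> * cmod (?X t - \<i> * of_real (t * \<theta>) * of_real v * ?\<phi> (t * \<theta>))"
      by (simp add: norm_mult)
    also have "\<dots> \<le> ?e 1 * \<bar>\<theta>\<bar> * (\<bar>\<theta>\<bar> * \<delta>)"
    proof (intro mult_mono)
      have "cmod (?X t - \<i> * of_real (t * \<theta>) * of_real v * ?\<phi> (t * \<theta>)) \<le> \<bar>t * \<theta>\<bar> * \<delta>"
        unfolding v_def by (rule stein_trig[OF U \<delta> var])
      also have "\<dots> \<le> \<bar>\<theta>\<bar> * \<delta>"
        using t \<delta> by (intro mult_right_mono) (auto simp: abs_mult mult_left_le_one_le)
      finally show "cmod (?X t - \<i> * of_real (t * \<theta>) * of_real v * ?\<phi> (t * \<theta>)) \<le> \<bar>\<theta>\<bar> * \<delta>" .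
      have "(t * \<theta>)\<^sup>2 \<le> (1 * \<theta>)\<^sup>2"
        using t by (simp add: power_mult_distrib mult_left_le_one_le power_le_one)
      thus "?e t \<le> ?e 1" using v0 by (simp add: mult_right_mono)
    qed auto
    also have "\<dots> = \<theta>\<^sup>2 * \<delta> * ?e 1" by (simp add: power2_eq_square abs_mult_self_eq algebra_simps)
    finally show ?thesis .
  qed
  have "cmod (?k 1 - ?k 0) \<le> \<theta>\<^sup>2 * \<delta> * ?e 1"
    by (rule norm_diff_le_of_vector_derivative_bound[OF d bound])
  also have "?k 0 = 1" by (simp add: prob_space)
  also have "?k 1 = of_real (?e 1) * ?\<phi> \<theta>" by simp
  finally have A: "cmod (of_real (?e 1) * ?\<phi> \<theta> - 1) \<le> \<theta>\<^sup>2 * \<delta> * ?e 1" .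
  \<comment> \<open>Removing the integrating factor cancels \<open>?e 1\<close>, so the final bound
    does not involve the variance.\<close>
  have inv: "exp (- \<theta>\<^sup>2 * v / 2) * ?e 1 = 1" by (simp flip: exp_add)
  have "cmod (?\<phi> \<theta> - of_real (exp (- \<theta>\<^sup>2 * v / 2))) = cmod (of_real (exp (- \<theta>\<^sup>2 * v / 2)) * (of_real (?e 1) * ?\<phi> \<theta> - 1))"
  proof -
    have "of_real (exp (- \<theta>\<^sup>2 * v / 2)) * (of_real (?e 1) * ?\<phi> \<theta> - 1) = of_real (exp (- \<theta>\<^sup>2 * v / 2) * ?e 1) * ?\<phi> \<theta> - of_real (exp (- \<theta>\<^sup>2 * v / 2))"
      unfolding of_real_mult right_diff_distrib mult.assoc by simp
    thus ?thesis unfolding inv by simp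
  qed
  also have "\<dots> = exp (- \<theta>\<^sup>2 * v / 2) * cmod (of_real (?e 1) * ?\<phi> \<theta> - 1)"
    unfolding norm_mult by simp
  also have "\<dots> \<le> exp (- \<theta>\<^sup>2 * v / 2) * (\<theta>\<^sup>2 * \<delta> * ?e 1)" by (intro mult_left_mono A) simp
  also have "\<dots> = (exp (- \<theta>\<^sup>2 * v / 2) * ?e 1) * (\<theta>\<^sup>2 * \<delta>)" by simp
  also have "\<dots> = \<theta>\<^sup>2 * \<delta>" unfolding inv by simp
  finally show ?thesis unfolding v_def .
qed

end

section \<open>Fourth-order bounds\<close>

text \<open>Expanding over the four signs leaves exactly the subgraphs of K4 all of whose degrees are odd:
  the three perfect matchings, the four stars and K4 itself.\<close>

lemma odd_subgraphs_K4:
  fixes C12 C13 C14 C23 C24 C34 S12 S13 S14 S23 S24 S34 :: real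
  shows
  "(  (C12+S12)*(C13+S13)*(C14-S14)*(C23-S23)*(C24+S24)*(C34+S34)
    + (C12+S12)*(C13-S13)*(C14+S14)*(C23+S23)*(C24-S24)*(C34+S34)
    - (C12+S12)*(C13+S13)*(C14+S14)*(C23-S23)*(C24-S24)*(C34-S34)
    - (C12+S12)*(C13-S13)*(C14-S14)*(C23+S23)*(C24+S24)*(C34-S34)
    - (C12-S12)*(C13+S13)*(C14-S14)*(C23+S23)*(C24-S24)*(C34+S34)
    - (C12-S12)*(C13-S13)*(C14+S14)*(C23-S23)*(C24+S24)*(C34+S34)
    + (C12-S12)*(C13+S13)*(C14+S14)*(C23+S23)*(C24+S24)*(C34-S34)
    + (C12-S12)*(C13-S13)*(C14-S14)*(C23-S23)*(C24-S24)*(C34-S34)) / 8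
  = S12*S34*(C13*C14*C23*C24) + S13*S24*(C12*C14*C23*C34) + S14*S23*(C12*C13*C24*C34)
    - S12*S13*S14*(C23*C24*C34) - S12*S23*S24*(C13*C14*C34) - S13*S23*S34*(C12*C14*C24)
    - S14*S24*S34*(C12*C13*C23) + S12*S34*S13*S24*S14*S23"
  by (simp add: field_simps)

text \<open>All bounds come from exp x - 1 <= x exp x, which is 1 - x <= exp(- x) multiplied by exp
  x. A bound linear in \<open>r\<close> for cosh - 1 is weaker than the true quadratic order, but
  lets every edge of a graph cost one factor \<open>r\<close>.\<close>

lemma cosh_sinh_bounds:
  fixes c r \<kappa> :: real
  assumes c: "\<bar>c\<bar> \<le> r" and r: "r \<le> \<kappa>"
  shows "1 \<le> cosh c" "cosh c \<le> exp \<kappa>" "\<bar>sinh c\<bar> \<le> exp \<kappa> * r" "cosh c - 1 \<le> exp \<kappa> * r"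
proof -
  have aux: "cosh x \<le> exp \<kappa> \<and> \<bar>sinh x\<bar> \<le> exp \<kappa> * \<bar>x\<bar> \<and> cosh x - 1 \<le> exp \<kappa> * \<bar>x\<bar>"
    if x: "0 \<le> x" "x \<le> \<kappa>" for x :: real
  proof -
    have e1: "exp (-x) \<le> exp x" using x by simp
    have ex: "exp x \<le> exp \<kappa>" using x by simp
    have "1 + (- x) \<le> exp (- x)" by (rule exp_ge_add_one_self)
    hence "exp x * (1 - x) \<le> exp x * exp (-x)" by (intro mult_left_mono) auto
    hence *: "exp x - 1 \<le> exp x * x" by (simp add: algebra_simps flip: exp_add)
    have **: "exp x * x \<le> exp \<kappa> * x" using ex x by (intro mult_right_mono) auto
    have "exp (-x) \<le> 1" using x by simp
    hence s: "sinh x \<le> exp x * x" using * e1 \<open>1 + (- x) \<le> exp (- x)\<close>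
    proof -
      have "sinh x \<le> exp x - 1 \<or> sinh x \<le> exp x * x"
      proof -
        have "exp x + exp (- x) \<ge> 2" using cosh_real_ge_1[of x] by (simp add: cosh_def)
        hence "sinh x \<le> exp x - 1" by (simp add: sinh_def)
        thus ?thesis by simp
      qed
      thus ?thesis using * by linarith
    qed
    have s0: "0 \<le> sinh x" using x by simp
    have cx: "cosh x \<le> exp x" using e1 by (simp add: cosh_def)
    have "cosh x - 1 \<le> exp x * x" using * cx by linarith
    thus ?thesis using order_trans[OF cx ex] s s0 ** x by auto
  qed
  have "cosh \<bar>c\<bar> = cosh c" by (simp add: abs_if)
  moreover have "\<bar>sinh \<bar>c\<bar>\<bar> = \<bar>sinh c\<bar>" by (simp add: abs_if)
  ultimately have "cosh c \<le> exp \<kappa>" "\<bar>sinh c\<bar> \<le> exp \<kappa> * \<bar>c\<bar>" "cosh c - 1 \<le> exp \<kappa> * \<bar>c\<bar>"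
    using aux[of "\<bar>c\<bar>"] assms by auto
  moreover have "exp \<kappa> * \<bar>c\<bar> \<le> exp \<kappa> * r" using c by (intro mult_left_mono) auto
  ultimately show "cosh c \<le> exp \<kappa>" "\<bar>sinh c\<bar> \<le> exp \<kappa> * r" "cosh c - 1 \<le> exp \<kappa> * r" by linarith+
  show "1 \<le> cosh c" by (rule cosh_real_ge_1)
qed

text \<open>Telescoping: the factors are replaced by 1 one after the other, and each replacement
  costs p_i - 1 times a product of at most three remaining factors.\<close>

lemma prod4_minus_1_le:
  fixes p1 p2 p3 p4 E :: real
  assumes "1 \<le> p1" "1 \<le> p2" "1 \<le> p3" "1 \<le> p4" "p2 \<le> E" "p3 \<le> E" "p4 \<le> E"
    and "p1 - 1 \<le> E * y1" "p2 - 1 \<le> E * y2" "p3 - 1 \<le> E * y3" "p4 - 1 \<le> E * y4"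
  shows "p1 * p2 * p3 * p4 - 1 \<le> E ^ 4 * (y1 + y2 + y3 + y4)" "0 \<le> p1 * p2 * p3 * p4 - 1"
proof -
  have E1: "1 \<le> E" using assms by linarith
  have q: "p2 * p3 * p4 \<le> E ^ 3" "p3 * p4 \<le> E ^ 3" "p4 \<le> E ^ 3" "1 \<le> E ^ 3"
    and q0: "0 \<le> p2 * p3 * p4" "0 \<le> p3 * p4"
  proof -
    have "p2 * p3 * p4 \<le> E * E * E" by (intro mult_mono mult_nonneg_nonneg) (use assms E1 in auto)
    moreover have "1 * p3 * p4 \<le> E * E * E" by (intro mult_mono mult_nonneg_nonneg) (use assms E1 in auto)
    moreover have "1 * 1 * p4 \<le> E * E * E" by (intro mult_mono mult_nonneg_nonneg) (use assms E1 in auto)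
    ultimately show "p2 * p3 * p4 \<le> E ^ 3" "p3 * p4 \<le> E ^ 3" "p4 \<le> E ^ 3" by (simp_all add: power3_eq_cube)
    show "1 \<le> E ^ 3" using E1 by simp
    show "0 \<le> p2 * p3 * p4" "0 \<le> p3 * p4" using assms by auto
  qed
  have *: "(p - 1) * x \<le> E ^ 4 * y" if "1 \<le> p" "p - 1 \<le> E * y" "0 \<le> x" "x \<le> E ^ 3" for p x y
  proof -
    have "0 \<le> E * y" using that by linarith
    hence "(p - 1) * x \<le> (E * y) * E ^ 3" using that by (intro mult_mono) auto
    thus ?thesis by (simp add: eval_nat_numeral mult_ac)
  qed
  have "p1 * p2 * p3 * p4 - 1 = (p1 - 1) * (p2 * p3 * p4) + (p2 - 1) * (p3 * p4) + (p3 - 1) * p4 + (p4 - 1) * 1"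
    by (simp add: algebra_simps)
  also have "\<dots> \<le> E ^ 4 * y1 + E ^ 4 * y2 + E ^ 4 * y3 + E ^ 4 * y4"
    using assms q q0 by (intro add_mono *) auto
  finally show "p1 * p2 * p3 * p4 - 1 \<le> E ^ 4 * (y1 + y2 + y3 + y4)" by (simp add: algebra_simps)
  have "1 * 1 * 1 * 1 \<le> p1 * p2 * p3 * p4" using assms by (intro mult_mono mult_nonneg_nonneg) auto
  thus "0 \<le> p1 * p2 * p3 * p4 - 1" by simp
qed

text \<open>The subtracted term is what the matching 12, 34 contributes to the product of the two
  second moments. Every other subgraph has an edge between {1,2} and {3,4}, and that is why the
  difference decays. The exponent 6 counts one factor exp \<kappa> for each edge of K4.\<close>

lemma K4_bound:
  fixes c12 c13 c14 c23 c24 c34 r12 r13 r14 r23 r24 r34 \<kappa> :: real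
  assumes r: "\<bar>c12\<bar> \<le> r12" "\<bar>c13\<bar> \<le> r13" "\<bar>c14\<bar> \<le> r14" "\<bar>c23\<bar> \<le> r23" "\<bar>c24\<bar> \<le> r24" "\<bar>c34\<bar> \<le> r34"
    and k: "r12 \<le> \<kappa>" "r13 \<le> \<kappa>" "r14 \<le> \<kappa>" "r23 \<le> \<kappa>" "r24 \<le> \<kappa>" "r34 \<le> \<kappa>"
  shows "\<bar>sinh c12 * sinh c34*(cosh c13*cosh c14*cosh c23*cosh c24) + sinh c13 * sinh c24*(cosh c12*cosh c14*cosh c23*cosh c34)
     + sinh c14 * sinh c23*(cosh c12*cosh c13*cosh c24*cosh c34)
    - sinh c12 * sinh c13 * sinh c14*(cosh c23*cosh c24*cosh c34) - sinh c12 * sinh c23 * sinh c24*(cosh c13*cosh c14*cosh c34)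
    - sinh c13 * sinh c23 * sinh c34*(cosh c12*cosh c14*cosh c24)
    - sinh c14 * sinh c24 * sinh c34*(cosh c12*cosh c13*cosh c23) + sinh c12 * sinh c34 * sinh c13 * sinh c24 * sinh c14 * sinh c23
    - sinh c12 * sinh c34\<bar> \<le>
    exp \<kappa> ^ 6 * (r12*r34*(r13+r14+r23+r24) + (1 + \<kappa>^4) * (r13*r24) + r14*r23
      + r12*r13*r14 + r12*r23*r24 + r13*r23*r34 + r14*r24*r34)"
proof -
  define E where "E = exp \<kappa>"
  have \<kappa>0: "0 \<le> \<kappa>" using r(1) k(1) by linarith
  have E1: "1 \<le> E" using \<kappa>0 by (simp add: E_def)
  note b12 = cosh_sinh_bounds[OF r(1) k(1), folded E_def] and b13 = cosh_sinh_bounds[OF r(2) k(2), folded E_def]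
    and b14 = cosh_sinh_bounds[OF r(3) k(3), folded E_def] and b23 = cosh_sinh_bounds[OF r(4) k(4), folded E_def]
    and b24 = cosh_sinh_bounds[OF r(5) k(5), folded E_def] and b34 = cosh_sinh_bounds[OF r(6) k(6), folded E_def]
  have two: "\<bar>s1 * s2*(p1*p2*p3*p4)\<bar> \<le> E^6 * (x1*x2)"
    if "\<bar>s1\<bar> \<le> E * x1" "\<bar>s2\<bar> \<le> E * x2" "1 \<le> p1" "p1 \<le> E" "1 \<le> p2" "p2 \<le> E" "1 \<le> p3" "p3 \<le> E" "1 \<le> p4" "p4 \<le> E"
    for s1 s2 p1 p2 p3 p4 x1 x2 :: real
  proof -
    note z = that(1,2)[THEN order_trans[OF abs_ge_zero]]
    have A: "p1*p2*p3*p4 \<le> E*E*E*E" by (intro mult_mono mult_nonneg_nonneg) (use that E1 in auto)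
    have B: "\<bar>s1\<bar> * \<bar>s2\<bar> \<le> (E*x1)*(E*x2)" using that(1,2) z by (intro mult_mono) auto
    have "\<bar>s1\<bar> * \<bar>s2\<bar>*(p1*p2*p3*p4) \<le> (E*x1)*(E*x2)*(E*E*E*E)"
      by (rule mult_mono[OF B A]) (use that z in \<open>auto intro!: mult_nonneg_nonneg simp del: zero_le_mult_iff\<close>)
    moreover have "\<bar>s1 * s2*(p1*p2*p3*p4)\<bar> = \<bar>s1\<bar> * \<bar>s2\<bar>*(p1*p2*p3*p4)" using that by (simp add: abs_mult)
    ultimately show ?thesis by (simp add: eval_nat_numeral mult_ac)
  qed
  have three: "\<bar>s1 * s2 * s3*(p1*p2*p3)\<bar> \<le> E^6 * (x1*x2*x3)"
    if "\<bar>s1\<bar> \<le> E * x1" "\<bar>s2\<bar> \<le> E * x2" "\<bar>s3\<bar> \<le> E * x3" "1 \<le> p1" "p1 \<le> E" "1 \<le> p2" "p2 \<le> E" "1 \<le> p3" "p3 \<le> E"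
    for s1 s2 s3 p1 p2 p3 x1 x2 x3 :: real
  proof -
    note z = that(1,2,3)[THEN order_trans[OF abs_ge_zero]]
    have A: "p1*p2*p3 \<le> E*E*E" by (intro mult_mono mult_nonneg_nonneg) (use that E1 in auto)
    have B: "\<bar>s1\<bar> * \<bar>s2\<bar> * \<bar>s3\<bar> \<le> (E*x1)*(E*x2)*(E*x3)"
      by (rule mult_mono[OF mult_mono[OF that(1,2)] that(3)]) (use z in \<open>auto intro!: mult_nonneg_nonneg simp del: zero_le_mult_iff\<close>)
    have "\<bar>s1\<bar> * \<bar>s2\<bar> * \<bar>s3\<bar>*(p1*p2*p3) \<le> (E*x1)*(E*x2)*(E*x3)*(E*E*E)"
      by (rule mult_mono[OF B A]) (use that z in \<open>auto intro!: mult_nonneg_nonneg simp del: zero_le_mult_iff\<close>)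
    moreover have "\<bar>s1 * s2 * s3*(p1*p2*p3)\<bar> = \<bar>s1\<bar> * \<bar>s2\<bar> * \<bar>s3\<bar>*(p1*p2*p3)" using that by (simp add: abs_mult)
    ultimately show ?thesis by (simp add: eval_nat_numeral mult_ac)
  qed
  \<comment> \<open>After the subtraction the product of the four remaining cosh factors appears
    minus 1, which yields one additional edge between the pairs.\<close>
  have t1: "\<bar>sinh c12 * sinh c34*(cosh c13*cosh c14*cosh c23*cosh c24) - sinh c12 * sinh c34\<bar>
      \<le> E^6 * (r12*r34*(r13+r14+r23+r24))"
  proof -
    let ?P = "cosh c13*cosh c14*cosh c23*cosh c24 - 1"
    note P = prod4_minus_1_le[OF b13(1) b14(1) b23(1) b24(1) b14(2) b23(2) b24(2) b13(4) b14(4) b23(4) b24(4)]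
    note P0 = P(2)
    have "sinh c12 * sinh c34*(cosh c13*cosh c14*cosh c23*cosh c24) - sinh c12 * sinh c34 = sinh c12 * sinh c34 * ?P"
      by (simp add: algebra_simps)
    hence "\<bar>sinh c12 * sinh c34*(cosh c13*cosh c14*cosh c23*cosh c24) - sinh c12 * sinh c34\<bar> = \<bar>sinh c12\<bar> * \<bar>sinh c34\<bar> * ?P"
      using P0 by (simp add: abs_mult)
    also have "\<dots> \<le> (E*r12)*(E*r34)*(E^4 * (r13+r14+r23+r24))"
      by (rule mult_mono[OF mult_mono[OF b12(3) b34(3)] P(1)])
        (use P0 order_trans[OF abs_ge_zero b12(3)] order_trans[OF abs_ge_zero b34(3)] in
          \<open>auto intro!: mult_nonneg_nonneg simp del: zero_le_mult_iff\<close>)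
    also have "\<dots> = E^6 * (r12*r34*(r13+r14+r23+r24))"
      by (simp add: eval_nat_numeral)
    finally show ?thesis .
  qed
  \<comment> \<open>Four of the six edges are estimated by \<kappa>. This charges K4 to the matching
    13, 24 and accounts for the coefficient \<open>1 + \<kappa>^4\<close>.\<close>
  have t6: "\<bar>sinh c12 * sinh c34 * sinh c13 * sinh c24 * sinh c14 * sinh c23\<bar> \<le> E^6 * (\<kappa>^4 * (r13*r24))"
  proof -
    have K: "E * c \<le> E * \<kappa>" if "c \<le> \<kappa>" for c using that E1 by (intro mult_left_mono) auto
    have six: "\<bar>s1 * s2 * s3 * s4 * s5 * s6\<bar> \<le> (E*x1)*(E*x2)*(E*x3)*(E*x4)*(E*x5)*(E*x6)"
      if "\<bar>s1\<bar> \<le> E*x1" "\<bar>s2\<bar> \<le> E*x2" "\<bar>s3\<bar> \<le> E*x3" "\<bar>s4\<bar> \<le> E*x4" "\<bar>s5\<bar> \<le> E*x5" "\<bar>s6\<bar> \<le> E*x6"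
      for s1 s2 s3 s4 s5 s6 x1 x2 x3 x4 x5 x6 :: real
    proof -
      note z = that[THEN order_trans[OF abs_ge_zero]]
      show ?thesis unfolding abs_mult
        by (rule mult_mono[OF mult_mono[OF mult_mono[OF mult_mono[OF mult_mono[OF that(1,2)] that(3)] that(4)] that(5)] that(6)])
          (use z in \<open>auto simp del: zero_le_mult_iff intro!: mult_nonneg_nonneg\<close>)
    qed
    show ?thesis
      using six[OF order_trans[OF b12(3) K[OF k(1)]] order_trans[OF b34(3) K[OF k(6)]] b13(3) b24(3)
        order_trans[OF b14(3) K[OF k(3)]] order_trans[OF b23(3) K[OF k(4)]]]
      by (simp add: eval_nat_numeral mult_ac)
  qed
  note t2 = two[OF b13(3) b24(3) b12(1,2) b14(1,2) b23(1,2) b34(1,2)]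
  note t3 = two[OF b14(3) b23(3) b12(1,2) b13(1,2) b24(1,2) b34(1,2)]
  note u1 = three[OF b12(3) b13(3) b14(3) b23(1,2) b24(1,2) b34(1,2)]
  note u2 = three[OF b12(3) b23(3) b24(3) b13(1,2) b14(1,2) b34(1,2)]
  note u3 = three[OF b13(3) b23(3) b34(3) b12(1,2) b14(1,2) b24(1,2)]
  note u4 = three[OF b14(3) b24(3) b34(3) b12(1,2) b13(1,2) b23(1,2)]
  have tri: "\<bar>x1 + x2 + x3 - x4 - x5 - x6 - x7 + x8 - y\<bar> \<le> B1 + B2 + B3 + B4 + B5 + B6 + B7 + B8"
    if "\<bar>x1 - y\<bar> \<le> B1" "\<bar>x2\<bar> \<le> B2" "\<bar>x3\<bar> \<le> B3" "\<bar>x4\<bar> \<le> B4" "\<bar>x5\<bar> \<le> B5" "\<bar>x6\<bar> \<le> B6" "\<bar>x7\<bar> \<le> B7" "\<bar>x8\<bar> \<le> B8"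
    for x1 x2 x3 x4 x5 x6 x7 x8 y B1 B2 B3 B4 B5 B6 B7 B8 :: real using that unfolding abs_le_iff by linarith
  show ?thesis unfolding E_def[symmetric]
    by (rule order_trans[OF tri[OF t1 t2 t3 u1 u2 u3 u4 t6]]) (simp add: algebra_simps)
qed

context gaussian_space
begin

lemma expectation_sin_sin:
  assumes "X \<in> H" "Y \<in> H"
  shows "expectation (\<lambda>\<omega>. sin (X \<omega>) * sin (Y \<omega>)) = exp (- (cov X X + cov Y Y) / 2) * sinh (cov X Y)"
proof -
  have "expectation (\<lambda>\<omega>. sin (X \<omega>) * sin (Y \<omega>)) = expectation (\<lambda>\<omega>. (cos (X \<omega> - Y \<omega>) - cos (X \<omega> + Y \<omega>)) / 2)"
    by (simp add: cos_diff cos_add)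
  also have "\<dots> = (expectation (\<lambda>\<omega>. cos (X \<omega> - Y \<omega>)) - expectation (\<lambda>\<omega>. cos (X \<omega> + Y \<omega>))) / 2"
    using H_integrable_cos[OF H_diff[OF assms]] H_integrable_cos[OF H_add[OF assms]] by simp
  also have "\<dots> = (exp (- (cov X X + cov Y Y) / 2 + cov X Y) - exp (- (cov X X + cov Y Y) / 2 - cov X Y)) / 2"
    using assms by (simp add: expectation_cos H_add H_diff cov_simps cov_commute[of Y X] field_simps)
  moreover have "(exp (w + c) - exp (w - c)) / 2 = exp w * sinh c" for w c :: real
    by (simp add: exp_add exp_diff exp_minus sinh_def field_simps)
  ultimately show ?thesis by (simp only:)
qed

text \<open>The product of four sines is a signed sum of eight cosines of linear combinations. Each
  expectation factorises over the six edges of K4, and \<open>odd_subgraphs_K4\<close> evaluates the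
  sum.\<close>

lemma expectation_sin4:
  assumes X: "X1 \<in> H" "X2 \<in> H" "X3 \<in> H" "X4 \<in> H"
  defines "c12 \<equiv> cov X1 X2" and "c13 \<equiv> cov X1 X3" and "c14 \<equiv> cov X1 X4"
    and "c23 \<equiv> cov X2 X3" and "c24 \<equiv> cov X2 X4" and "c34 \<equiv> cov X3 X4"
  shows "expectation (\<lambda>\<omega>. sin (X1 \<omega>) * sin (X2 \<omega>) * (sin (X3 \<omega>) * sin (X4 \<omega>))) =
    exp (- (cov X1 X1 + cov X2 X2 + cov X3 X3 + cov X4 X4) / 2) *
    (sinh c12 * sinh c34*(cosh c13*cosh c14*cosh c23*cosh c24) + sinh c13 * sinh c24*(cosh c12*cosh c14*cosh c23*cosh c34)
     + sinh c14 * sinh c23*(cosh c12*cosh c13*cosh c24*cosh c34)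
    - sinh c12 * sinh c13 * sinh c14*(cosh c23*cosh c24*cosh c34) - sinh c12 * sinh c23 * sinh c24*(cosh c13*cosh c14*cosh c34)
    - sinh c13 * sinh c23 * sinh c34*(cosh c12*cosh c14*cosh c24)
    - sinh c14 * sinh c24 * sinh c34*(cosh c12*cosh c13*cosh c23) + sinh c12 * sinh c34 * sinh c13 * sinh c24 * sinh c14 * sinh c23)"
proof -
  let ?W = "exp (- (cov X1 X1 + cov X2 X2 + cov X3 X3 + cov X4 X4) / 2)"
  \<comment> \<open>The sign of \<open>X1\<close> is fixed because cosine is even.\<close>
  let ?L = "\<lambda>e2 e3 e4 \<omega>. X1 \<omega> + e2 * X2 \<omega> + e3 * X3 \<omega> + e4 * X4 \<omega>"
  have LH: "?L e2 e3 e4 \<in> H" for e2 e3 e4 using X by (intro H_add H_scale)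
  have ec: "expectation (\<lambda>\<omega>. cos (?L e2 e3 e4 \<omega>)) = ?W * exp (- (e2*c12)) * exp (- (e3*c13)) * exp (-(e4*c14))
     * exp (- (e2*e3*c23)) * exp (- (e2*e4*c24)) * exp (- (e3*e4*c34))"
    if e: "e2*e2 = 1" "e3*e3 = 1" "e4*e4 = (1::real)" for e2 e3 e4
  proof -
    have "cov (?L e2 e3 e4) (?L e2 e3 e4) = cov X1 X1 + (e2*e2) * cov X2 X2 + (e3*e3) * cov X3 X3 + (e4*e4) * cov X4 X4 +
      2 * (e2*c12 + e3*c13 + e4*c14 + e2*e3*c23 + e2*e4*c24 + e3*e4*c34)"
      unfolding c12_def c13_def c14_def c23_def c24_def c34_def using X
      by (simp add: cov_simps H_add H_scale cov_commute[of X2 X1] cov_commute[of X3 X1] cov_commute[of X3 X2]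
        cov_commute[of X4 X1] cov_commute[of X4 X2] cov_commute[of X4 X3] algebra_simps)
    hence "- cov (?L e2 e3 e4) (?L e2 e3 e4) / 2 = - (cov X1 X1 + cov X2 X2 + cov X3 X3 + cov X4 X4) / 2
       + - (e2*c12) + - (e3*c13) + - (e4*c14) + - (e2*e3*c23) + - (e2*e4*c24) + - (e3*e4*c34)"
      unfolding e by (simp add: field_simps)
    thus ?thesis unfolding expectation_cos[OF LH] exp_add[symmetric] by simp
  qed
  have m: "(-1) * (-1) = (1::real)" and p: "1 * 1 = (1::real)" by simp_all
  have i: "integrable M (\<lambda>\<omega>. cos (?L e2 e3 e4 \<omega>))" for e2 e3 e4 by (rule H_integrable_cos[OF LH])
  have "sin x1 * sin x2 * (sin x3 * sin x4) = (
      cos (x1 + (-1)*x2 + (-1)*x3 + 1*x4) + cos (x1 + (-1)*x2 + 1*x3 + (-1)*x4)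
    - cos (x1 + (-1)*x2 + (-1)*x3 + (-1)*x4) - cos (x1 + (-1)*x2 + 1*x3 + 1*x4)
    - cos (x1 + 1*x2 + (-1)*x3 + 1*x4) - cos (x1 + 1*x2 + 1*x3 + (-1)*x4)
    + cos (x1 + 1*x2 + (-1)*x3 + (-1)*x4) + cos (x1 + 1*x2 + 1*x3 + 1*x4)) / 8" for x1 x2 x3 x4 :: real
    by (simp add: cos_diff cos_add sin_add sin_diff algebra_simps)
  hence "expectation (\<lambda>\<omega>. sin (X1 \<omega>) * sin (X2 \<omega>) * (sin (X3 \<omega>) * sin (X4 \<omega>))) =
     expectation (\<lambda>\<omega>. (cos (?L (-1) (-1) 1 \<omega>) + cos (?L (-1) 1 (-1) \<omega>) - cos (?L (-1) (-1) (-1) \<omega>) - cos (?L (-1) 1 1 \<omega>)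
       - cos (?L 1 (-1) 1 \<omega>) - cos (?L 1 1 (-1) \<omega>) + cos (?L 1 (-1) (-1) \<omega>) + cos (?L 1 1 1 \<omega>)) / 8)"
    by (simp only:)
  also have "\<dots> = (expectation (\<lambda>\<omega>. cos (?L (-1) (-1) 1 \<omega>)) + expectation (\<lambda>\<omega>. cos (?L (-1) 1 (-1) \<omega>))
       - expectation (\<lambda>\<omega>. cos (?L (-1) (-1) (-1) \<omega>)) - expectation (\<lambda>\<omega>. cos (?L (-1) 1 1 \<omega>))
       - expectation (\<lambda>\<omega>. cos (?L 1 (-1) 1 \<omega>)) - expectation (\<lambda>\<omega>. cos (?L 1 1 (-1) \<omega>))
       + expectation (\<lambda>\<omega>. cos (?L 1 (-1) (-1) \<omega>)) + expectation (\<lambda>\<omega>. cos (?L 1 1 1 \<omega>))) / 8"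
    by (simp only: integral_divide_zero Bochner_Integration.integral_add Bochner_Integration.integral_diff
        Bochner_Integration.integrable_add Bochner_Integration.integrable_diff i)
  also have "\<dots> = ?W * (
      ((exp c12)*(exp c13)*(exp (-c14))*(exp (-c23))*(exp c24)*(exp c34)
    + (exp c12)*(exp (-c13))*(exp c14)*(exp c23)*(exp (-c24))*(exp c34)
    - (exp c12)*(exp c13)*(exp c14)*(exp (-c23))*(exp (-c24))*(exp (-c34))
    - (exp c12)*(exp (-c13))*(exp (-c14))*(exp c23)*(exp c24)*(exp (-c34))
    - (exp (-c12))*(exp c13)*(exp (-c14))*(exp c23)*(exp (-c24))*(exp c34)
    - (exp (-c12))*(exp (-c13))*(exp c14)*(exp (-c23))*(exp c24)*(exp c34)
    + (exp (-c12))*(exp c13)*(exp c14)*(exp c23)*(exp c24)*(exp (-c34))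
    + (exp (-c12))*(exp (-c13))*(exp (-c14))*(exp (-c23))*(exp (-c24))*(exp (-c34))) / 8)"
    unfolding ec[OF m m p] ec[OF m p m] ec[OF m m m] ec[OF m p p] ec[OF p m p] ec[OF p p m] ec[OF p m m] ec[OF p p p]
    by (simp add: algebra_simps)
  also have "\<dots> = ?W * (sinh c12 * sinh c34*(cosh c13*cosh c14*cosh c23*cosh c24) + sinh c13 * sinh c24*(cosh c12*cosh c14*cosh c23*cosh c34)
     + sinh c14 * sinh c23*(cosh c12*cosh c13*cosh c24*cosh c34)
    - sinh c12 * sinh c13 * sinh c14*(cosh c23*cosh c24*cosh c34) - sinh c12 * sinh c23 * sinh c24*(cosh c13*cosh c14*cosh c34)
    - sinh c13 * sinh c23 * sinh c34*(cosh c12*cosh c14*cosh c24)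
    - sinh c14 * sinh c24 * sinh c34*(cosh c12*cosh c13*cosh c23) + sinh c12 * sinh c34 * sinh c13 * sinh c24 * sinh c14 * sinh c23)"
    unfolding odd_subgraphs_K4[symmetric] cosh_plus_sinh cosh_minus_sinh ..
  finally show ?thesis .
qed

text \<open>The exponential of the variances is common to the fourth moment and to the product of
  second moments, and it is at most 1; what remains is \<open>K4_bound\<close>.\<close>

lemma cov_sin4_bound:
  assumes X: "X1 \<in> H" "X2 \<in> H" "X3 \<in> H" "X4 \<in> H"
    and r: "\<bar>cov X1 X2\<bar> \<le> r12" "\<bar>cov X1 X3\<bar> \<le> r13" "\<bar>cov X1 X4\<bar> \<le> r14" "\<bar>cov X2 X3\<bar> \<le> r23" "\<bar>cov X2 X4\<bar> \<le> r24" "\<bar>cov X3 X4\<bar> \<le> r34"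
    and k: "r12 \<le> \<kappa>" "r13 \<le> \<kappa>" "r14 \<le> \<kappa>" "r23 \<le> \<kappa>" "r24 \<le> \<kappa>" "r34 \<le> \<kappa>"
  shows "\<bar>expectation (\<lambda>\<omega>. sin (X1 \<omega>) * sin (X2 \<omega>) * (sin (X3 \<omega>) * sin (X4 \<omega>)))
     - expectation (\<lambda>\<omega>. sin (X1 \<omega>) * sin (X2 \<omega>)) * expectation (\<lambda>\<omega>. sin (X3 \<omega>) * sin (X4 \<omega>))\<bar>
    \<le> exp \<kappa> ^ 6 * (r12*r34*(r13+r14+r23+r24) + (1 + \<kappa>^4) * (r13*r24) + r14*r23
      + r12*r13*r14 + r12*r23*r24 + r13*r23*r34 + r14*r24*r34)"
proof -
  let ?W = "exp (- (cov X1 X1 + cov X2 X2 + cov X3 X3 + cov X4 X4) / 2)"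
  have W: "exp (- (cov X1 X1 + cov X2 X2) / 2) * exp (- (cov X3 X3 + cov X4 X4) / 2) = ?W"
    unfolding exp_add[symmetric] by (simp add: field_simps)
  have W1: "?W \<le> 1" using cov_self_nonneg[of X1] cov_self_nonneg[of X2] cov_self_nonneg[of X3] cov_self_nonneg[of X4] by simp
  have "\<bar>?W * x\<bar> \<le> \<bar>x\<bar>" for x using W1 by (simp add: abs_mult mult_left_le_one_le)
  note B = order_trans[OF this K4_bound[OF r k]]
  show ?thesis
    unfolding expectation_sin4[OF X] expectation_sin_sin[OF X(1,2)] expectation_sin_sin[OF X(3,4)]
    by (rule order_trans[OF _ B]) (unfold W[symmetric], simp add: algebra_simps)
qed

end

section \<open>Sums over four vertices weighted by graphs\<close>

lemma sum_pairs: "(\<Sum>p\<in>S\<times>T. h p) = (\<Sum>a\<in>S. \<Sum>b\<in>T. h (a, b))"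
  by (simp add: sum.cartesian_product)

text \<open>Taking the summand as a function of four vertices turns relabellings of a graph into
  equations between sums.\<close>

definition sum4 :: "'s set \<Rightarrow> ('s \<Rightarrow> 's \<Rightarrow> 's \<Rightarrow> 's \<Rightarrow> real) \<Rightarrow> real" where
  "sum4 S f = (\<Sum>a\<in>S. \<Sum>b\<in>S. \<Sum>c\<in>S. \<Sum>d\<in>S. f a b c d)"

lemma sum4_swap12: "sum4 S (\<lambda>a b c d. f b a c d) = sum4 S f"
  unfolding sum4_def by (rule sum.swap)

lemma sum4_swap34: "sum4 S (\<lambda>a b c d. f a b d c) = sum4 S f"
  unfolding sum4_def by (rule sum.cong[OF refl], rule sum.cong[OF refl], rule sum.swap)

lemma sum4_swap_pairs: "sum4 S (\<lambda>a b c d. f c d a b) = sum4 S f"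
proof -
  have "sum4 S g = (\<Sum>p\<in>S\<times>S. \<Sum>q\<in>S\<times>S. g (fst p) (snd p) (fst q) (snd q))" for g :: "'a \<Rightarrow> 'a \<Rightarrow> 'a \<Rightarrow> 'a \<Rightarrow> real"
    unfolding sum4_def sum_pairs by simp
  thus ?thesis by simp (rule sum.swap)
qed

lemma sum4_add: "sum4 S (\<lambda>a b c d. f a b c d + g a b c d) = sum4 S f + sum4 S g"
  by (simp add: sum4_def sum.distrib)

lemma sum4_scale: "sum4 S (\<lambda>a b c d. k * f a b c d) = k * sum4 S f"
  by (simp add: sum4_def sum_distrib_left)

lemma sum4_mono:
  "(\<And>a b c d. a \<in> S \<Longrightarrow> b \<in> S \<Longrightarrow> c \<in> S \<Longrightarrow> d \<in> S \<Longrightarrow> f a b c d \<le> g a b c d) \<Longrightarrow> sum4 S f \<le> sum4 S g"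
  unfolding sum4_def by (intro sum_mono)

text \<open>The estimate behind the vanishing of the variance: apart from the 4-cycles, every term
  contains a square or a path that can be summed out at the cost of a constant, which leaves a
  single edge.\<close>

lemma sum4_graph_bound:
  fixes R :: "'s \<Rightarrow> 's \<Rightarrow> real"
  assumes R0: "\<And>a b. 0 \<le> R a b" and sym: "\<And>a b. R a b = R b a"
    and \<beta>: "\<And>a. a \<in> S \<Longrightarrow> (\<Sum>b\<in>S. (R a b)\<^sup>2) \<le> \<beta>" and K: "0 \<le> K"
  shows "sum4 S (\<lambda>a b c d. R a b * R c d * (R a b * R c d * (R a c + R a d + R b c + R b d) + K * (R a c * R b d) + R a d * R b c
      + R a b * R a c * R a d + R a b * R b c * R b d + R a c * R b c * R c d + R a d * R b d * R c d))
    \<le> 8 * \<beta>\<^sup>2 * (\<Sum>a\<in>S. \<Sum>b\<in>S. R a b) + (K + 1) * (\<Sum>a\<in>S. \<Sum>d\<in>S. (\<Sum>b\<in>S. R a b * R b d)\<^sup>2)"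
\<comment> \<open>Nonnegativity of \<beta> has to be read off at a vertex, hence the separate empty
  case.\<close>
proof (cases "S = {}")
  case True
  thus ?thesis by (simp add: sum4_def)
next
  case False
  then obtain s0 where s0: "s0 \<in> S" by auto
  have \<beta>0: "0 \<le> \<beta>" using order_trans[OF sum_nonneg \<beta>[OF s0]] by simp
  define L where "L = (\<Sum>a\<in>S. \<Sum>b\<in>S. R a b)"
  define Q where "Q = (\<Sum>a\<in>S. \<Sum>d\<in>S. (\<Sum>b\<in>S. R a b * R b d)\<^sup>2)"
  have path: "(\<Sum>d\<in>S. R c d * R a d) \<le> \<beta>" if "a \<in> S" "c \<in> S" for a c
  proof -
    have "(\<Sum>d\<in>S. R c d * R a d) \<le> (\<Sum>d\<in>S. ((R c d)\<^sup>2 + (R a d)\<^sup>2) / 2)"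
    proof (rule sum_mono)
      fix d show "R c d * R a d \<le> ((R c d)\<^sup>2 + (R a d)\<^sup>2) / 2"
        using sum_squares_bound[of "R c d" "R a d"] by simp
    qed
    also have "\<dots> = ((\<Sum>d\<in>S. (R c d)\<^sup>2) + (\<Sum>d\<in>S. (R a d)\<^sup>2)) / 2"
      by (simp only: sum_divide_distrib[symmetric] sum.distrib)
    also have "\<dots> \<le> \<beta>" using add_mono[OF \<beta>[OF that(2)] \<beta>[OF that(1)]] by simp
    finally show ?thesis .
  qed
  have edge: "(\<Sum>a\<in>S. \<Sum>b\<in>S. \<Sum>c\<in>S. \<Sum>d\<in>S. f a b * R a c * g a c d) \<le> \<beta>\<^sup>2 * L"
    if f: "\<And>a. a \<in> S \<Longrightarrow> (\<Sum>b\<in>S. f a b) \<le> \<beta>" "\<And>a b. 0 \<le> f a b"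
     and g: "\<And>a c. a \<in> S \<Longrightarrow> c \<in> S \<Longrightarrow> (\<Sum>d\<in>S. g a c d) \<le> \<beta>" "\<And>a c d. 0 \<le> g a c d" for f g
  proof -
    have "(\<Sum>a\<in>S. \<Sum>b\<in>S. \<Sum>c\<in>S. \<Sum>d\<in>S. f a b * R a c * g a c d) = (\<Sum>a\<in>S. (\<Sum>b\<in>S. f a b) * (\<Sum>c\<in>S. R a c * (\<Sum>d\<in>S. g a c d)))"
    proof (rule sum.cong[OF refl])
      fix a
      show "(\<Sum>b\<in>S. \<Sum>c\<in>S. \<Sum>d\<in>S. f a b * R a c * g a c d) = (\<Sum>b\<in>S. f a b) * (\<Sum>c\<in>S. R a c * (\<Sum>d\<in>S. g a c d))"
        by (subst sum_product) (simp add: sum_distrib_left mult.assoc)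
    qed
    also have "\<dots> \<le> (\<Sum>a\<in>S. \<beta> * (\<Sum>c\<in>S. R a c * \<beta>))"
      using f g R0 \<beta>0 by (intro sum_mono mult_mono sum_nonneg mult_nonneg_nonneg mult_left_mono) auto
    also have "\<dots> = \<beta>\<^sup>2 * L" by (simp add: L_def sum_distrib_left power2_eq_square mult_ac)
    finally show ?thesis .
  qed
  \<comment> \<open>\<open>?t\<close> is a path with both end edges doubled, \<open>?u\<close> a
    triangle with a doubled pendant edge, \<open>?q\<close> a 4-cycle. The first two occur four
    times each, whence the constant 8.\<close>
  let ?t = "\<lambda>a b c d. (R a b)\<^sup>2 * R a c * (R c d)\<^sup>2"
  let ?u = "\<lambda>a b c d. (R a b)\<^sup>2 * R a c * (R c d * R a d)"
  let ?q = "\<lambda>a b c d. R a b * R b c * (R a d * R d c)"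
  have t: "sum4 S ?t \<le> \<beta>\<^sup>2 * L" unfolding sum4_def by (rule edge) (use \<beta> R0 in auto)
  have u: "sum4 S ?u \<le> \<beta>\<^sup>2 * L" unfolding sum4_def by (rule edge) (use \<beta> R0 path in auto)
  have q: "sum4 S ?q = Q"
  proof -
    have "sum4 S ?q = (\<Sum>a\<in>S. \<Sum>c\<in>S. \<Sum>b\<in>S. \<Sum>d\<in>S. ?q a b c d)"
      unfolding sum4_def by (intro sum.cong refl sum.swap)
    also have "\<dots> = Q" unfolding Q_def power2_eq_square sum_product ..
    finally show ?thesis .
  qed
  have q': "sum4 S (\<lambda>a b c d. ?q a b d c) = Q" unfolding sum4_swap34[of S ?q] by (rule q)
  have "sum4 S (\<lambda>a b c d. R a b * R c d * (R a b * R c d * (R a c + R a d + R b c + R b d) + K * (R a c * R b d) + R a d * R b c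
      + R a b * R a c * R a d + R a b * R b c * R b d + R a c * R b c * R c d + R a d * R b d * R c d))
    = sum4 S (\<lambda>a b c d. ?t a b c d + ?t a b d c + ?t b a c d + ?t b a d c + K * ?q a b d c + ?q a b c d
       + ?u a b c d + ?u b a c d + ?u c d a b + ?u d c a b)"
    unfolding sum4_def
  proof (intro sum.cong refl, goal_cases)
    case (1 a b c d)
    show ?case by (simp add: sym[of b a] sym[of d a] sym[of c a] sym[of c b] sym[of d b] sym[of d c] power2_eq_square algebra_simps)
  qed
  also have "\<dots> = sum4 S ?t + sum4 S ?t + sum4 S ?t + sum4 S ?t + K * Q + Q + sum4 S ?u + sum4 S ?u + sum4 S ?u + sum4 S ?u"
    unfolding sum4_add sum4_scale q q'
    using sum4_swap34[of S ?t] sum4_swap12[of S ?t] sum4_swap12[of S "\<lambda>a b c d. ?t a b d c"]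
      sum4_swap12[of S ?u] sum4_swap_pairs[of S ?u] sum4_swap_pairs[of S "\<lambda>a b c d. ?u b a c d"]
    by simp
  also have "\<dots> \<le> 8 * \<beta>\<^sup>2 * L + (K + 1) * Q" using t u by (simp add: algebra_simps)
  finally show ?thesis unfolding L_def Q_def .
qed

lemma (in prob_space) variance_linear_combination:
  fixes X :: "'p \<Rightarrow> 'a \<Rightarrow> real"
  assumes X: "\<And>p. p \<in> P \<Longrightarrow> X p \<in> borel_measurable M" "\<And>p \<omega>. \<bar>X p \<omega>\<bar> \<le> 1"
  shows "expectation (\<lambda>\<omega>. ((\<Sum>p\<in>P. A p * X p \<omega>) - expectation (\<lambda>\<omega>. \<Sum>p\<in>P. A p * X p \<omega>))\<^sup>2)
    = (\<Sum>p\<in>P. \<Sum>q\<in>P. A p * A q * (expectation (\<lambda>\<omega>. X p \<omega> * X q \<omega>) - expectation (X p) * expectation (X q)))"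
proof -
  have i: "integrable M (X p)" if "p \<in> P" for p using X that by (intro integrable_const_bound[of _ 1]) auto
  have i2: "integrable M (\<lambda>\<omega>. X p \<omega> * X q \<omega>)" if "p \<in> P" "q \<in> P" for p q
    using X that by (intro integrable_const_bound[of _ 1]) (auto simp: abs_mult intro!: mult_le_one)
  let ?m = "\<lambda>p. expectation (X p)"
  have m: "expectation (\<lambda>\<omega>. \<Sum>p\<in>P. A p * X p \<omega>) = (\<Sum>p\<in>P. A p * ?m p)"
    using i by (subst Bochner_Integration.integral_sum) auto
  have "expectation (\<lambda>\<omega>. ((\<Sum>p\<in>P. A p * X p \<omega>) - (\<Sum>p\<in>P. A p * ?m p))\<^sup>2)
    = expectation (\<lambda>\<omega>. \<Sum>p\<in>P. \<Sum>q\<in>P. A p * A q * (X p \<omega> * X q \<omega> - ?m q * X p \<omega> - ?m p * X q \<omega> + ?m p * ?m q))"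
    unfolding sum_subtractf[symmetric] power2_eq_square sum_product
    by (intro Bochner_Integration.integral_cong sum.cong refl) (simp add: algebra_simps)
  also have "\<dots> = (\<Sum>p\<in>P. \<Sum>q\<in>P. expectation (\<lambda>\<omega>. A p * A q * (X p \<omega> * X q \<omega> - ?m q * X p \<omega> - ?m p * X q \<omega> + ?m p * ?m q)))"
    using i i2 by (subst Bochner_Integration.integral_sum, force, intro sum.cong refl, subst Bochner_Integration.integral_sum) auto
  also have "\<dots> = (\<Sum>p\<in>P. \<Sum>q\<in>P. A p * A q * (expectation (\<lambda>\<omega>. X p \<omega> * X q \<omega>) - ?m p * ?m q))"
  proof (intro sum.cong refl)
    fix p q assume "p \<in> P" "q \<in> P"
    thus "expectation (\<lambda>\<omega>. A p * A q * (X p \<omega> * X q \<omega> - ?m q * X p \<omega> - ?m p * X q \<omega> + ?m p * ?m q)) =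
       A p * A q * (expectation (\<lambda>\<omega>. X p \<omega> * X q \<omega>) - ?m p * ?m q)"
      using i i2 by (simp add: prob_space)
  qed
  finally show ?thesis unfolding m .
qed

context gaussian_space
begin

text \<open>\<open>carre\<close> is a linear combination over pairs (s, s') of products of two
  sines, whose coefficient already contains the covariance of that pair. So each variance term
  carries the edges ab and cd on top of the graph from \<open>cov_sin4_bound\<close>, the shape
  treated in \<open>sum4_graph_bound\<close>.\<close>

lemma carre_variance_bound:
  fixes R :: "'s \<Rightarrow> 's \<Rightarrow> real"
  assumes U: "\<And>s. s \<in> S \<Longrightarrow> U s \<in> H" and a: "\<And>s. s \<in> S \<Longrightarrow> \<bar>a s\<bar> \<le> \<alpha>"
    and R0: "\<And>a b. 0 \<le> R a b" and sym: "\<And>a b. R a b = R b a" and R\<kappa>: "\<And>a b. R a b \<le> \<kappa>"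
    and cR: "\<And>s s'. s \<in> S \<Longrightarrow> s' \<in> S \<Longrightarrow> \<bar>cov (U s) (U s')\<bar> \<le> R s s'"
    and \<beta>: "\<And>a. a \<in> S \<Longrightarrow> (\<Sum>b\<in>S. (R a b)\<^sup>2) \<le> \<beta>" and t: "t \<in> {0..1}"
  shows "expectation (\<lambda>\<omega>. (carre S a U t \<omega> - expectation (carre S a U t))\<^sup>2)
    \<le> \<alpha>^4 * exp \<kappa> ^ 6 * (8 * \<beta>\<^sup>2 * (\<Sum>a\<in>S. \<Sum>b\<in>S. R a b) + (2 + \<kappa>^4) * (\<Sum>a\<in>S. \<Sum>d\<in>S. (\<Sum>b\<in>S. R a b * R b d)\<^sup>2))"
proof -
  let ?w = "\<lambda>s. exp (- (1 - t\<^sup>2) * cov (U s) (U s) / 2)"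
  define A where "A p = a (fst p) * a (snd p) * cov (U (fst p)) (U (snd p)) * ?w (fst p)" for p
  define X where "X p \<omega> = sin (t * U (fst p) \<omega>) * sin (U (snd p) \<omega>)" for p \<omega>
  have carre: "carre S a U t \<omega> = (\<Sum>p\<in>S\<times>S. A p * X p \<omega>)" for \<omega>
    unfolding carre_def dtrig_def sum_pairs A_def X_def mult_minus_right sum_negf minus_minus sum_distrib_left
    by (intro sum.cong refl) (simp add: mult_ac)
  have w1: "?w s \<le> 1" for s
  proof -
    have "0 \<le> (1 - t\<^sup>2) * cov (U s) (U s)"
      using t cov_self_nonneg[of "U s"] by (intro mult_nonneg_nonneg) (auto simp: power_le_one)
    thus ?thesis unfolding mult_minus_left by simp
  qed
  have Ab: "\<bar>A (s, s')\<bar> \<le> \<alpha>\<^sup>2 * R s s'" if "s \<in> S" "s' \<in> S" for s s'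
  proof -
    have "\<bar>A (s, s')\<bar> = \<bar>a s\<bar> * \<bar>a s'\<bar> * \<bar>cov (U s) (U s')\<bar> * ?w s" by (simp add: A_def abs_mult)
    also have "\<dots> \<le> \<alpha> * \<alpha> * R s s' * 1"
      using a[OF that(1)] a[OF that(2)] cR[OF that] w1[of s] R0
      by (intro mult_mono mult_nonneg_nonneg) auto
    finally show ?thesis by (simp add: power2_eq_square)
  qed
  have Xm: "X p \<in> borel_measurable M" if "p \<in> S \<times> S" for p
    using that H_measurable[OF U] unfolding X_def[abs_def] by (auto intro!: borel_measurable_times)
  have X1: "\<bar>X p \<omega>\<bar> \<le> 1" for p \<omega> by (auto simp: X_def abs_mult intro!: mult_le_one)
  let ?B = "\<lambda>a b c d. R a b * R c d * (R a c + R a d + R b c + R b d) + (1 + \<kappa>^4) * (R a c * R b d) + R a d * R b c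
      + R a b * R a c * R a d + R a b * R b c * R b d + R a c * R b c * R c d + R a d * R b d * R c d"
  \<comment> \<open>The first sine of each pair has argument t U; since t <= 1 its covariances
    satisfy the same bounds.\<close>
  have tc: "\<bar>t * x\<bar> \<le> r" if "\<bar>x\<bar> \<le> r" for x r :: real
    using that t mult_left_le_one_le[of "\<bar>x\<bar>" t] by (auto simp: abs_mult)
  have cb: "\<bar>expectation (\<lambda>\<omega>. X (s1,s2) \<omega> * X (s3,s4) \<omega>) - expectation (X (s1,s2)) * expectation (X (s3,s4))\<bar>
      \<le> exp \<kappa> ^ 6 * ?B s1 s2 s3 s4" if s: "s1 \<in> S" "s2 \<in> S" "s3 \<in> S" "s4 \<in> S" for s1 s2 s3 s4
    unfolding X_def[abs_def] fst_conv snd_conv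
    by (rule cov_sin4_bound[OF H_scale[OF U] U H_scale[OF U] U])
      (use s R\<kappa> in \<open>auto simp: cov_simps U H_scale intro!: tc cR\<close>)
  have "expectation (\<lambda>\<omega>. (carre S a U t \<omega> - expectation (carre S a U t))\<^sup>2) =
    (\<Sum>p\<in>S\<times>S. \<Sum>q\<in>S\<times>S. A p * A q * (expectation (\<lambda>\<omega>. X p \<omega> * X q \<omega>) - expectation (X p) * expectation (X q)))"
    unfolding carre[abs_def] by (rule variance_linear_combination[OF Xm X1])
  also have "\<dots> = sum4 S (\<lambda>s1 s2 s3 s4. A (s1,s2) * A (s3,s4) *
      (expectation (\<lambda>\<omega>. X (s1,s2) \<omega> * X (s3,s4) \<omega>) - expectation (X (s1,s2)) * expectation (X (s3,s4))))"
    unfolding sum4_def sum_pairs by simp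
  also have "\<dots> \<le> sum4 S (\<lambda>s1 s2 s3 s4. (\<alpha>^4 * exp \<kappa> ^ 6) * (R s1 s2 * R s3 s4 * ?B s1 s2 s3 s4))"
  proof (rule sum4_mono)
    fix s1 s2 s3 s4 assume s: "s1 \<in> S" "s2 \<in> S" "s3 \<in> S" "s4 \<in> S"
    let ?C = "expectation (\<lambda>\<omega>. X (s1,s2) \<omega> * X (s3,s4) \<omega>) - expectation (X (s1,s2)) * expectation (X (s3,s4))"
    have "A (s1,s2) * A (s3,s4) * ?C \<le> \<bar>A (s1,s2)\<bar> * \<bar>A (s3,s4)\<bar> * \<bar>?C\<bar>"
      unfolding abs_mult[symmetric] by (rule abs_ge_self)
    also have "\<dots> \<le> (\<alpha>\<^sup>2 * R s1 s2) * (\<alpha>\<^sup>2 * R s3 s4) * (exp \<kappa> ^ 6 * ?B s1 s2 s3 s4)"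
      by (rule mult_mono[OF mult_mono[OF Ab[OF s(1,2)] Ab[OF s(3,4)]] cb[OF s]])
        (use R0 in \<open>auto intro!: mult_nonneg_nonneg\<close>)
    finally show "A (s1,s2) * A (s3,s4) * ?C \<le> (\<alpha>^4 * exp \<kappa> ^ 6) * (R s1 s2 * R s3 s4 * ?B s1 s2 s3 s4)"
      by (simp add: power2_eq_square power4_eq_xxxx mult_ac)
  qed
  also have "\<dots> = \<alpha>^4 * exp \<kappa> ^ 6 * sum4 S (\<lambda>s1 s2 s3 s4. R s1 s2 * R s3 s4 * ?B s1 s2 s3 s4)"
    by (rule sum4_scale)
  also have "\<dots> \<le> \<alpha>^4 * exp \<kappa> ^ 6 * (8 * \<beta>\<^sup>2 * (\<Sum>a\<in>S. \<Sum>b\<in>S. R a b)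
      + ((1 + \<kappa>^4) + 1) * (\<Sum>a\<in>S. \<Sum>d\<in>S. (\<Sum>b\<in>S. R a b * R b d)\<^sup>2))"
    by (intro mult_left_mono sum4_graph_bound[OF R0 sym \<beta>]) auto
  finally show ?thesis by simp
qed

end

section \<open>Stationary sequences with square-summable correlations\<close>

text \<open>Mapping k to |k| covers \<open>A\<close> by two copies of a set of naturals, hence the
  factor 2; overlaps only help, as \<open>g\<close> is nonnegative.\<close>

lemma sum_int_tail_le:
  fixes g :: "int \<Rightarrow> real"
  assumes g0: "\<And>k. 0 \<le> g k" and sym: "\<And>k. g (- k) = g k" and summ: "summable (\<lambda>n. g (int n))"
    and A: "finite A" "\<And>k. k \<in> A \<Longrightarrow> int m \<le> \<bar>k\<bar>"
  shows "(\<Sum>k\<in>A. g k) \<le> 2 * (\<Sum>n. g (int (n + m)))"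
proof -
  let ?N = "(\<lambda>k. nat \<bar>k\<bar>) ` A"
  have fN: "finite ?N" using A by simp
  have sub: "A \<subseteq> int ` ?N \<union> (\<lambda>n. - int n) ` ?N"
  proof
    fix k assume "k \<in> A"
    moreover have "k = int (nat \<bar>k\<bar>) \<or> k = - int (nat \<bar>k\<bar>)" by linarith
    ultimately show "k \<in> int ` ?N \<union> (\<lambda>n. - int n) ` ?N" by blast
  qed
  have N: "(\<Sum>n\<in>?N. g (int n)) \<le> (\<Sum>n. g (int (n + m)))"
  proof -
    \<comment> \<open>All elements are at least \<open>m\<close>, so truncated subtraction of
      \<open>m\<close> is undone by adding it again.\<close>
    have "?N \<subseteq> (\<lambda>n. n + m) ` (\<lambda>n. n - m) ` ?N"
    proof
      fix n assume n: "n \<in> ?N"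
      hence "m \<le> n" using A(2) by force
      thus "n \<in> (\<lambda>n. n + m) ` (\<lambda>n. n - m) ` ?N" using n by (force simp: image_iff)
    qed
    hence "(\<Sum>n\<in>?N. g (int n)) \<le> (\<Sum>n\<in>(\<lambda>n. n + m) ` (\<lambda>n. n - m) ` ?N. g (int n))"
      using fN g0 by (intro sum_mono2) auto
    also have "\<dots> = (\<Sum>n\<in>(\<lambda>n. n - m) ` ?N. g (int (n + m)))"
      by (subst sum.reindex) (auto simp: inj_on_def)
    also have "\<dots> \<le> (\<Sum>n. g (int (n + m)))"
    proof (rule sum_le_suminf)
      show "summable (\<lambda>n. g (int (n + m)))" using summ by (rule summable_ignore_initial_segment)
    qed (use fN g0 in auto)
    finally show ?thesis .
  qed
  have "(\<Sum>k\<in>A. g k) \<le> (\<Sum>k\<in>int ` ?N \<union> (\<lambda>n. - int n) ` ?N. g k)"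
    using fN g0 sub by (intro sum_mono2) auto
  also have "\<dots> \<le> (\<Sum>k\<in>int ` ?N. g k) + (\<Sum>k\<in>(\<lambda>n. - int n) ` ?N. g k)"
  proof -
    have "0 \<le> sum g (int ` ?N \<inter> (\<lambda>n. - int n) ` ?N)" using g0 by (intro sum_nonneg) auto
    thus ?thesis using fN sum.union_inter[of "int ` ?N" "(\<lambda>n. - int n) ` ?N" g] by simp
  qed
  also have "\<dots> = 2 * (\<Sum>n\<in>?N. g (int n))"
    by (subst (1 2) sum.reindex) (auto simp: inj_on_def sym)
  finally show ?thesis using N by linarith
qed

text \<open>In this form of the condition nearby pairs of times may cost a multiple of n, as long as
  distant pairs cost at most \<epsilon> each.\<close>

lemma tendsto_zero_over_square:
  fixes x :: "nat \<Rightarrow> real"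
  assumes "\<And>n. 0 \<le> x n" and "\<And>\<epsilon>. \<epsilon> > 0 \<Longrightarrow> \<exists>K. \<forall>n. x n \<le> \<epsilon> * (real n)\<^sup>2 + K * real n"
  shows "(\<lambda>n. x n / (real n)\<^sup>2) \<longlonglongrightarrow> 0"
proof (rule LIMSEQ_I)
  fix r :: real assume r: "0 < r"
  obtain K where K: "\<And>n. x n \<le> (r/2) * (real n)\<^sup>2 + K * real n" using assms(2)[of "r/2"] r by auto
  obtain n0 :: nat where n0: "\<bar>K\<bar> * 2 / r < real n0" using reals_Archimedean2 by blast
  show "\<exists>no. \<forall>n\<ge>no. norm (x n / (real n)\<^sup>2 - 0) < r"
  proof (intro exI allI impI)
    fix n assume n: "Suc n0 \<le> n"
    hence n1: "0 < real n" by simp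
    have "\<bar>K\<bar> * 2 / r < real n" using n0 n by simp
    hence *: "K < (r/2) * real n" using r by (simp add: field_simps)
    have "x n < r * (real n)\<^sup>2"
      using K[of n] mult_strict_right_mono[OF * n1] by (simp add: power2_eq_square)
    thus "norm (x n / (real n)\<^sup>2 - 0) < r" using n1 assms(1)[of n] by (simp add: field_simps)
  qed
qed

text \<open>A symmetric majorant of all correlations; its square summability is how condition (S)
  enters the general theory.\<close>

locale square_summable =
  fixes \<rho> :: "int \<Rightarrow> real"
  assumes \<rho>_nonneg: "0 \<le> \<rho> k" and \<rho>_sym: "\<rho> (- k) = \<rho> k"
    and \<rho>_square: "summable (\<lambda>n. (\<rho> (int n))\<^sup>2)"
begin

text \<open>An upper bound for the sum of squares over all integers, with lag 0 counted
  twice.\<close>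

definition mass :: real where "mass = 2 * (\<Sum>n. (\<rho> (int n))\<^sup>2)"

lemma mass_nonneg: "0 \<le> mass"
  unfolding mass_def by (intro mult_nonneg_nonneg suminf_nonneg \<rho>_square) auto

lemma sum_\<rho>_square_le: "finite A \<Longrightarrow> (\<Sum>k\<in>A. (\<rho> k)\<^sup>2) \<le> mass"
  using sum_int_tail_le[of "\<lambda>k. (\<rho> k)\<^sup>2" A 0] \<rho>_square \<rho>_sym by (simp add: mass_def)

lemma \<rho>_le: "\<rho> k \<le> 1 + mass"
proof -
  have "(\<rho> k)\<^sup>2 \<le> mass" using sum_\<rho>_square_le[of "{k}"] by simp
  thus ?thesis using sum_squares_bound[of 1 "\<rho> k"] \<rho>_nonneg[of k] by simp
qed

lemma sum_\<rho>_square_diff: "finite A \<Longrightarrow> (\<Sum>l\<in>A. (\<rho> (k - l))\<^sup>2) \<le> mass"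
  using sum_\<rho>_square_le[of "(\<lambda>l. k - l) ` A"] by (simp add: sum.reindex inj_on_def)

lemma \<rho>_swap: "\<rho> (k - l) = \<rho> (l - k)"
  using \<rho>_sym[of "k - l"] by simp

text \<open>One \<open>m\<close> serves every centre \<open>k\<close>, because only differences of
  times occur.\<close>

lemma tail_square:
  assumes "\<epsilon> > 0"
  obtains m where "\<And>A k. finite A \<Longrightarrow> (\<And>l. l \<in> A \<Longrightarrow> int m \<le> \<bar>k - l\<bar>) \<Longrightarrow> (\<Sum>l\<in>A. (\<rho> (k - l))\<^sup>2) \<le> \<epsilon>"
proof -
  obtain m where m: "\<bar>\<Sum>n. (\<rho> (int (n + m)))\<^sup>2\<bar> < \<epsilon> / 2"
    using suminf_exist_split[of "\<epsilon> / 2" "\<lambda>n. (\<rho> (int n))\<^sup>2"] \<rho>_square assms by (auto simp: real_norm_def)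
  have "(\<Sum>l\<in>A. (\<rho> (k - l))\<^sup>2) \<le> \<epsilon>" if A: "finite A" "\<And>l. l \<in> A \<Longrightarrow> int m \<le> \<bar>k - l\<bar>" for A k
  proof -
    have "(\<Sum>l\<in>A. (\<rho> (k - l))\<^sup>2) = (\<Sum>l\<in>(\<lambda>l. k - l) ` A. (\<rho> l)\<^sup>2)" by (subst sum.reindex) (auto simp: inj_on_def)
    also have "\<dots> \<le> 2 * (\<Sum>n. (\<rho> (int (n + m)))\<^sup>2)"
      using A \<rho>_square \<rho>_sym by (intro sum_int_tail_le) auto
    finally show ?thesis using m by linarith
  qed
  thus ?thesis by (rule that)
qed

text \<open>As \<rho> itself need not be summable, it is split by \<rho> <= \<epsilon> + \<rho>^2 /
  \<epsilon>, whose second part is summable.\<close>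

lemma edge_sum_tendsto:
  "(\<lambda>n. (\<Sum>k\<in>{1..int n}. \<Sum>l\<in>{1..int n}. \<rho> (k - l)) / (real n)\<^sup>2) \<longlonglongrightarrow> 0"
proof (rule tendsto_zero_over_square)
  show "0 \<le> (\<Sum>k\<in>{1..int n}. \<Sum>l\<in>{1..int n}. \<rho> (k - l))" for n by (intro sum_nonneg \<rho>_nonneg)
  fix \<epsilon> :: real assume e: "\<epsilon> > 0"
  have le: "\<rho> k \<le> \<epsilon> + (\<rho> k)\<^sup>2 / \<epsilon>" for k
  proof (cases "\<rho> k \<le> \<epsilon>")
    case False
    hence "\<rho> k * \<epsilon> \<le> \<rho> k * \<rho> k" using \<rho>_nonneg[of k] by (intro mult_left_mono) auto
    hence "\<rho> k \<le> (\<rho> k)\<^sup>2 / \<epsilon>" using e by (simp add: field_simps power2_eq_square)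
    thus ?thesis using e by simp
  qed (use e in \<open>simp add: add_increasing2\<close>)
  have "(\<Sum>k\<in>{1..int n}. \<Sum>l\<in>{1..int n}. \<rho> (k - l)) \<le> \<epsilon> * (real n)\<^sup>2 + mass / \<epsilon> * real n" for n
  proof -
    have "(\<Sum>k\<in>{1..int n}. \<Sum>l\<in>{1..int n}. \<rho> (k - l)) \<le> (\<Sum>k\<in>{1..int n}. \<Sum>l\<in>{1..int n}. \<epsilon> + (\<rho> (k - l))\<^sup>2 / \<epsilon>)"
      by (intro sum_mono le)
    also have "\<dots> = (\<Sum>k\<in>{1..int n}. \<epsilon> * real n + (\<Sum>l\<in>{1..int n}. (\<rho> (k - l))\<^sup>2) / \<epsilon>)"
      by (simp add: sum.distrib sum_divide_distrib mult.commute)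
    also have "\<dots> \<le> (\<Sum>k\<in>{1..int n}. \<epsilon> * real n + mass / \<epsilon>)"
      using e by (intro sum_mono add_mono divide_right_mono sum_\<rho>_square_diff) auto
    also have "\<dots> = \<epsilon> * (real n)\<^sup>2 + mass / \<epsilon> * real n" by (simp add: power2_eq_square algebra_simps)
    finally show ?thesis .
  qed
  thus "\<exists>K. \<forall>n. (\<Sum>k\<in>{1..int n}. \<Sum>l\<in>{1..int n}. \<rho> (k - l)) \<le> \<epsilon> * (real n)\<^sup>2 + K * real n" by blast
qed

lemma path_sum_le: "finite A \<Longrightarrow> (\<Sum>j\<in>A. \<rho> (k - j) * \<rho> (j - l)) \<le> mass"
proof -
  assume A: "finite A"
  have "(\<Sum>j\<in>A. \<rho> (k - j) * \<rho> (j - l)) \<le> (\<Sum>j\<in>A. ((\<rho> (k - j))\<^sup>2 + (\<rho> (l - j))\<^sup>2) / 2)"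
  proof (rule sum_mono)
    fix j show "\<rho> (k - j) * \<rho> (j - l) \<le> ((\<rho> (k - j))\<^sup>2 + (\<rho> (l - j))\<^sup>2) / 2"
      using sum_squares_bound[of "\<rho> (k - j)" "\<rho> (l - j)"] \<rho>_swap[of j l] by simp
  qed
  also have "\<dots> = ((\<Sum>j\<in>A. (\<rho> (k - j))\<^sup>2) + (\<Sum>j\<in>A. (\<rho> (l - j))\<^sup>2)) / 2"
    by (simp only: sum_divide_distrib[symmetric] sum.distrib)
  also have "\<dots> \<le> mass" using add_mono[OF sum_\<rho>_square_diff[OF A, of k] sum_\<rho>_square_diff[OF A, of l]] by simp
  finally show ?thesis .
qed

text \<open>A convolution of square-summable sequences vanishes at infinity: if k and l are 2m
  apart, each j is at distance at least m from one of them, and the factor belonging to that end has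
  a small sum of squares.\<close>

lemma path_sum_tail:
  assumes e: "\<epsilon> > 0"
  obtains m where "\<And>A k l. finite A \<Longrightarrow> int m \<le> \<bar>k - l\<bar> \<Longrightarrow> (\<Sum>j\<in>A. \<rho> (k - j) * \<rho> (j - l)) \<le> \<epsilon>"
proof -
  \<comment> \<open>The weight in the inequality 2xy <= x^2 / \<eta> + \<eta> y^2. The near factor
    then costs \<eta> times \<open>mass\<close>, at most \<epsilon> / 2, and a tail below \<eta>
    \<epsilon> / 2 for the far factor costs \<epsilon> / 2 as well. Adding 1 to \<open>mass\<close>
    avoids division by 0.\<close>
  define \<eta> where "\<eta> = \<epsilon> / (2 * (mass + 1))"
  have \<eta>: "0 < \<eta>" using e mass_nonneg by (simp add: \<eta>_def)
  have \<eta>m: "\<eta> * mass \<le> \<epsilon> / 2"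
    using e mass_nonneg by (simp add: \<eta>_def field_simps)
  obtain m where m: "\<And>A k. finite A \<Longrightarrow> (\<And>l. l \<in> A \<Longrightarrow> int m \<le> \<bar>k - l\<bar>) \<Longrightarrow> (\<Sum>l\<in>A. (\<rho> (k - l))\<^sup>2) \<le> \<eta> * \<epsilon> / 2"
    using tail_square[of "\<eta> * \<epsilon> / 2"] \<eta> e by (metis half_gt_zero mult_pos_pos)
  have ineq: "x * y \<le> (x\<^sup>2 / \<eta> + \<eta> * y\<^sup>2) / 2" for x y :: real
  proof -
    have "0 \<le> (x - \<eta> * y)\<^sup>2" by simp
    hence "2 * \<eta> * (x * y) \<le> x\<^sup>2 + \<eta>\<^sup>2 * y\<^sup>2" by (simp add: power2_eq_square algebra_simps)
    thus ?thesis using \<eta> by (simp add: field_simps power2_eq_square)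
  qed
  have half: "(\<Sum>j\<in>A. \<rho> (k - j) * \<rho> (j - l)) \<le> \<epsilon> / 2" if A: "finite A" "\<And>j. j \<in> A \<Longrightarrow> int m \<le> \<bar>k - j\<bar>" for A k l
  proof -
    have "(\<Sum>j\<in>A. \<rho> (k - j) * \<rho> (j - l)) \<le> (\<Sum>j\<in>A. ((\<rho> (k - j))\<^sup>2 / \<eta> + \<eta> * (\<rho> (l - j))\<^sup>2) / 2)"
      using ineq \<rho>_swap by (intro sum_mono) simp
    also have "\<dots> = ((\<Sum>j\<in>A. (\<rho> (k - j))\<^sup>2) / \<eta> + \<eta> * (\<Sum>j\<in>A. (\<rho> (l - j))\<^sup>2)) / 2"
      by (simp only: sum_divide_distrib[symmetric] sum.distrib sum_distrib_left[symmetric])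
    also have "\<dots> \<le> ((\<eta> * \<epsilon> / 2) / \<eta> + \<eta> * mass) / 2"
      using \<eta> m[OF A] sum_\<rho>_square_diff[OF A(1), of l] by (intro divide_right_mono add_mono mult_left_mono) auto
    also have "\<dots> \<le> \<epsilon> / 2" using \<eta>m \<eta> by simp
    finally show ?thesis .
  qed
  have "(\<Sum>j\<in>A. \<rho> (k - j) * \<rho> (j - l)) \<le> \<epsilon>" if A: "finite A" and kl: "int (2 * m) \<le> \<bar>k - l\<bar>" for A k l
  proof -
    let ?A1 = "{j\<in>A. int m \<le> \<bar>k - j\<bar>}" and ?A2 = "{j\<in>A. \<not> int m \<le> \<bar>k - j\<bar>}"
    have "(\<Sum>j\<in>A. \<rho> (k - j) * \<rho> (j - l)) = (\<Sum>j\<in>?A1. \<rho> (k - j) * \<rho> (j - l)) + (\<Sum>j\<in>?A2. \<rho> (k - j) * \<rho> (j - l))"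
      using A by (subst sum.union_disjoint[symmetric]) (auto intro!: sum.cong)
    moreover have "(\<Sum>j\<in>?A1. \<rho> (k - j) * \<rho> (j - l)) \<le> \<epsilon> / 2" using A by (intro half) auto
    moreover have "(\<Sum>j\<in>?A2. \<rho> (l - j) * \<rho> (j - k)) \<le> \<epsilon> / 2" using A kl by (intro half) auto
    moreover have "(\<Sum>j\<in>?A2. \<rho> (l - j) * \<rho> (j - k)) = (\<Sum>j\<in>?A2. \<rho> (k - j) * \<rho> (j - l))"
      using \<rho>_swap by (intro sum.cong) (auto simp: mult.commute)
    ultimately show ?thesis by linarith
  qed
  thus ?thesis by (rule that)
qed

text \<open>A 4-cycle is a squared path sum between opposite corners. By
  \<open>path_sum_tail\<close> it is small for distant corners, and each corner has at most 2m + 1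
  near partners.\<close>

lemma cycle_sum_tendsto:
  "(\<lambda>n. (\<Sum>k\<in>{1..int n}. \<Sum>l\<in>{1..int n}. (\<Sum>j\<in>{1..int n}. \<rho> (k - j) * \<rho> (j - l))\<^sup>2) / (real n)\<^sup>2) \<longlonglongrightarrow> 0"
proof (rule tendsto_zero_over_square)
  show "0 \<le> (\<Sum>k\<in>{1..int n}. \<Sum>l\<in>{1..int n}. (\<Sum>j\<in>{1..int n}. \<rho> (k - j) * \<rho> (j - l))\<^sup>2)" for n by (intro sum_nonneg) auto
  fix \<epsilon> :: real assume e: "\<epsilon> > 0"
  obtain m where m: "\<And>A k l. finite A \<Longrightarrow> int m \<le> \<bar>k - l\<bar> \<Longrightarrow> (\<Sum>j\<in>A. \<rho> (k - j) * \<rho> (j - l)) \<le> sqrt \<epsilon>"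
    using path_sum_tail[of "sqrt \<epsilon>"] e by (metis real_sqrt_gt_0_iff)
  have "(\<Sum>k\<in>{1..int n}. \<Sum>l\<in>{1..int n}. (\<Sum>j\<in>{1..int n}. \<rho> (k - j) * \<rho> (j - l))\<^sup>2)
      \<le> \<epsilon> * (real n)\<^sup>2 + (2 * real m + 1) * mass\<^sup>2 * real n" for n
  proof -
    let ?P = "\<lambda>k l. \<Sum>j\<in>{1..int n}. \<rho> (k - j) * \<rho> (j - l)"
    have P0: "0 \<le> ?P k l" for k l by (intro sum_nonneg mult_nonneg_nonneg \<rho>_nonneg)
    have le: "(?P k l)\<^sup>2 \<le> \<epsilon> + (if l \<in> {k - int m..k + int m} then mass\<^sup>2 else 0)" for k l
    proof (cases "int m \<le> \<bar>k - l\<bar>")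
      case True
      have "(?P k l)\<^sup>2 \<le> (sqrt \<epsilon>)\<^sup>2" using m[OF _ True, of "{1..int n}"] P0 by (intro power_mono) auto
      hence "(?P k l)\<^sup>2 \<le> \<epsilon>" using e by simp
      moreover have "0 \<le> (if l \<in> {k - int m..k + int m} then mass\<^sup>2 else 0)" by simp
      ultimately show ?thesis by linarith
    next
      case False
      have "(?P k l)\<^sup>2 \<le> mass\<^sup>2" using path_sum_le[of "{1..int n}" k l] P0 by (intro power_mono) auto
      thus ?thesis using False e by auto
    qed
    have "(\<Sum>k\<in>{1..int n}. \<Sum>l\<in>{1..int n}. (?P k l)\<^sup>2) \<le> (\<Sum>k\<in>{1..int n}. \<Sum>l\<in>{1..int n}. \<epsilon> + (if l \<in> {k - int m..k + int m} then mass\<^sup>2 else 0))"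
      by (intro sum_mono le)
    also have "\<dots> \<le> (\<Sum>k\<in>{1..int n}. \<epsilon> * real n + (2 * real m + 1) * mass\<^sup>2)"
    proof (rule sum_mono)
      fix k
      have "(\<Sum>l\<in>{1..int n}. if l \<in> {k - int m..k + int m} then mass\<^sup>2 else 0) = (\<Sum>l\<in>{1..int n} \<inter> {k - int m..k + int m}. mass\<^sup>2)"
        by (subst sum.inter_restrict) auto
      also have "\<dots> \<le> (\<Sum>l\<in>{k - int m..k + int m}. mass\<^sup>2)" by (intro sum_mono2) auto
      also have "\<dots> = (2 * real m + 1) * mass\<^sup>2" by simp
      finally show "(\<Sum>l\<in>{1..int n}. \<epsilon> + (if l \<in> {k - int m..k + int m} then mass\<^sup>2 else 0)) \<le> \<epsilon> * real n + (2 * real m + 1) * mass\<^sup>2"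
        by (simp add: sum.distrib mult.commute)
    qed
    also have "\<dots> = \<epsilon> * (real n)\<^sup>2 + (2 * real m + 1) * mass\<^sup>2 * real n" by (simp add: power2_eq_square algebra_simps)
    finally show ?thesis .
  qed
  thus "\<exists>K. \<forall>n. (\<Sum>k\<in>{1..int n}. \<Sum>l\<in>{1..int n}. (\<Sum>j\<in>{1..int n}. \<rho> (k - j) * \<rho> (j - l))\<^sup>2) \<le> \<epsilon> * (real n)\<^sup>2 + K * real n"
    by blast
qed

end

text \<open>The finite set \<open>I\<close> indexes the coordinates of the random vector observed at
  one time. A function of a whole window of the process thus becomes a function of one vector of a
  stationary sequence.\<close>

locale stationary_gaussian = gaussian_space M H + square_summable \<rho>
  for M :: "'a measure" and H and \<rho> +
  fixes I :: "'i set" and V :: "'i \<Rightarrow> int \<Rightarrow> 'a \<Rightarrow> real" and C :: "'i \<Rightarrow> 'i \<Rightarrow> int \<Rightarrow> real"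
  assumes finite_I: "finite I" and H_zero: "(\<lambda>\<omega>. 0) \<in> H" and V_H: "a \<in> I \<Longrightarrow> V a k \<in> H"
    and cov_V: "a \<in> I \<Longrightarrow> b \<in> I \<Longrightarrow> cov (V a k) (V b l) = C a b (l - k)"
    and C_le: "a \<in> I \<Longrightarrow> b \<in> I \<Longrightarrow> \<bar>C a b k\<bar> \<le> \<rho> k"
begin

definition lin :: "('i \<Rightarrow> real) \<Rightarrow> int \<Rightarrow> 'a \<Rightarrow> real" where
  "lin x k \<omega> = (\<Sum>a\<in>I. x a * V a k \<omega>)"

definition bil :: "int \<Rightarrow> ('i \<Rightarrow> real) \<Rightarrow> ('i \<Rightarrow> real) \<Rightarrow> real" where
  "bil k x y = (\<Sum>a\<in>I. \<Sum>b\<in>I. x a * y b * C a b k)"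

lemma H_sum: "(\<And>i. i \<in> J \<Longrightarrow> X i \<in> H) \<Longrightarrow> (\<lambda>\<omega>. \<Sum>i\<in>J. X i \<omega>) \<in> H"
  by (induction J rule: infinite_finite_induct) (auto intro: H_zero H_add)

lemma cov_sum: "(\<And>i. i \<in> J \<Longrightarrow> X i \<in> H) \<Longrightarrow> Y \<in> H \<Longrightarrow> cov (\<lambda>\<omega>. \<Sum>i\<in>J. X i \<omega>) Y = (\<Sum>i\<in>J. cov (X i) Y)"
proof (induction J rule: infinite_finite_induct)
  case (insert i J)
  thus ?case using cov_add[of "X i" "\<lambda>\<omega>. \<Sum>i\<in>J. X i \<omega>" Y] H_sum[of J X] by simp
qed (simp_all add: cov_def)

lemma lin_H: "lin x k \<in> H"
  unfolding lin_def[abs_def] by (intro H_sum H_scale V_H)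

lemma cov_lin: "cov (lin x k) (lin y l) = bil (l - k) x y"
proof -
  have 1: "cov (lin x k) Y = (\<Sum>a\<in>I. x a * cov (V a k) Y)" if "Y \<in> H" for x k Y
    unfolding lin_def[abs_def] using that
    by (subst cov_sum) (auto intro!: H_scale V_H sum.cong simp: cov_scale V_H)
  have "cov (lin x k) (lin y l) = (\<Sum>a\<in>I. x a * (\<Sum>b\<in>I. y b * cov (V b l) (V a k)))"
    unfolding 1[OF lin_H]
  proof (intro sum.cong refl)
    fix a assume "a \<in> I"
    thus "x a * cov (V a k) (lin y l) = x a * (\<Sum>b\<in>I. y b * cov (V b l) (V a k))"
      unfolding cov_commute[of "V a k" "lin y l"] by (simp add: 1 V_H)
  qed
  also have "\<dots> = bil (l - k) x y"
    unfolding bil_def sum_distrib_left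
    by (intro sum.cong refl) (simp add: cov_V cov_commute[of "V _ l"] mult.assoc)
  finally show ?thesis .
qed

lemma bil_le: "\<bar>bil k x y\<bar> \<le> (\<Sum>a\<in>I. \<bar>x a\<bar>) * (\<Sum>a\<in>I. \<bar>y a\<bar>) * \<rho> k"
proof -
  have "\<bar>bil k x y\<bar> \<le> (\<Sum>a\<in>I. \<Sum>b\<in>I. \<bar>x a\<bar> * \<bar>y b\<bar> * \<rho> k)"
    unfolding bil_def
    by (intro order_trans[OF sum_abs] sum_mono) (auto simp: abs_mult intro!: mult_left_mono C_le)
  also have "\<dots> = (\<Sum>a\<in>I. \<bar>x a\<bar>) * (\<Sum>a\<in>I. \<bar>y a\<bar>) * \<rho> k"
    unfolding sum_product by (simp only: sum_distrib_right)
  finally show ?thesis .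
qed

text \<open>The vertices are pairs of a frequency and a time. Coefficients have order n^(-1/2), so
  their fourth power supplies the factor n^(-2) against which edge and cycle sums vanish. The
  comparison is with the Gaussian law of the same variance, so convergence of the variances is left
  for later.\<close>

lemma trig_clt:
  fixes N :: nat and c :: "nat \<Rightarrow> real" and x :: "nat \<Rightarrow> 'i \<Rightarrow> real"
  defines "Z \<equiv> \<lambda>n \<omega>. (\<Sum>k\<in>{1..int n}. \<Sum>m<N. c m * (cos (lin (x m) k \<omega>) - exp (- bil 0 (x m) (x m) / 2))) / sqrt (real n)"
  shows "(\<lambda>n. expectation (\<lambda>\<omega>. cis (\<theta> * Z n \<omega>)) - of_real (exp (- \<theta>\<^sup>2 * expectation (\<lambda>\<omega>. (Z n \<omega>)\<^sup>2) / 2))) \<longlonglongrightarrow> 0"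
proof -
  define S where "S n = {..<N} \<times> {1..int n}" for n
  define U where "U s = lin (x (fst s)) (snd s)" for s
  define a where "a n s = c (fst s) / sqrt (real n)" for n and s :: "nat \<times> int"
  have Z: "Z n = trig (S n) (a n) U" for n
  proof
    fix \<omega>
    have "trig (S n) (a n) U \<omega> = (\<Sum>m<N. \<Sum>k\<in>{1..int n}. c m * (cos (lin (x m) k \<omega>) - exp (- bil 0 (x m) (x m) / 2)) / sqrt (real n))"
      unfolding trig_def S_def sum_pairs U_def a_def cov_lin by simp
    also have "\<dots> = (\<Sum>k\<in>{1..int n}. \<Sum>m<N. c m * (cos (lin (x m) k \<omega>) - exp (- bil 0 (x m) (x m) / 2)) / sqrt (real n))"
      by (rule sum.swap)
    also have "\<dots> = Z n \<omega>" unfolding Z_def by (simp only: sum_divide_distrib)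
    finally show "Z n \<omega> = trig (S n) (a n) U \<omega>" by simp
  qed
  have UH: "U s \<in> H" for s by (simp add: U_def lin_H)
  \<comment> \<open>The sum of the l1-norms of all frequencies bounds each of them, so q^2 \<rho>
    dominates every covariance between vertices.\<close>
  define q where "q = (\<Sum>m<N. \<Sum>a\<in>I. \<bar>x m a\<bar>)"
  define R where "R s s' = q\<^sup>2 * \<rho> (snd s - snd s')" for s s' :: "nat \<times> int"
  define \<kappa> where "\<kappa> = q\<^sup>2 * (1 + mass)"
  \<comment> \<open>Each time carries \<open>N\<close> vertices, and R^2 equals q^4
    \<rho>^2.\<close>
  define \<beta> where "\<beta> = real N * (q\<^sup>2)\<^sup>2 * mass"
  define \<gamma> where "\<gamma> = (\<Sum>m<N. \<bar>c m\<bar>)"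
  have R0: "0 \<le> R s s'" for s s' by (simp add: R_def \<rho>_nonneg)
  have Rs: "R s s' = R s' s" for s s' unfolding R_def using \<rho>_swap by simp
  have R\<kappa>: "R s s' \<le> \<kappa>" for s s' unfolding R_def \<kappa>_def by (intro mult_left_mono \<rho>_le) simp
  have cR: "\<bar>cov (U s) (U s')\<bar> \<le> R s s'" if "s \<in> S n" "s' \<in> S n" for s s' n
  proof -
    have "\<bar>cov (U s) (U s')\<bar> \<le> (\<Sum>a\<in>I. \<bar>x (fst s) a\<bar>) * (\<Sum>a\<in>I. \<bar>x (fst s') a\<bar>) * \<rho> (snd s' - snd s)"
      unfolding U_def cov_lin by (rule bil_le)
    also have "\<dots> \<le> q * q * \<rho> (snd s' - snd s)"
      using that unfolding q_def S_def
      by (intro mult_right_mono mult_mono \<rho>_nonneg member_le_sum) (auto intro!: sum_nonneg)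
    also have "\<dots> = R s s'" unfolding R_def using \<rho>_swap by (simp add: power2_eq_square)
    finally show ?thesis .
  qed
  have Rb: "(\<Sum>s'\<in>S n. (R s s')\<^sup>2) \<le> \<beta>" for s n
  proof -
    have "(\<Sum>s'\<in>S n. (R s s')\<^sup>2) = real N * (q\<^sup>2)\<^sup>2 * (\<Sum>l\<in>{1..int n}. (\<rho> (snd s - l))\<^sup>2)"
      unfolding S_def sum_pairs R_def by (simp add: power_mult_distrib sum_distrib_left mult.assoc)
    also have "\<dots> \<le> \<beta>" unfolding \<beta>_def by (intro mult_left_mono sum_\<rho>_square_diff) auto
    finally show ?thesis .
  qed
  have ab: "\<bar>a n s\<bar> \<le> \<gamma> / sqrt (real n)" if "s \<in> S n" for s n
    using that unfolding a_def \<gamma>_def S_def abs_divide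
    by (auto intro!: divide_right_mono member_le_sum)
  let ?L = "\<lambda>n. \<Sum>k\<in>{1..int n}. \<Sum>l\<in>{1..int n}. \<rho> (k - l)"
  let ?Q = "\<lambda>n. \<Sum>k\<in>{1..int n}. \<Sum>l\<in>{1..int n}. (\<Sum>j\<in>{1..int n}. \<rho> (k - j) * \<rho> (j - l))\<^sup>2"
  have RL: "(\<Sum>s\<in>S n. \<Sum>s'\<in>S n. R s s') = (real N)\<^sup>2 * q\<^sup>2 * ?L n" for n
    unfolding S_def sum_pairs R_def by (simp add: sum_distrib_left power2_eq_square mult.assoc)
  have RQ: "(\<Sum>s\<in>S n. \<Sum>d\<in>S n. (\<Sum>b\<in>S n. R s b * R b d)\<^sup>2) = (real N)\<^sup>2 * (real N * (q\<^sup>2)\<^sup>2)\<^sup>2 * ?Q n" for n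
  proof -
    define P where "P k l = (\<Sum>j\<in>{1..int n}. \<rho> (k - j) * \<rho> (j - l))" for k l
    define K where "K = real N * (q\<^sup>2)\<^sup>2"
    have "(\<Sum>b\<in>S n. R s b * R b d) = K * P (snd s) (snd d)" for s d
      unfolding S_def sum_pairs R_def K_def P_def by (simp add: sum_distrib_left power2_eq_square mult_ac)
    hence inner: "(\<Sum>b\<in>S n. R s b * R b d)\<^sup>2 = K\<^sup>2 * (P (snd s) (snd d))\<^sup>2" for s d
      by (simp add: power_mult_distrib)
    show ?thesis
      unfolding inner unfolding K_def[symmetric] P_def[symmetric] S_def sum_pairs
      by (simp add: sum_distrib_left power2_eq_square[of "real N"] mult.assoc)
  qed
  \<comment> \<open>The bound of \<open>carre_variance_bound\<close> for these data; its square root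
    plays the role of \<delta> in \<open>char_trig_gaussian_bound\<close>.\<close>
  define D where "D n = (\<gamma> / sqrt (real n))^4 * exp \<kappa> ^ 6 * (8 * \<beta>\<^sup>2 * ((real N)\<^sup>2 * q\<^sup>2 * ?L n)
      + (2 + \<kappa>^4) * ((real N)\<^sup>2 * (real N * (q\<^sup>2)\<^sup>2)\<^sup>2 * ?Q n))" for n
  \<comment> \<open>For n = 0 both sides vanish by the convention for division by 0.\<close>
  have D: "D n = \<gamma>^4 * exp \<kappa> ^ 6 * (8 * \<beta>\<^sup>2 * ((real N)\<^sup>2 * q\<^sup>2 * (?L n / (real n)\<^sup>2))
      + (2 + \<kappa>^4) * ((real N)\<^sup>2 * (real N * (q\<^sup>2)\<^sup>2)\<^sup>2 * (?Q n / (real n)\<^sup>2)))" for n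
  proof -
    have "sqrt (real n) ^ 4 = (sqrt (real n) ^ 2) ^ 2" by (simp add: power2_eq_square power4_eq_xxxx)
    hence "sqrt (real n) ^ 4 = (real n)\<^sup>2" by simp
    thus ?thesis unfolding D_def power_divide by (cases "n = 0") (simp_all add: field_simps)
  qed
  have D0: "D \<longlonglongrightarrow> 0"
  proof -
    have "D \<longlonglongrightarrow> \<gamma>^4 * exp \<kappa> ^ 6 * (8 * \<beta>\<^sup>2 * ((real N)\<^sup>2 * q\<^sup>2 * 0) + (2 + \<kappa>^4) * ((real N)\<^sup>2 * (real N * (q\<^sup>2)\<^sup>2)\<^sup>2 * 0))"
      unfolding D by (intro tendsto_intros edge_sum_tendsto cycle_sum_tendsto)
    thus ?thesis by simp
  qed
  have Dn: "0 \<le> D n" for n unfolding D_def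
    by (intro mult_nonneg_nonneg add_nonneg_nonneg sum_nonneg \<rho>_nonneg) auto
  have var: "expectation (\<lambda>\<omega>. (carre (S n) (a n) U t \<omega> - expectation (carre (S n) (a n) U t))\<^sup>2) \<le> (sqrt (D n))\<^sup>2"
    if "t \<in> {0..1}" for n t
  proof -
    have "expectation (\<lambda>\<omega>. (carre (S n) (a n) U t \<omega> - expectation (carre (S n) (a n) U t))\<^sup>2)
      \<le> (\<gamma> / sqrt (real n))^4 * exp \<kappa> ^ 6 * (8 * \<beta>\<^sup>2 * (\<Sum>s\<in>S n. \<Sum>s'\<in>S n. R s s')
        + (2 + \<kappa>^4) * (\<Sum>s\<in>S n. \<Sum>d\<in>S n. (\<Sum>b\<in>S n. R s b * R b d)\<^sup>2))"
      by (rule carre_variance_bound) (rule UH ab R0 Rs R\<kappa> cR Rb that | assumption)+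
    thus ?thesis using Dn[of n] unfolding RL RQ D_def by simp
  qed
  have bound: "cmod (expectation (\<lambda>\<omega>. cis (\<theta> * Z n \<omega>)) - of_real (exp (- \<theta>\<^sup>2 * expectation (\<lambda>\<omega>. (Z n \<omega>)\<^sup>2) / 2)))
     \<le> \<theta>\<^sup>2 * sqrt (D n)" for n
    unfolding Z by (rule char_trig_gaussian_bound[OF UH _ var]) (use Dn in auto)
  have "(\<lambda>n. \<theta>\<^sup>2 * sqrt (D n)) \<longlonglongrightarrow> \<theta>\<^sup>2 * sqrt 0" by (intro tendsto_intros D0)
  thus ?thesis by (intro Lim_null_comparison[OF always_eventually[OF allI[OF bound]]]) simp
qed

end

section \<open>Comparison of covariances across lags\<close>

lemma sum_mult_pull:
  fixes a b P :: real
  shows "(\<Sum>i\<in>A. (a * f i) * (b * g i) * P) = a * b * ((\<Sum>i\<in>A. f i * g i) * P)"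
  by (simp add: sum_distrib_left sum_distrib_right mult_ac)

lemma sum_mult_pull2:
  fixes a P :: real
  shows "(\<Sum>i\<in>A. \<Sum>j\<in>B. a * h i j * P) = a * ((\<Sum>i\<in>A. \<Sum>j\<in>B. h i j) * P)"
  by (simp add: sum_distrib_left sum_distrib_right mult_ac)

lemma sum4_swap_outer_inner:
  "(\<Sum>i\<in>A. \<Sum>j\<in>B. \<Sum>m\<in>C. \<Sum>l\<in>E. F i j m l) = (\<Sum>m\<in>C. \<Sum>l\<in>E. \<Sum>i\<in>A. \<Sum>j\<in>B. F i j m l)"
proof -
  have "(\<Sum>i\<in>A. \<Sum>j\<in>B. \<Sum>m\<in>C. \<Sum>l\<in>E. F i j m l) = (\<Sum>p\<in>A\<times>B. \<Sum>q\<in>C\<times>E. F (fst p) (snd p) (fst q) (snd q))"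
    by (simp add: sum_pairs)
  also have "\<dots> = (\<Sum>q\<in>C\<times>E. \<Sum>p\<in>A\<times>B. F (fst p) (snd p) (fst q) (snd q))" by (rule sum.swap)
  finally show ?thesis by (simp add: sum_pairs)
qed

text \<open>Chaos-by-chaos comparison: for the q-th power both sides are quadratic forms in the
  q-fold tensor powers of the vectors x m.\<close>

lemma power_bilinear_sum_bound:
  fixes x y :: "nat \<Rightarrow> nat \<Rightarrow> real" and A :: "nat \<Rightarrow> nat \<Rightarrow> real"
  assumes A: "\<And>i j. i < D \<Longrightarrow> j < D \<Longrightarrow> \<bar>A i j\<bar> \<le> \<epsilon>" and \<epsilon>: "0 \<le> \<epsilon>"
  shows "\<bar>\<Sum>m<N. \<Sum>l<N. u m * v l * (\<Sum>i<D. \<Sum>j<D. x m i * x l j * A i j) ^ q\<bar>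
    \<le> (real D * \<epsilon>) ^ q * ((\<Sum>m<N. \<Sum>l<N. u m * u l * (\<Sum>i<D. x m i * x l i) ^ q)
        + (\<Sum>m<N. \<Sum>l<N. v m * v l * (\<Sum>i<D. x m i * x l i) ^ q)) / 2"
\<comment> \<open>The weights are generalised separately because the step absorbs a coordinate x m i
  into \<open>u\<close> and a possibly different coordinate x l j into \<open>v\<close>.\<close>
proof (induction q arbitrary: u v)
  case 0
  have "(\<Sum>m<N. \<Sum>l<N. u m * v l) = (\<Sum>m<N. u m) * (\<Sum>m<N. v m)" for u v :: "nat \<Rightarrow> real"
    by (simp add: sum_product)
  moreover have "\<bar>s * t\<bar> \<le> (s * s + t * t) / 2" for s t :: real
    using sum_squares_bound[of "\<bar>s\<bar>" "\<bar>t\<bar>"] by (simp add: abs_mult power2_eq_square)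
  ultimately show ?case by simp
next
  case (Suc q)
  let ?\<Phi> = "\<lambda>q u. \<Sum>m<N. \<Sum>l<N. u m * u l * (\<Sum>i<D. x m i * x l i) ^ q"
  let ?P = "\<lambda>q u v. \<Sum>m<N. \<Sum>l<N. u m * v l * (\<Sum>i<D. \<Sum>j<D. x m i * x l j * A i j) ^ q"
  \<comment> \<open>Peeling off one tensor factor: weighting by one coordinate and summing over
    coordinates raises the power by 1.\<close>
  have \<Phi>: "(\<Sum>i<D. ?\<Phi> q (\<lambda>m. u m * x m i)) = ?\<Phi> (Suc q) u" for u
  proof -
    have "(\<Sum>i<D. ?\<Phi> q (\<lambda>m. u m * x m i)) = (\<Sum>m<N. \<Sum>l<N. \<Sum>i<D. (u m * x m i) * (u l * x l i) * (\<Sum>i<D. x m i * x l i) ^ q)"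
      by (subst sum.swap, rule sum.cong[OF refl], rule sum.swap)
    also have "\<dots> = ?\<Phi> (Suc q) u" unfolding sum_mult_pull power_Suc ..
    finally show ?thesis .
  qed
  have P: "?P (Suc q) u v = (\<Sum>i<D. \<Sum>j<D. A i j * ?P q (\<lambda>m. u m * x m i) (\<lambda>l. v l * x l j))"
  proof -
    have "(\<Sum>i<D. \<Sum>j<D. A i j * ?P q (\<lambda>m. u m * x m i) (\<lambda>l. v l * x l j))
      = (\<Sum>i<D. \<Sum>j<D. \<Sum>m<N. \<Sum>l<N. u m * v l * (x m i * x l j * A i j) * (\<Sum>i<D. \<Sum>j<D. x m i * x l j * A i j) ^ q)"
      unfolding sum_distrib_left by (intro sum.cong refl) (simp add: mult_ac)
    also have "\<dots> = (\<Sum>m<N. \<Sum>l<N. \<Sum>i<D. \<Sum>j<D. u m * v l * (x m i * x l j * A i j) * (\<Sum>i<D. \<Sum>j<D. x m i * x l j * A i j) ^ q)"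
      by (rule sum4_swap_outer_inner)
    also have "\<dots> = ?P (Suc q) u v" unfolding sum_mult_pull2 power_Suc ..
    finally show ?thesis by simp
  qed
  have "\<bar>?P (Suc q) u v\<bar> \<le> (\<Sum>i<D. \<Sum>j<D. \<epsilon> * ((real D * \<epsilon>) ^ q * (?\<Phi> q (\<lambda>m. u m * x m i) + ?\<Phi> q (\<lambda>m. v m * x m j)) / 2))"
    unfolding P
  proof (intro order_trans[OF sum_abs] sum_mono)
    fix i j assume ij: "i \<in> {..<D}" "j \<in> {..<D}"
    show "\<bar>A i j * ?P q (\<lambda>m. u m * x m i) (\<lambda>l. v l * x l j)\<bar> \<le> \<epsilon> * ((real D * \<epsilon>) ^ q * (?\<Phi> q (\<lambda>m. u m * x m i) + ?\<Phi> q (\<lambda>m. v m * x m j)) / 2)"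
      unfolding abs_mult[of "A i j"] using ij \<epsilon> by (intro mult_mono A Suc) auto
  qed
  also have "\<dots> = \<epsilon> * (real D * \<epsilon>) ^ q / 2 * (real D * (\<Sum>i<D. ?\<Phi> q (\<lambda>m. u m * x m i)) + real D * (\<Sum>j<D. ?\<Phi> q (\<lambda>m. v m * x m j)))"
  proof -
    have "(\<Sum>i<D. \<Sum>j<D. \<epsilon> * (K * (f i + g j) / 2)) = \<epsilon> * K / 2 * (real D * (\<Sum>i<D. f i) + real D * (\<Sum>j<D. g j))" for K and f g :: "nat \<Rightarrow> real"
    proof -
      have "(\<Sum>i<D. \<Sum>j<D. \<epsilon> * (K * (f i + g j) / 2)) = (\<Sum>i<D. \<Sum>j<D. \<epsilon> * K / 2 * (f i + g j))" by (simp add: mult.assoc)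
      also have "\<dots> = \<epsilon> * K / 2 * (\<Sum>i<D. \<Sum>j<D. f i + g j)" by (simp only: sum_distrib_left)
      also have "(\<Sum>i<D. \<Sum>j<D. f i + g j) = real D * (\<Sum>i<D. f i) + real D * (\<Sum>j<D. g j)"
        by (simp add: sum.distrib sum_distrib_left)
      finally show ?thesis .
    qed
    thus ?thesis .
  qed
  also have "\<dots> = (real D * \<epsilon>) ^ Suc q * (?\<Phi> (Suc q) u + ?\<Phi> (Suc q) v) / 2"
    unfolding \<Phi> by (simp add: algebra_simps)
  finally show ?case .
qed

text \<open>The Schur product theorem for entrywise powers of a Gram matrix, by peeling off one
  coordinate at a time.\<close>

lemma power_gram_sum_nonneg:
  fixes x :: "nat \<Rightarrow> nat \<Rightarrow> real"
  shows "0 \<le> (\<Sum>m<N. \<Sum>l<N. u m * u l * (\<Sum>i<D. x m i * x l i) ^ q)"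
proof (induction q arbitrary: u)
  case 0
  have "(\<Sum>m<N. \<Sum>l<N. u m * u l) = (\<Sum>m<N. u m) * (\<Sum>m<N. u m)" for u :: "nat \<Rightarrow> real" by (simp add: sum_product)
  thus ?case by simp
next
  case (Suc q)
  have "(\<Sum>m<N. \<Sum>l<N. u m * u l * (\<Sum>i<D. x m i * x l i) ^ Suc q) =
     (\<Sum>m<N. \<Sum>l<N. \<Sum>i<D. (u m * x m i) * (u l * x l i) * (\<Sum>i<D. x m i * x l i) ^ q)"
    unfolding sum_mult_pull power_Suc ..
  also have "\<dots> = (\<Sum>i<D. \<Sum>m<N. \<Sum>l<N. (u m * x m i) * (u l * x l i) * (\<Sum>i<D. x m i * x l i) ^ q)"
    by (rule sym, subst sum.swap, rule sum.cong[OF refl], rule sum.swap)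
  also have "\<dots> \<ge> 0" by (intro sum_nonneg Suc)
  finally show ?case .
qed

lemma cosh_minus_1_sums:
  "(\<lambda>q. (if even q \<and> q \<noteq> 0 then 1 / fact q else 0) * x ^ q) sums (cosh x - 1)" for x :: real
proof -
  have "(\<lambda>q. (if even q then x ^ q /\<^sub>R fact q else 0) - (if q = 0 then 1 else 0)) sums (cosh x - 1)"
    by (intro sums_diff cosh_converges) (use sums_single[of 0 "\<lambda>_. 1::real"] in simp)
  moreover have "(\<lambda>q. (if even q then x ^ q /\<^sub>R fact q else 0) - (if q = 0 then 1 else 0))
     = (\<lambda>q. (if even q \<and> q \<noteq> 0 then 1 / fact q else 0) * x ^ q)"
    by (auto simp: fun_eq_iff field_simps)
  ultimately show ?thesis by simp
qed

text \<open>Termwise in the power series: the q-th term gains (D \<epsilon>)^q, and as q >= 2 and D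
  \<epsilon> <= 1 this is at most (D \<epsilon>)^2. Nonnegativity of the Gram terms permits
  summation.\<close>

lemma cosh_quadratic_form_bound:
  fixes x :: "nat \<Rightarrow> nat \<Rightarrow> real"
  assumes A: "\<And>i j. i < D \<Longrightarrow> j < D \<Longrightarrow> \<bar>A i j\<bar> \<le> \<epsilon>" and \<epsilon>: "0 \<le> \<epsilon>" and le1: "real D * \<epsilon> \<le> 1"
  shows "\<bar>\<Sum>m<N. \<Sum>l<N. u m * u l * (cosh (\<Sum>i<D. \<Sum>j<D. x m i * x l j * A i j) - 1)\<bar>
    \<le> (real D * \<epsilon>)\<^sup>2 * (\<Sum>m<N. \<Sum>l<N. u m * u l * (cosh (\<Sum>i<D. x m i * x l i) - 1))"
proof -
  define w :: "nat \<Rightarrow> real" where "w q = (if even q \<and> q \<noteq> 0 then 1 / fact q else 0)" for q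
  have w0: "0 \<le> w q" for q by (simp add: w_def)
  have s: "(\<lambda>q. w q * (\<Sum>m<N. \<Sum>l<N. u m * u l * f m l ^ q)) sums (\<Sum>m<N. \<Sum>l<N. u m * u l * (cosh (f m l) - 1))" for f :: "nat \<Rightarrow> nat \<Rightarrow> real"
  proof -
    have "(\<lambda>q. \<Sum>m<N. \<Sum>l<N. u m * u l * (w q * f m l ^ q)) sums (\<Sum>m<N. \<Sum>l<N. u m * u l * (cosh (f m l) - 1))"
      unfolding w_def by (intro sums_sum sums_mult cosh_minus_1_sums)
    thus ?thesis by (simp add: sum_distrib_left mult_ac)
  qed
  let ?a = "\<lambda>q. \<Sum>m<N. \<Sum>l<N. u m * u l * (\<Sum>i<D. \<Sum>j<D. x m i * x l j * A i j) ^ q"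
  let ?b = "\<lambda>q. \<Sum>m<N. \<Sum>l<N. u m * u l * (\<Sum>i<D. x m i * x l i) ^ q"
  have b0: "0 \<le> ?b q" for q by (rule power_gram_sum_nonneg)
  have le: "\<bar>w q * ?a q\<bar> \<le> (real D * \<epsilon>)\<^sup>2 * (w q * ?b q)" for q
  proof (cases "even q \<and> q \<noteq> 0")
    case True
    hence q2: "2 \<le> q" by presburger
    have "\<bar>?a q\<bar> \<le> (real D * \<epsilon>) ^ q * (?b q + ?b q) / 2" by (rule power_bilinear_sum_bound[OF A \<epsilon>])
    also have "\<dots> = (real D * \<epsilon>) ^ q * ?b q" by simp
    also have "\<dots> \<le> (real D * \<epsilon>)\<^sup>2 * ?b q"
      using q2 le1 \<epsilon> by (intro mult_right_mono power_decreasing b0) auto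
    finally have "w q * \<bar>?a q\<bar> \<le> w q * ((real D * \<epsilon>)\<^sup>2 * ?b q)" by (intro mult_left_mono w0)
    thus ?thesis using w0[of q] by (simp add: abs_mult mult_ac)
  next
    case False
    hence "w q = 0" by (auto simp: w_def)
    thus ?thesis by simp
  qed
  note sa = s[of "\<lambda>m l. \<Sum>i<D. \<Sum>j<D. x m i * x l j * A i j"]
  note sb = sums_mult[OF s[of "\<lambda>m l. \<Sum>i<D. x m i * x l i"], of "(real D * \<epsilon>)\<^sup>2"]
  have summ: "summable (\<lambda>q. \<bar>w q * ?a q\<bar>)"
    by (rule summable_comparison_test'[OF sums_summable[OF sb], of 0]) (use le in auto)
  have "\<bar>\<Sum>q. w q * ?a q\<bar> \<le> (\<Sum>q. \<bar>w q * ?a q\<bar>)" by (rule summable_rabs[OF summ])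
  also have "\<dots> \<le> (\<Sum>q. (real D * \<epsilon>)\<^sup>2 * (w q * ?b q))"
    by (rule suminf_le[OF le summ sums_summable[OF sb]])
  finally show ?thesis using sums_unique[OF sa] sums_unique[OF sb] by simp
qed

section \<open>Orthonormal coordinates for a possibly degenerate covariance form\<close>

context stationary_gaussian
begin

lemma bil_add_left: "bil k (\<lambda>a. x a + y a) z = bil k x z + bil k y z"
  by (simp add: bil_def sum.distrib algebra_simps)

lemma bil_scale_left: "bil k (\<lambda>a. c * x a) z = c * bil k x z"
  by (simp add: bil_def sum_distrib_left mult_ac)

lemma bil_sum_left: "bil k (\<lambda>a. \<Sum>i\<in>J. x i a) z = (\<Sum>i\<in>J. bil k (x i) z)"
proof (induction J rule: infinite_finite_induct)
  case (insert i J)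
  thus ?case using bil_add_left[of k "x i" "\<lambda>a. \<Sum>i\<in>J. x i a" z] by simp
qed (simp_all add: bil_def)

lemma bil_swap: "bil k x y = bil (- k) y x"
  using cov_lin[of x 0 y k] cov_lin[of y k x 0] by (simp add: cov_commute)

lemma bil_cong_left: "(\<And>a. a \<in> I \<Longrightarrow> x a = y a) \<Longrightarrow> bil k x z = bil k y z"
  by (simp add: bil_def)

text \<open>A vector of zero norm represents a variable that vanishes almost surely, and such a
  variable is uncorrelated with everything at every lag.\<close>

lemma bil_null:
  assumes "bil 0 x x = 0" shows "bil k x y = 0"
proof -
  have X: "lin x 0 \<in> H" "lin y k \<in> H" by (rule lin_H)+
  have "expectation (\<lambda>\<omega>. (lin x 0 \<omega>)\<^sup>2) = 0"
    using assms cov_lin[of x 0 x 0] by (simp add: cov_def power2_eq_square)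
  hence "AE \<omega> in M. (lin x 0 \<omega>)\<^sup>2 = 0"
    using H_square[OF X(1)] by (subst (asm) integral_nonneg_eq_0_iff_AE) auto
  hence "AE \<omega> in M. lin x 0 \<omega> * lin y k \<omega> = 0" by eventually_elim simp
  hence "expectation (\<lambda>\<omega>. lin x 0 \<omega> * lin y k \<omega>) = 0" by (rule integral_eq_zero_AE)
  thus ?thesis using cov_lin[of x 0 y k] by (simp add: cov_def)
qed

lemma bil_0_nonneg: "0 \<le> bil 0 x x"
  using cov_lin[of x 0 x 0] cov_self_nonneg[of "lin x 0"] by simp

text \<open>As \<open>bil 0\<close> is only semidefinite, the residual of a unit vector need not be
  the zero vector but only have zero norm. A residual of zero norm leaves the basis unchanged, any
  other one is normalised and added.\<close>

lemma gram_schmidt: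
  assumes "finite J"
  shows "\<exists>(D::nat) (e :: nat \<Rightarrow> 'i \<Rightarrow> real). (\<forall>i<D. \<forall>j<D. bil 0 (e i) (e j) = (if i = j then 1 else 0)) \<and>
     (\<forall>a\<in>J. \<exists>b. bil 0 (\<lambda>a'. (if a' = a then 1 else 0) - (\<Sum>i<D. b i * e i a')) (\<lambda>a'. (if a' = a then 1 else 0) - (\<Sum>i<D. b i * e i a')) = 0)"
  using assms
proof (induction J rule: finite_induct)
  case empty
  thus ?case by (intro exI[of _ 0]) auto
next
  case (insert a J)
  let ?u = "\<lambda>a a'. if a' = a then 1 else (0::real)"
  from insert.IH obtain D :: nat and e where on': "\<forall>i<D. \<forall>j<D. bil 0 (e i) (e j) = (if i = j then 1 else 0)"
    and J: "\<forall>a\<in>J. \<exists>b. bil 0 (\<lambda>a'. ?u a a' - (\<Sum>i<D. b i * e i a')) (\<lambda>a'. ?u a a' - (\<Sum>i<D. b i * e i a')) = 0"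
    by (elim exE conjE) (erule (1) that)
  have on: "bil 0 (e i) (e j) = (if i = j then 1 else 0)" if "i < D" "j < D" for i j using on' that by blast
  define b where "b i = bil 0 (?u a) (e i)" for i
  define r where "r a' = ?u a a' - (\<Sum>i<D. b i * e i a')" for a'
  have orth: "bil 0 r (e j) = 0" if "j < D" for j
  proof -
    have "bil 0 r (e j) = bil 0 (\<lambda>a'. ?u a a' + (\<Sum>i<D. - b i * e i a')) (e j)"
      by (rule bil_cong_left) (simp add: r_def sum_negf)
    also have "\<dots> = b j + (\<Sum>i<D. - b i * bil 0 (e i) (e j))"
      unfolding bil_add_left bil_sum_left bil_scale_left b_def by simp
    also have "(\<Sum>i<D. - b i * bil 0 (e i) (e j)) = (\<Sum>i<D. if i = j then - b j else 0)"
      by (intro sum.cong refl) (use on that in auto)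
    also have "\<dots> = - b j" using that by simp
    finally show ?thesis by simp
  qed
  show ?case
  proof (cases "bil 0 r r = 0")
    case True
    show ?thesis
    proof (intro exI[of _ D] exI[of _ e] conjI allI impI ballI)
      fix a1 assume "a1 \<in> insert a J"
      show "\<exists>b. bil 0 (\<lambda>a'. ?u a1 a' - (\<Sum>i<D. b i * e i a')) (\<lambda>a'. ?u a1 a' - (\<Sum>i<D. b i * e i a')) = 0"
      proof (cases "a1 = a")
        case True
        show ?thesis using \<open>bil 0 r r = 0\<close> unfolding r_def[abs_def] True by blast
      next
        case False
        hence "a1 \<in> J" using \<open>a1 \<in> insert a J\<close> by simp
        thus ?thesis by (rule bspec[OF J])
      qed
    qed (use on in auto)
  next
    case False
    define v where "v = bil 0 r r"
    have v: "0 < v" using False bil_0_nonneg[of r] by (simp add: v_def)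
    define e' where "e' i = (if i < D then e i else (\<lambda>a'. (1 / sqrt v) * r a'))" for i
    have nn: "bil 0 (\<lambda>a'. (1 / sqrt v) * r a') (\<lambda>a'. (1 / sqrt v) * r a') = 1"
      unfolding bil_scale_left bil_swap[of 0 r] using v by (simp add: bil_scale_left v_def[symmetric])
    have rn: "bil 0 (e i) (\<lambda>a'. (1 / sqrt v) * r a') = 0" "bil 0 (\<lambda>a'. (1 / sqrt v) * r a') (e i) = 0" if "i < D" for i
      using orth[OF that] bil_swap[of 0 "e i" "\<lambda>a'. (1 / sqrt v) * r a'"] by (simp_all add: bil_scale_left del: times_divide_eq_left)
    have b0: "bil 0 y y = 0" if "\<And>a'. y a' = 0" for y using that by (simp add: bil_def)
    show ?thesis
    proof (intro exI[of _ "Suc D"] exI[of _ e'] conjI allI impI ballI)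
      fix i j assume "i < Suc D" "j < Suc D"
      thus "bil 0 (e' i) (e' j) = (if i = j then 1 else 0)"
        using on nn rn by (auto simp: e'_def less_Suc_eq simp del: times_divide_eq_left)
    next
      fix a1 assume a1: "a1 \<in> insert a J"
      show "\<exists>b. bil 0 (\<lambda>a'. ?u a1 a' - (\<Sum>i<Suc D. b i * e' i a')) (\<lambda>a'. ?u a1 a' - (\<Sum>i<Suc D. b i * e' i a')) = 0"
      proof (cases "a1 = a")
        case True
        \<comment> \<open>The new basis vector is \<open>r\<close> divided by \<open>sqrt v\<close>,
          so the coordinate of the new unit vector along it is \<open>sqrt v\<close>.\<close>
        have "?u a a' - (\<Sum>i<Suc D. (b(D := sqrt v)) i * e' i a') = 0" for a'
          using v by (simp add: e'_def r_def)
        thus ?thesis unfolding True by (intro exI[of _ "b(D := sqrt v)"] b0)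
      next
        case False
        then obtain b1 where "bil 0 (\<lambda>a'. ?u a1 a' - (\<Sum>i<D. b1 i * e i a')) (\<lambda>a'. ?u a1 a' - (\<Sum>i<D. b1 i * e i a')) = 0"
          using bspec[OF J, of a1] a1 by auto
        moreover have "(\<Sum>i<Suc D. (b1(D := 0)) i * e' i a') = (\<Sum>i<D. b1 i * e i a')" for a'
          by (simp add: e'_def)
        ultimately show ?thesis by (intro exI[of _ "b1(D := 0)"]) (simp only:)
      qed
    qed
  qed
qed

text \<open>Coordinates adapted to lag 0 serve all lags, since residuals of zero norm drop out at
  every lag by \<open>bil_null\<close>. \<open>A k\<close> is the matrix of correlations at lag
  \<open>k\<close> in the orthonormal basis.\<close>

lemma orthonormal_coordinates:
  obtains D :: nat and K :: real and \<xi> :: "('i \<Rightarrow> real) \<Rightarrow> nat \<Rightarrow> real" and A :: "int \<Rightarrow> nat \<Rightarrow> nat \<Rightarrow> real"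
  where "\<And>x y. bil 0 x y = (\<Sum>i<D. \<xi> x i * \<xi> y i)"
    and "\<And>k x y. bil k x y = (\<Sum>i<D. \<Sum>j<D. \<xi> x i * \<xi> y j * A k i j)"
    and "\<And>k i j. i < D \<Longrightarrow> j < D \<Longrightarrow> \<bar>A k i j\<bar> \<le> K * \<rho> k" and "0 \<le> K"
proof -
  let ?u = "\<lambda>a a'. if a' = a then 1 else (0::real)"
  from gram_schmidt[OF finite_I] obtain D :: nat and e where on': "\<forall>i<D. \<forall>j<D. bil 0 (e i) (e j) = (if i = j then 1 else 0)"
    and J: "\<forall>a\<in>I. \<exists>b. bil 0 (\<lambda>a'. ?u a a' - (\<Sum>i<D. b i * e i a')) (\<lambda>a'. ?u a a' - (\<Sum>i<D. b i * e i a')) = 0"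
    by (elim exE conjE) (erule (1) that)
  have on: "bil 0 (e i) (e j) = (if i = j then 1 else 0)" if "i < D" "j < D" for i j using on' that by blast
  from bchoice[OF J] obtain B where B: "\<And>a. a \<in> I \<Longrightarrow> bil 0 (\<lambda>a'. ?u a a' - (\<Sum>i<D. B a i * e i a')) (\<lambda>a'. ?u a a' - (\<Sum>i<D. B a i * e i a')) = 0"
    by blast
  define \<xi> where "\<xi> x i = (\<Sum>a\<in>I. x a * B a i)" for x :: "'i \<Rightarrow> real" and i
  have left: "bil k x y = (\<Sum>i<D. \<xi> x i * bil k (e i) y)" for k x y
  proof -
    \<comment> \<open>Each unit vector is written as residual plus projection, so that linearity
      isolates the residuals.\<close>
    have "bil k x y = bil k (\<lambda>a'. \<Sum>a\<in>I. x a * ((?u a a' - (\<Sum>i<D. B a i * e i a')) + (\<Sum>i<D. B a i * e i a'))) y"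
    proof (rule bil_cong_left)
      fix a' assume "a' \<in> I"
      thus "x a' = (\<Sum>a\<in>I. x a * ((?u a a' - (\<Sum>i<D. B a i * e i a')) + (\<Sum>i<D. B a i * e i a')))"
        using finite_I by (simp add: if_distrib[of "(*) _"] cong: if_cong)
    qed
    also have "\<dots> = (\<Sum>a\<in>I. x a * (bil k (\<lambda>a'. ?u a a' - (\<Sum>i<D. B a i * e i a')) y + (\<Sum>i<D. B a i * bil k (e i) y)))"
      by (simp only: bil_sum_left bil_scale_left bil_add_left)
    also have "\<dots> = (\<Sum>a\<in>I. x a * (\<Sum>i<D. B a i * bil k (e i) y))"
      by (intro sum.cong refl) (simp add: bil_null[OF B])
    also have "\<dots> = (\<Sum>i<D. \<xi> x i * bil k (e i) y)"
      unfolding \<xi>_def sum_distrib_left sum_distrib_right by (subst sum.swap) (simp add: mult.assoc)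
    finally show ?thesis .
  qed
  have right: "bil k x y = (\<Sum>j<D. \<xi> y j * bil k x (e j))" for k x y
    unfolding bil_swap[of k x] by (rule left)
  have both: "bil k x y = (\<Sum>i<D. \<Sum>j<D. \<xi> x i * \<xi> y j * bil k (e i) (e j))" for k x y
  proof -
    have "bil k x y = (\<Sum>i<D. \<xi> x i * (\<Sum>j<D. \<xi> y j * bil k (e i) (e j)))"
      by (subst left, intro sum.cong refl, subst right) simp
    thus ?thesis by (simp add: sum_distrib_left mult.assoc)
  qed
  define q where "q = (\<Sum>i<D. \<Sum>a\<in>I. \<bar>e i a\<bar>)"
  show ?thesis
  proof (rule that[of \<xi> D "\<lambda>k i j. bil k (e i) (e j)" "q * q"])
    show "bil 0 x y = (\<Sum>i<D. \<xi> x i * \<xi> y i)" for x y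
    proof -
      have "bil 0 x y = (\<Sum>i<D. \<Sum>j<D. if j = i then \<xi> x i * \<xi> y i else 0)"
        by (subst both, intro sum.cong refl) (use on in auto)
      thus ?thesis by simp
    qed
    show "bil k x y = (\<Sum>i<D. \<Sum>j<D. \<xi> x i * \<xi> y j * bil k (e i) (e j))" for k x y by (rule both)
    show "\<bar>bil k (e i) (e j)\<bar> \<le> q * q * \<rho> k" if "i < D" "j < D" for k i j
    proof -
      have "\<bar>bil k (e i) (e j)\<bar> \<le> (\<Sum>a\<in>I. \<bar>e i a\<bar>) * (\<Sum>a\<in>I. \<bar>e j a\<bar>) * \<rho> k" by (rule bil_le)
      also have "\<dots> \<le> q * q * \<rho> k"
        using that unfolding q_def
        by (intro mult_right_mono mult_mono \<rho>_nonneg member_le_sum) (auto intro!: sum_nonneg)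
      finally show ?thesis .
    qed
    show "0 \<le> q * q" by simp
  qed
qed

definition tpoly :: "nat \<Rightarrow> (nat \<Rightarrow> real) \<Rightarrow> (nat \<Rightarrow> 'i \<Rightarrow> real) \<Rightarrow> int \<Rightarrow> 'a \<Rightarrow> real" where
  "tpoly N c x k \<omega> = (\<Sum>m<N. c m * (cos (lin (x m) k \<omega>) - exp (- bil 0 (x m) (x m) / 2)))"

text \<open>The lag-k covariance of \<open>tpoly\<close>, as \<open>expectation_tpoly_mult\<close>
  shows; the weights \<open>c m * exp ...\<close> are independent of the lag.\<close>

definition tcov :: "nat \<Rightarrow> (nat \<Rightarrow> real) \<Rightarrow> (nat \<Rightarrow> 'i \<Rightarrow> real) \<Rightarrow> int \<Rightarrow> real" where
  "tcov N c x k = (\<Sum>m<N. \<Sum>l<N. (c m * exp (- bil 0 (x m) (x m) / 2)) * (c l * exp (- bil 0 (x l) (x l) / 2)) * (cosh (bil k (x m) (x l)) - 1))"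

lemma tpoly_measurable[measurable]: "tpoly N c x k \<in> borel_measurable M"
  unfolding tpoly_def[abs_def] using H_measurable[OF lin_H] by measurable

lemma tpoly_bound: "\<bar>tpoly N c x k \<omega>\<bar> \<le> 2 * (\<Sum>m<N. \<bar>c m\<bar>)"
proof -
  have "tpoly N c x k \<omega> = trig {..<N} c (\<lambda>m. lin (x m) k) \<omega>"
    unfolding tpoly_def trig_def cov_lin by simp
  thus ?thesis using trig_bound by metis
qed

lemma tpoly_integrable_mult: "integrable M (\<lambda>\<omega>. tpoly N c x k \<omega> * tpoly N' c' x' l \<omega>)"
proof (rule integrable_const_bound[of _ "(2 * (\<Sum>m<N. \<bar>c m\<bar>)) * (2 * (\<Sum>m<N'. \<bar>c' m\<bar>))"])
  show "AE \<omega> in M. norm (tpoly N c x k \<omega> * tpoly N' c' x' l \<omega>) \<le> (2 * (\<Sum>m<N. \<bar>c m\<bar>)) * (2 * (\<Sum>m<N'. \<bar>c' m\<bar>))"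
    unfolding real_norm_def abs_mult by (intro AE_I2 mult_mono tpoly_bound) (auto intro!: sum_nonneg)
qed measurable

text \<open>For Gaussian P and Q the means of cos(P + Q) and cos(P - Q) average to the product of
  the single means times cosh of the covariance; centring subtracts 1 from the cosh.\<close>

lemma expectation_tpoly_mult: "expectation (\<lambda>\<omega>. tpoly N c x k \<omega> * tpoly N c x l \<omega>) = tcov N c x (l - k)"
proof -
  let ?e = "\<lambda>m. exp (- bil 0 (x m) (x m) / 2)"
  let ?X = "\<lambda>m k \<omega>. cos (lin (x m) k \<omega>) - ?e m"
  have cb: "\<bar>?X m k \<omega>\<bar> \<le> 2" for m k \<omega>
    using cos_minus_exp_bound[of "lin (x m) k \<omega>" "lin (x m) k"] by (simp add: cov_lin)
  have i: "integrable M (\<lambda>\<omega>. ?X m k \<omega> * ?X m' l \<omega>)" for m m'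
  proof (rule integrable_const_bound[of _ "2 * 2"])
    show "AE \<omega> in M. norm (?X m k \<omega> * ?X m' l \<omega>) \<le> 2 * 2"
      unfolding real_norm_def abs_mult by (intro AE_I2 mult_mono cb) auto
  qed (use H_measurable[OF lin_H] in measurable)
  have E: "expectation (\<lambda>\<omega>. ?X m k \<omega> * ?X m' l \<omega>) = ?e m * ?e m' * (cosh (bil (l - k) (x m) (x m')) - 1)" for m m'
  proof -
    let ?P = "lin (x m) k" and ?Q = "lin (x m') l"
    have PQ: "?P \<in> H" "?Q \<in> H" by (rule lin_H)+
    note int = H_integrable_cos[OF H_add[OF PQ]] H_integrable_cos[OF H_diff[OF PQ]] H_integrable_cos[OF PQ(1)] H_integrable_cos[OF PQ(2)]
    have vP: "cov ?P ?P = bil 0 (x m) (x m)" and vQ: "cov ?Q ?Q = bil 0 (x m') (x m')" and c: "cov ?P ?Q = bil (l - k) (x m) (x m')" "cov ?Q ?P = bil (l - k) (x m) (x m')"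
      using cov_commute[of ?Q ?P] by (simp_all add: cov_lin)
    have "expectation (\<lambda>\<omega>. ?X m k \<omega> * ?X m' l \<omega>) = expectation (\<lambda>\<omega>. (cos (?P \<omega> + ?Q \<omega>) + cos (?P \<omega> - ?Q \<omega>)) / 2 - ?e m' * cos (?P \<omega>) - ?e m * cos (?Q \<omega>) + ?e m * ?e m')"
      by (intro Bochner_Integration.integral_cong refl) (simp add: cos_add cos_diff algebra_simps)
    also have "\<dots> = (expectation (\<lambda>\<omega>. cos (?P \<omega> + ?Q \<omega>)) + expectation (\<lambda>\<omega>. cos (?P \<omega> - ?Q \<omega>))) / 2 - ?e m' * expectation (\<lambda>\<omega>. cos (?P \<omega>)) - ?e m * expectation (\<lambda>\<omega>. cos (?Q \<omega>)) + ?e m * ?e m'"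
      using int by (simp add: prob_space)
    also have "\<dots> = (exp (- cov (\<lambda>\<omega>. ?P \<omega> + ?Q \<omega>) (\<lambda>\<omega>. ?P \<omega> + ?Q \<omega>) / 2) + exp (- cov (\<lambda>\<omega>. ?P \<omega> - ?Q \<omega>) (\<lambda>\<omega>. ?P \<omega> - ?Q \<omega>) / 2)) / 2 - ?e m * ?e m'"
      unfolding expectation_cos[OF H_add[OF PQ]] expectation_cos[OF H_diff[OF PQ]] expectation_cos[OF PQ(1)] expectation_cos[OF PQ(2)] vP vQ by simp
    also have "- cov (\<lambda>\<omega>. ?P \<omega> + ?Q \<omega>) (\<lambda>\<omega>. ?P \<omega> + ?Q \<omega>) / 2 = - bil 0 (x m) (x m) / 2 + - bil 0 (x m') (x m') / 2 + - bil (l - k) (x m) (x m')"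
      using PQ by (simp add: cov_simps H_add vP vQ c field_simps)
    also have "- cov (\<lambda>\<omega>. ?P \<omega> - ?Q \<omega>) (\<lambda>\<omega>. ?P \<omega> - ?Q \<omega>) / 2 = - bil 0 (x m) (x m) / 2 + - bil 0 (x m') (x m') / 2 + bil (l - k) (x m) (x m')"
      using PQ by (simp add: cov_simps H_diff vP vQ c field_simps)
    finally show ?thesis unfolding exp_add cosh_def by (simp add: algebra_simps add_divide_distrib)
  qed
  have "expectation (\<lambda>\<omega>. tpoly N c x k \<omega> * tpoly N c x l \<omega>) = expectation (\<lambda>\<omega>. \<Sum>m<N. \<Sum>m'<N. c m * c m' * (?X m k \<omega> * ?X m' l \<omega>))"
    unfolding tpoly_def sum_product by (intro Bochner_Integration.integral_cong sum.cong refl) (simp add: mult_ac)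
  also have "\<dots> = (\<Sum>m<N. \<Sum>m'<N. c m * c m' * expectation (\<lambda>\<omega>. ?X m k \<omega> * ?X m' l \<omega>))"
    using i by (subst Bochner_Integration.integral_sum, force, intro sum.cong refl, subst Bochner_Integration.integral_sum) auto
  also have "\<dots> = tcov N c x (l - k)" unfolding E tcov_def by (intro sum.cong refl) (simp only: mult_ac)
  finally show ?thesis .
qed

lemma tcov_0_nonneg: "0 \<le> tcov N c x 0"
proof -
  have "0 \<le> expectation (\<lambda>\<omega>. tpoly N c x 0 \<omega> * tpoly N c x 0 \<omega>)" by (rule integral_nonneg_AE) simp
  thus ?thesis unfolding expectation_tpoly_mult by simp
qed

lemma tcov_le_tcov_0: "\<bar>tcov N c x k\<bar> \<le> tcov N c x 0"
proof -
  have "\<bar>expectation (\<lambda>\<omega>. tpoly N c x 0 \<omega> * tpoly N c x k \<omega>)\<bar> \<le>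
     expectation (\<lambda>\<omega>. (tpoly N c x 0 \<omega> * tpoly N c x 0 \<omega> + tpoly N c x k \<omega> * tpoly N c x k \<omega>) / 2)"
    unfolding real_norm_def[symmetric]
  proof (rule norm_integral_le)
    show "norm (tpoly N c x 0 \<omega> * tpoly N c x k \<omega>) \<le> (tpoly N c x 0 \<omega> * tpoly N c x 0 \<omega> + tpoly N c x k \<omega> * tpoly N c x k \<omega>) / 2" for \<omega>
      using sum_squares_bound[of "\<bar>tpoly N c x 0 \<omega>\<bar>" "\<bar>tpoly N c x k \<omega>\<bar>"] by (simp add: abs_mult power2_eq_square)
  qed (use tpoly_integrable_mult in auto)
  also have "\<dots> = (tcov N c x 0 + tcov N c x 0) / 2"
    using tpoly_integrable_mult by (simp add: expectation_tpoly_mult)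
  finally show ?thesis unfolding expectation_tpoly_mult by simp
qed

text \<open>\<open>K\<close> is obtained before the polynomial, and this uniformity is what makes
  approximation possible. If \<rho> is too large at a lag for the series comparison, the claimed
  factor is at least 1 and the bound by the variance suffices.\<close>

lemma tcov_decay:
  obtains K where "0 \<le> K" "\<And>N c x k. \<bar>tcov N c x k\<bar> \<le> K * (\<rho> k)\<^sup>2 * tcov N c x 0"
proof -
  obtain D :: nat and K \<xi> A where b0: "\<And>x y. bil 0 x y = (\<Sum>i<D. \<xi> x i * \<xi> y i)"
    and bk: "\<And>k x y. bil k x y = (\<Sum>i<D. \<Sum>j<D. \<xi> x i * \<xi> y j * A k i j)"
    and A: "\<And>k i j. i < D \<Longrightarrow> j < D \<Longrightarrow> \<bar>A k i j\<bar> \<le> K * \<rho> k" and K: "0 \<le> K"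
    by (rule orthonormal_coordinates) blast
  have "\<bar>tcov N c x k\<bar> \<le> (real D * K)\<^sup>2 * (\<rho> k)\<^sup>2 * tcov N c x 0" for N c x k
  proof (cases "real D * (K * \<rho> k) \<le> 1")
    case True
    have "0 \<le> K * \<rho> k" using K \<rho>_nonneg by simp
    from cosh_quadratic_form_bound[where A="A k" and D=D and \<epsilon>="K * \<rho> k" and N=N and x="\<lambda>m. \<xi> (x m)" and u="\<lambda>m. c m * exp (- bil 0 (x m) (x m) / 2)", OF A this True]
    show ?thesis unfolding tcov_def bk[of k, symmetric] b0[symmetric] by (simp add: power_mult_distrib mult_ac)
  next
    case False
    hence "1 * tcov N c x 0 \<le> (real D * (K * \<rho> k))\<^sup>2 * tcov N c x 0"
      by (intro mult_right_mono tcov_0_nonneg) (simp add: one_le_power)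
    thus ?thesis using tcov_le_tcov_0[of N c x k] by (simp add: power_mult_distrib mult_ac)
  qed
  moreover have "0 \<le> (real D * K)\<^sup>2" by simp
  ultimately show ?thesis by (rule that[rotated])
qed

end

section \<open>Approximation by trigonometric polynomials\<close>

lemma norm_cis_diff_le: "cmod (cis a - cis b) \<le> \<bar>a - b\<bar>"
proof -
  have "cis a - cis b = cis b * (cis (a - b) - 1)" by (simp add: algebra_simps cis_mult)
  hence "cmod (cis a - cis b) = cmod (cis (a - b) - 1)" by (simp add: norm_mult)
  also have "\<dots> \<le> \<bar>a - b\<bar>"
    using iexp_approx1[of "a - b" 0] by (simp add: cis_conv_exp)
  finally show ?thesis .
qed

lemma exp_minus_lipschitz:
  fixes a b :: real
  assumes "0 \<le> a" "0 \<le> b" shows "\<bar>exp (- a) - exp (- b)\<bar> \<le> \<bar>a - b\<bar>"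
proof -
  have *: "exp (- a) - exp (- b) \<le> b - a" "exp (- b) \<le> exp (- a)" if "0 \<le> a" "a \<le> b" for a b :: real
  proof -
    have e1: "1 + (a - b) \<le> exp (a - b)" by (rule exp_ge_add_one_self)
    have "exp (- a) - exp (- b) = exp (- a) * (1 - exp (a - b))" by (simp add: algebra_simps flip: exp_add)
    also have "\<dots> \<le> 1 * (b - a)"
    proof (intro mult_mono)
      show "1 - exp (a - b) \<le> b - a" using e1 by linarith
    qed (use that in auto)
    finally show "exp (- a) - exp (- b) \<le> b - a" by simp
    show "exp (- b) \<le> exp (- a)" using that by simp
  qed
  show ?thesis using *[of a b] *[of b a] assms by (cases "a \<le> b") auto
qed

lemma tendsto_arithmetic_means:
  fixes s :: "nat \<Rightarrow> real"
  assumes "s \<longlonglongrightarrow> L"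
  shows "(\<lambda>n. (\<Sum>i<n. s i) / real n) \<longlonglongrightarrow> L"
proof (rule LIMSEQ_I)
  fix r :: real assume r: "0 < r"
  obtain n0 where n0: "\<And>n. n \<ge> n0 \<Longrightarrow> \<bar>s n - L\<bar> < r / 2"
    using LIMSEQ_D[OF assms, of "r / 2"] r by (auto simp: real_norm_def)
  define K where "K = (\<Sum>i<n0. \<bar>s i - L\<bar>)"
  obtain n1 :: nat where n1: "2 * K / r < real n1" using reals_Archimedean2 by blast
  show "\<exists>no. \<forall>n\<ge>no. norm ((\<Sum>i<n. s i) / real n - L) < r"
  proof (intro exI allI impI)
    fix n assume n: "Suc (max n0 n1) \<le> n"
    hence np: "0 < real n" by simp
    have "(\<Sum>i<n. s i) / real n - L = (\<Sum>i<n. s i - L) / real n"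
      using np by (simp add: sum_subtractf field_simps)
    hence "norm ((\<Sum>i<n. s i) / real n - L) \<le> (\<Sum>i<n. \<bar>s i - L\<bar>) / real n"
      using np by (simp add: divide_right_mono)
    also have "(\<Sum>i<n. \<bar>s i - L\<bar>) = K + (\<Sum>i\<in>{n0..<n}. \<bar>s i - L\<bar>)"
      unfolding K_def using n sum.atLeastLessThan_concat[of 0 n0 n "\<lambda>i. \<bar>s i - L\<bar>"] by (simp add: lessThan_atLeast0)
    also have "(\<Sum>i\<in>{n0..<n}. \<bar>s i - L\<bar>) \<le> (\<Sum>i\<in>{n0..<n}. r / 2)"
      using n0 by (intro sum_mono) (auto intro: less_imp_le)
    also have "\<dots> \<le> real n * (r / 2)" using r by (simp add: mult_right_mono)
    also have "K < real n * (r / 2)"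
    proof -
      have "2 * K / r < real n" using n1 n by simp
      thus ?thesis using r by (simp add: field_simps)
    qed
    finally show "norm ((\<Sum>i<n. s i) / real n - L) < r" using np by (simp add: field_simps)
  qed
qed

text \<open>Enlarging the square by one row and one column adds the lags from -n to n once each. The
  variance of a normalised sum is thereby an arithmetic mean of symmetric partial sums, to which
  \<open>tendsto_arithmetic_means\<close> applies.\<close>

lemma sum_diff_square_eq_sum_symmetric:
  fixes \<Phi> :: "int \<Rightarrow> real"
  shows "(\<Sum>k\<in>{1..int n}. \<Sum>l\<in>{1..int n}. \<Phi> (l - k)) = (\<Sum>N<n. \<Sum>d\<in>{- int N..int N}. \<Phi> d)"
proof (induction n)
  case (Suc n)
  have s: "{1..int (Suc n)} = insert (1 + int n) {1..int n}" by auto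
  have a: "(\<Sum>l\<in>{1..int n}. \<Phi> (l - (1 + int n))) = (\<Sum>d\<in>{- int n..-1}. \<Phi> d)"
    by (rule sum.reindex_bij_witness[of _ "\<lambda>d. d + (1 + int n)" "\<lambda>l. l - (1 + int n)"]) auto
  have b: "(\<Sum>k\<in>{1..int n}. \<Phi> (1 + int n - k)) = (\<Sum>d\<in>{1..int n}. \<Phi> d)"
    by (rule sum.reindex_bij_witness[of _ "\<lambda>d. 1 + int n - d" "\<lambda>k. 1 + int n - k"]) auto
  have "{- int n..int n} = {- int n..-1} \<union> (insert 0 {1..int n})" by auto
  hence c: "(\<Sum>d\<in>{- int n..int n}. \<Phi> d) = (\<Sum>d\<in>{- int n..-1}. \<Phi> d) + (\<Phi> 0 + (\<Sum>d\<in>{1..int n}. \<Phi> d))"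
    by (simp only:) (subst sum.union_disjoint, auto)
  have "(\<Sum>k\<in>{1..int (Suc n)}. \<Sum>l\<in>{1..int (Suc n)}. \<Phi> (l - k)) =
     (\<Phi> 0 + (\<Sum>l\<in>{1..int n}. \<Phi> (l - (1 + int n)))) + (\<Sum>k\<in>{1..int n}. \<Phi> (1 + int n - k) + (\<Sum>l\<in>{1..int n}. \<Phi> (l - k)))"
    unfolding s by simp
  also have "\<dots> = (\<Sum>k\<in>{1..int n}. \<Sum>l\<in>{1..int n}. \<Phi> (l - k)) + (\<Sum>d\<in>{- int n..int n}. \<Phi> d)"
    unfolding sum.distrib a b c by simp
  finally show ?case using Suc.IH by simp
qed simp

context square_summable
begin

lemma symmetric_sum_convergent:
  fixes \<Phi> :: "int \<Rightarrow> real"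
  assumes "\<And>k. \<bar>\<Phi> k\<bar> \<le> K * (\<rho> k)\<^sup>2"
  shows "convergent (\<lambda>N. \<Sum>d\<in>{- int N..int N}. \<Phi> d)"
proof -
  \<comment> \<open>Opposite lags are paired, so that up to lag 0 the symmetric sums are partial
    sums of a single absolutely convergent series.\<close>
  let ?a = "\<lambda>n. \<Phi> (int (Suc n)) + \<Phi> (- int (Suc n))"
  have eq: "(\<Sum>d\<in>{- int N..int N}. \<Phi> d) = \<Phi> 0 + (\<Sum>n<N. ?a n)" for N
  proof (induction N)
    case (Suc N)
    have "{- int (Suc N)..int (Suc N)} = insert (int (Suc N)) (insert (- int (Suc N)) {- int N..int N})" by auto
    hence "(\<Sum>d\<in>{- int (Suc N)..int (Suc N)}. \<Phi> d) = \<Phi> (int (Suc N)) + (\<Phi> (- int (Suc N)) + (\<Sum>d\<in>{- int N..int N}. \<Phi> d))"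
      by (simp only:) (subst sum.insert, auto)+
    thus ?case using Suc by simp
  qed simp
  have "summable (\<lambda>n. 2 * K * (\<rho> (int (Suc n)))\<^sup>2)"
    using \<rho>_square by (intro summable_mult) (subst summable_Suc_iff)
  hence "summable ?a"
  proof (rule summable_comparison_test'[of _ 0])
    fix n
    show "norm (?a n) \<le> 2 * K * (\<rho> (int (Suc n)))\<^sup>2"
      using assms[of "int (Suc n)"] assms[of "- int (Suc n)"] \<rho>_sym[of "int (Suc n)"] by simp
  qed
  hence "(\<lambda>N. \<Sum>n<N. ?a n) \<longlonglongrightarrow> (\<Sum>n. ?a n)" by (rule summable_LIMSEQ)
  hence "(\<lambda>N. \<Phi> 0 + (\<Sum>n<N. ?a n)) \<longlonglongrightarrow> \<Phi> 0 + (\<Sum>n. ?a n)" by (intro tendsto_intros)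
  thus ?thesis unfolding eq convergent_def by blast
qed

lemma double_sum_le:
  fixes \<Phi> :: "int \<Rightarrow> real"
  assumes "\<And>k. \<bar>\<Phi> k\<bar> \<le> K * (\<rho> k)\<^sup>2" and K: "0 \<le> K"
  shows "(\<Sum>k\<in>{1..int n}. \<Sum>l\<in>{1..int n}. \<Phi> (l - k)) \<le> real n * (K * mass)"
proof -
  have "(\<Sum>k\<in>{1..int n}. \<Sum>l\<in>{1..int n}. \<Phi> (l - k)) \<le> (\<Sum>k\<in>{1..int n}. K * (\<Sum>l\<in>{1..int n}. (\<rho> (k - l))\<^sup>2))"
    unfolding sum_distrib_left
  proof (intro sum_mono)
    fix k l show "\<Phi> (l - k) \<le> K * (\<rho> (k - l))\<^sup>2" using assms(1)[of "l - k"] \<rho>_swap[of k l] by auto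
  qed
  also have "\<dots> \<le> (\<Sum>k\<in>{1..int n}. K * mass)"
    using K by (intro sum_mono mult_left_mono sum_\<rho>_square_diff) auto
  finally show ?thesis by simp
qed

end

context stationary_gaussian
begin

lemma tpoly_diff:
  "\<exists>N3 c3 x3. \<forall>k \<omega>. tpoly N1 c1 x1 k \<omega> - tpoly N2 c2 x2 k \<omega> = tpoly N3 c3 x3 k \<omega>"
proof -
  \<comment> \<open>The two families are listed one after the other, the second with negated
    coefficients.\<close>
  define c3 where "c3 m = (if m < N1 then c1 m else - c2 (m - N1))" for m
  define x3 where "x3 m = (if m < N1 then x1 m else x2 (m - N1))" for m
  have "(\<Sum>m<N1 + N2. c3 m * (cos (lin (x3 m) k \<omega>) - exp (- bil 0 (x3 m) (x3 m) / 2))) =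
     (\<Sum>m<N1. c1 m * (cos (lin (x1 m) k \<omega>) - exp (- bil 0 (x1 m) (x1 m) / 2)))
     - (\<Sum>m<N2. c2 m * (cos (lin (x2 m) k \<omega>) - exp (- bil 0 (x2 m) (x2 m) / 2)))" for k \<omega>
  proof (induction N2)
    case 0
    show ?case by (simp add: c3_def x3_def)
  next
    case (Suc N2)
    thus ?case by (simp add: c3_def x3_def algebra_simps)
  qed
  thus ?thesis unfolding tpoly_def by metis
qed

text \<open>One sequence of polynomials serves all times simultaneously, which carries stationarity
  of covariances over to the limit; the uniform bound \<open>B\<close> is for dominated
  convergence.\<close>

definition trig_limit :: "(int \<Rightarrow> 'a \<Rightarrow> real) \<Rightarrow> bool" where
  "trig_limit F \<longleftrightarrow> (\<forall>k. F k \<in> borel_measurable M) \<and> (\<exists>N c x B. (\<forall>j k \<omega>. \<bar>tpoly (N j) (c j) (x j) k \<omega>\<bar> \<le> B) \<and>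
     (\<forall>k. AE \<omega> in M. (\<lambda>j. tpoly (N j) (c j) (x j) k \<omega>) \<longlonglongrightarrow> F k \<omega>))"

lemma bounded_integrable_mult:
  fixes f g :: "'a \<Rightarrow> real"
  assumes "f \<in> borel_measurable M" "g \<in> borel_measurable M" "AE \<omega> in M. \<bar>f \<omega>\<bar> \<le> B" "AE \<omega> in M. \<bar>g \<omega>\<bar> \<le> B"
  shows "integrable M (\<lambda>\<omega>. f \<omega> * g \<omega>)"
proof (rule integrable_const_bound[of _ "B * B"])
  show "AE \<omega> in M. norm (f \<omega> * g \<omega>) \<le> B * B"
    using assms(3,4) unfolding real_norm_def abs_mult
    by eventually_elim (auto intro!: mult_mono)
qed (use assms in measurable)

lemma expectation_mult_limit:
  assumes [measurable]: "\<And>k. F k \<in> borel_measurable M"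
    and B: "\<And>j k \<omega>. \<bar>tpoly (N j) (c j) (x j) k \<omega>\<bar> \<le> B"
    and lim: "\<And>k. AE \<omega> in M. (\<lambda>j. tpoly (N j) (c j) (x j) k \<omega>) \<longlonglongrightarrow> F k \<omega>"
  shows "(\<lambda>j. tcov (N j) (c j) (x j) (l - k)) \<longlonglongrightarrow> expectation (\<lambda>\<omega>. F k \<omega> * F l \<omega>)"
    "AE \<omega> in M. \<bar>F k \<omega>\<bar> \<le> B"
proof -
  show "AE \<omega> in M. \<bar>F k \<omega>\<bar> \<le> B"
    using lim[of k]
  proof eventually_elim
    case (elim \<omega>)
    show ?case by (rule LIMSEQ_le_const2[OF tendsto_rabs[OF elim]]) (use B in auto)
  qed
  have "(\<lambda>j. expectation (\<lambda>\<omega>. tpoly (N j) (c j) (x j) k \<omega> * tpoly (N j) (c j) (x j) l \<omega>)) \<longlonglongrightarrow> expectation (\<lambda>\<omega>. F k \<omega> * F l \<omega>)"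
  proof (rule integral_dominated_convergence[where w="\<lambda>_. B * B"])
    show "AE \<omega> in M. (\<lambda>j. tpoly (N j) (c j) (x j) k \<omega> * tpoly (N j) (c j) (x j) l \<omega>) \<longlonglongrightarrow> F k \<omega> * F l \<omega>"
      using lim[of k] lim[of l] by eventually_elim (intro tendsto_intros)
    \<comment> \<open>The bound holds at every point of the sample type, so an arbitrary one shows
      that \<open>B\<close> is nonnegative.\<close>
    have "0 \<le> B" using B[of 0 0 undefined] by linarith
    thus "AE \<omega> in M. norm (tpoly (N j) (c j) (x j) k \<omega> * tpoly (N j) (c j) (x j) l \<omega>) \<le> B * B" for j
      unfolding real_norm_def abs_mult by (intro AE_I2 mult_mono B) auto
  qed auto
  thus "(\<lambda>j. tcov (N j) (c j) (x j) (l - k)) \<longlonglongrightarrow> expectation (\<lambda>\<omega>. F k \<omega> * F l \<omega>)"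
    unfolding expectation_tpoly_mult .
qed

text \<open>Stationarity and decay pass to the limit because the constant of
  \<open>tcov_decay\<close> ignores the polynomial. \<open>K\<close> precedes \<open>F\<close>, so
  one value serves a limit, its approximants and the errors between them.\<close>

lemma trig_limit_cov:
  obtains K where "0 \<le> K" "\<And>F. trig_limit F \<Longrightarrow> (\<forall>k l. expectation (\<lambda>\<omega>. F k \<omega> * F l \<omega>) = expectation (\<lambda>\<omega>. F 0 \<omega> * F (l - k) \<omega>))
     \<and> (\<forall>k. \<bar>expectation (\<lambda>\<omega>. F 0 \<omega> * F k \<omega>)\<bar> \<le> K * expectation (\<lambda>\<omega>. F 0 \<omega> * F 0 \<omega>) * (\<rho> k)\<^sup>2)
     \<and> (\<forall>n. expectation (\<lambda>\<omega>. ((\<Sum>k\<in>{1..int n}. F k \<omega>))\<^sup>2) = (\<Sum>k\<in>{1..int n}. \<Sum>l\<in>{1..int n}. expectation (\<lambda>\<omega>. F 0 \<omega> * F (l - k) \<omega>)))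
     \<and> (\<forall>n. integrable M (\<lambda>\<omega>. (\<Sum>k\<in>{1..int n}. F k \<omega>)\<^sup>2))"
proof -
  obtain K where K: "0 \<le> K" "\<And>N c x k. \<bar>tcov N c x k\<bar> \<le> K * (\<rho> k)\<^sup>2 * tcov N c x 0" by (rule tcov_decay) blast
  show ?thesis
  proof (rule that[OF K(1)])
    fix F assume "trig_limit F"
    then obtain N c x B where m[measurable]: "\<And>k. F k \<in> borel_measurable M"
      and B: "\<And>j k \<omega>. \<bar>tpoly (N j) (c j) (x j) k \<omega>\<bar> \<le> B"
      and lim: "\<And>k. AE \<omega> in M. (\<lambda>j. tpoly (N j) (c j) (x j) k \<omega>) \<longlonglongrightarrow> F k \<omega>"
      unfolding trig_limit_def by blast
    note L = expectation_mult_limit(1)[OF m B lim] and FB = expectation_mult_limit(2)[OF m B lim]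
    have st: "expectation (\<lambda>\<omega>. F k \<omega> * F l \<omega>) = expectation (\<lambda>\<omega>. F 0 \<omega> * F (l - k) \<omega>)" for k l
      using LIMSEQ_unique[OF L[of l k]] L[of "l - k" 0] by simp
    have dec: "\<bar>expectation (\<lambda>\<omega>. F 0 \<omega> * F k \<omega>)\<bar> \<le> K * expectation (\<lambda>\<omega>. F 0 \<omega> * F 0 \<omega>) * (\<rho> k)\<^sup>2" for k
    proof -
      have a: "(\<lambda>j. \<bar>tcov (N j) (c j) (x j) k\<bar>) \<longlonglongrightarrow> \<bar>expectation (\<lambda>\<omega>. F 0 \<omega> * F k \<omega>)\<bar>"
        using tendsto_rabs[OF L[of k 0]] by simp
      have b: "(\<lambda>j. K * (\<rho> k)\<^sup>2 * tcov (N j) (c j) (x j) 0) \<longlonglongrightarrow> K * (\<rho> k)\<^sup>2 * expectation (\<lambda>\<omega>. F 0 \<omega> * F 0 \<omega>)"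
        using L[of 0 0] by (intro tendsto_intros) simp
      have "\<bar>expectation (\<lambda>\<omega>. F 0 \<omega> * F k \<omega>)\<bar> \<le> K * (\<rho> k)\<^sup>2 * expectation (\<lambda>\<omega>. F 0 \<omega> * F 0 \<omega>)"
        by (rule LIMSEQ_le[OF a b]) (use K(2) in blast)
      thus ?thesis by (simp add: mult_ac)
    qed
    have i: "integrable M (\<lambda>\<omega>. F k \<omega> * F l \<omega>)" for k l
      by (rule bounded_integrable_mult[OF m m FB FB])
    have sq: "(\<Sum>k\<in>{1..int n}. F k \<omega>)\<^sup>2 = (\<Sum>k\<in>{1..int n}. \<Sum>l\<in>{1..int n}. F k \<omega> * F l \<omega>)" for n \<omega>
      unfolding power2_eq_square sum_product ..
    have ex: "expectation (\<lambda>\<omega>. (\<Sum>k\<in>{1..int n}. F k \<omega>)\<^sup>2) = (\<Sum>k\<in>{1..int n}. \<Sum>l\<in>{1..int n}. expectation (\<lambda>\<omega>. F 0 \<omega> * F (l - k) \<omega>))" for n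
    proof -
      have "expectation (\<lambda>\<omega>. (\<Sum>k\<in>{1..int n}. F k \<omega>)\<^sup>2) = (\<Sum>k\<in>{1..int n}. \<Sum>l\<in>{1..int n}. expectation (\<lambda>\<omega>. F k \<omega> * F l \<omega>))"
        unfolding sq using i
        by (subst Bochner_Integration.integral_sum, force, intro sum.cong refl, subst Bochner_Integration.integral_sum) auto
      also have "\<dots> = (\<Sum>k\<in>{1..int n}. \<Sum>l\<in>{1..int n}. expectation (\<lambda>\<omega>. F 0 \<omega> * F (l - k) \<omega>))"
        by (intro sum.cong refl st)
      finally show ?thesis .
    qed
    have int: "integrable M (\<lambda>\<omega>. (\<Sum>k\<in>{1..int n}. F k \<omega>)\<^sup>2)" for n
      unfolding sq using i by (intro Bochner_Integration.integrable_sum)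
    show "(\<forall>k l. expectation (\<lambda>\<omega>. F k \<omega> * F l \<omega>) = expectation (\<lambda>\<omega>. F 0 \<omega> * F (l - k) \<omega>))
     \<and> (\<forall>k. \<bar>expectation (\<lambda>\<omega>. F 0 \<omega> * F k \<omega>)\<bar> \<le> K * expectation (\<lambda>\<omega>. F 0 \<omega> * F 0 \<omega>) * (\<rho> k)\<^sup>2)
     \<and> (\<forall>n. expectation (\<lambda>\<omega>. ((\<Sum>k\<in>{1..int n}. F k \<omega>))\<^sup>2) = (\<Sum>k\<in>{1..int n}. \<Sum>l\<in>{1..int n}. expectation (\<lambda>\<omega>. F 0 \<omega> * F (l - k) \<omega>)))
     \<and> (\<forall>n. integrable M (\<lambda>\<omega>. (\<Sum>k\<in>{1..int n}. F k \<omega>)\<^sup>2))"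
      using st dec ex int by blast
  qed
qed

text \<open>Subjects the error of approximation to \<open>trig_limit_cov\<close>.\<close>

lemma trig_limit_diff_tpoly:
  assumes "trig_limit F" shows "trig_limit (\<lambda>k \<omega>. F k \<omega> - tpoly N0 c0 x0 k \<omega>)"
proof -
  from assms obtain N c x B where m[measurable]: "\<And>k. F k \<in> borel_measurable M"
    and B: "\<And>j k \<omega>. \<bar>tpoly (N j) (c j) (x j) k \<omega>\<bar> \<le> B"
    and lim: "\<And>k. AE \<omega> in M. (\<lambda>j. tpoly (N j) (c j) (x j) k \<omega>) \<longlonglongrightarrow> F k \<omega>"
    unfolding trig_limit_def by blast
  have "\<forall>j. \<exists>t. \<forall>k \<omega>. tpoly (N j) (c j) (x j) k \<omega> - tpoly N0 c0 x0 k \<omega> = tpoly (fst t) (fst (snd t)) (snd (snd t)) k \<omega>"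
  proof
    fix j
    obtain N3 c3 x3 where "\<forall>k \<omega>. tpoly (N j) (c j) (x j) k \<omega> - tpoly N0 c0 x0 k \<omega> = tpoly N3 c3 x3 k \<omega>"
      using tpoly_diff by blast
    thus "\<exists>t. \<forall>k \<omega>. tpoly (N j) (c j) (x j) k \<omega> - tpoly N0 c0 x0 k \<omega> = tpoly (fst t) (fst (snd t)) (snd (snd t)) k \<omega>"
      by (intro exI[of _ "(N3, c3, x3)"]) simp
  qed
  then obtain t where t: "\<And>j k \<omega>. tpoly (N j) (c j) (x j) k \<omega> - tpoly N0 c0 x0 k \<omega> = tpoly (fst (t j)) (fst (snd (t j))) (snd (snd (t j))) k \<omega>"
    by metis
  show ?thesis unfolding trig_limit_def
  proof (intro conjI allI exI)
    show "(\<lambda>\<omega>. F k \<omega> - tpoly N0 c0 x0 k \<omega>) \<in> borel_measurable M" for k by measurable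
    show "\<bar>tpoly (fst (t j)) (fst (snd (t j))) (snd (snd (t j))) k \<omega>\<bar> \<le> B + 2 * (\<Sum>m<N0. \<bar>c0 m\<bar>)" for j k \<omega>
      unfolding t[symmetric] using B[of j k \<omega>] tpoly_bound[of N0 c0 x0 k \<omega>] by linarith
    show "AE \<omega> in M. (\<lambda>j. tpoly (fst (t j)) (fst (snd (t j))) (snd (snd (t j))) k \<omega>) \<longlonglongrightarrow> F k \<omega> - tpoly N0 c0 x0 k \<omega>" for k
      unfolding t[symmetric] using lim[of k] by eventually_elim (intro tendsto_intros)
  qed
qed

lemma trig_limit_tpoly: "trig_limit (tpoly N c x)"
  unfolding trig_limit_def using tpoly_bound[of N c x]
  by (auto intro!: exI[of _ "\<lambda>_. N"] exI[of _ "\<lambda>_. c"] exI[of _ "\<lambda>_. x"])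

end

lemma (in prob_space) cauchy_schwarz_expectation:
  fixes X Y :: "'a \<Rightarrow> real"
  assumes [measurable]: "X \<in> borel_measurable M" "Y \<in> borel_measurable M"
    and X2: "integrable M (\<lambda>\<omega>. (X \<omega>)\<^sup>2)" and Y2: "integrable M (\<lambda>\<omega>. (Y \<omega>)\<^sup>2)"
  shows "\<bar>expectation (\<lambda>\<omega>. X \<omega> * Y \<omega>)\<bar> \<le> sqrt (expectation (\<lambda>\<omega>. (X \<omega>)\<^sup>2)) * sqrt (expectation (\<lambda>\<omega>. (Y \<omega>)\<^sup>2))"
proof -
  have XY: "integrable M (\<lambda>\<omega>. X \<omega> * Y \<omega>)" by (rule integrable_mult_of_squares[OF _ X2 _ Y2]) auto
  let ?a = "expectation (\<lambda>\<omega>. (X \<omega>)\<^sup>2)" and ?b = "expectation (\<lambda>\<omega>. (Y \<omega>)\<^sup>2)" and ?c = "expectation (\<lambda>\<omega>. X \<omega> * Y \<omega>)"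
  have a0: "0 \<le> ?a" and b0: "0 \<le> ?b" by (rule integral_nonneg_AE, simp)+
  have "?c\<^sup>2 \<le> ?a * ?b"
  proof (cases "?b = 0")
    case True
    hence "AE \<omega> in M. (Y \<omega>)\<^sup>2 = 0" using Y2 by (subst (asm) integral_nonneg_eq_0_iff_AE) auto
    hence "AE \<omega> in M. X \<omega> * Y \<omega> = 0" by eventually_elim simp
    hence "?c = 0" by (rule integral_eq_zero_AE)
    thus ?thesis using True by simp
  next
    case False
    hence b: "0 < ?b" using b0 by linarith
    have "0 \<le> expectation (\<lambda>\<omega>. (X \<omega> - (?c / ?b) * Y \<omega>)\<^sup>2)" by (rule integral_nonneg_AE) simp
    also have "\<dots> = expectation (\<lambda>\<omega>. (X \<omega>)\<^sup>2 - 2 * (?c / ?b) * (X \<omega> * Y \<omega>) + (?c / ?b)\<^sup>2 * (Y \<omega>)\<^sup>2)"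
      by (intro Bochner_Integration.integral_cong refl) (simp add: power2_eq_square algebra_simps)
    also have "\<dots> = ?a - 2 * (?c / ?b) * ?c + (?c / ?b)\<^sup>2 * ?b"
      using X2 Y2 XY by simp
    also have "\<dots> = ?a - ?c\<^sup>2 / ?b" using b by (simp add: field_simps power2_eq_square)
    finally show ?thesis using b by (simp add: field_simps)
  qed
  hence "sqrt (?c\<^sup>2) \<le> sqrt (?a * ?b)" by (rule real_sqrt_le_mono)
  thus ?thesis by (simp add: real_sqrt_mult)
qed

context stationary_gaussian
begin

text \<open>The normalised sums of \<open>F\<close> and of an approximant differ in mean square by
  at most a constant times the error \<eta> at a single time, whatever n is. Hence characteristic
  functions and variances are close uniformly in n, and \<open>trig_clt\<close> treats the
  approximant. The bound on second moments is recorded for a later change of normalisation.\<close>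

theorem trig_limit_clt:
  assumes F: "trig_limit F"
  shows "\<exists>\<sigma>2 C. (\<lambda>N. \<Sum>d\<in>{- int N..int N}. expectation (\<lambda>\<omega>. F 0 \<omega> * F d \<omega>)) \<longlonglongrightarrow> \<sigma>2 \<and> 0 \<le> \<sigma>2
     \<and> (\<forall>n. expectation (\<lambda>\<omega>. ((\<Sum>k\<in>{1..int n}. F k \<omega>) / sqrt (real n))\<^sup>2) \<le> C)
     \<and> (\<forall>n. integrable M (\<lambda>\<omega>. ((\<Sum>k\<in>{1..int n}. F k \<omega>) / sqrt (real n))\<^sup>2))
     \<and> (\<forall>\<theta>. (\<lambda>n. expectation (\<lambda>\<omega>. cis (\<theta> * ((\<Sum>k\<in>{1..int n}. F k \<omega>) / sqrt (real n))))) \<longlonglongrightarrow> of_real (exp (- \<theta>\<^sup>2 * \<sigma>2 / 2)))"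
proof -
  define \<Phi> where "\<Phi> k = expectation (\<lambda>\<omega>. F 0 \<omega> * F k \<omega>)" for k
  obtain K where K: "0 \<le> K" and Kc: "\<And>F. trig_limit F \<Longrightarrow> (\<forall>k l. expectation (\<lambda>\<omega>. F k \<omega> * F l \<omega>) = expectation (\<lambda>\<omega>. F 0 \<omega> * F (l - k) \<omega>))
     \<and> (\<forall>k. \<bar>expectation (\<lambda>\<omega>. F 0 \<omega> * F k \<omega>)\<bar> \<le> K * expectation (\<lambda>\<omega>. F 0 \<omega> * F 0 \<omega>) * (\<rho> k)\<^sup>2)
     \<and> (\<forall>n. expectation (\<lambda>\<omega>. ((\<Sum>k\<in>{1..int n}. F k \<omega>))\<^sup>2) = (\<Sum>k\<in>{1..int n}. \<Sum>l\<in>{1..int n}. expectation (\<lambda>\<omega>. F 0 \<omega> * F (l - k) \<omega>)))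
     \<and> (\<forall>n. integrable M (\<lambda>\<omega>. (\<Sum>k\<in>{1..int n}. F k \<omega>)\<^sup>2))"
    by (rule trig_limit_cov) blast
  have nn: "0 \<le> expectation (\<lambda>\<omega>. G \<omega> * G \<omega>)" for G :: "'a \<Rightarrow> real" by (rule integral_nonneg_AE) simp
  have norm2: "expectation (\<lambda>\<omega>. ((\<Sum>k\<in>{1..int n}. G k \<omega>) / sqrt (real n))\<^sup>2) = (\<Sum>k\<in>{1..int n}. \<Sum>l\<in>{1..int n}. expectation (\<lambda>\<omega>. G 0 \<omega> * G (l - k) \<omega>)) / real n"
      "integrable M (\<lambda>\<omega>. ((\<Sum>k\<in>{1..int n}. G k \<omega>) / sqrt (real n))\<^sup>2)"
      "expectation (\<lambda>\<omega>. ((\<Sum>k\<in>{1..int n}. G k \<omega>) / sqrt (real n))\<^sup>2) \<le> K * mass * expectation (\<lambda>\<omega>. G 0 \<omega> * G 0 \<omega>)"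
    if G: "trig_limit G" for G n
  proof -
    show 1: "expectation (\<lambda>\<omega>. ((\<Sum>k\<in>{1..int n}. G k \<omega>) / sqrt (real n))\<^sup>2) = (\<Sum>k\<in>{1..int n}. \<Sum>l\<in>{1..int n}. expectation (\<lambda>\<omega>. G 0 \<omega> * G (l - k) \<omega>)) / real n"
      using Kc[OF G] by (simp add: power_divide)
    show "integrable M (\<lambda>\<omega>. ((\<Sum>k\<in>{1..int n}. G k \<omega>) / sqrt (real n))\<^sup>2)"
      using Kc[OF G] by (simp add: power_divide)
    have "(\<Sum>k\<in>{1..int n}. \<Sum>l\<in>{1..int n}. expectation (\<lambda>\<omega>. G 0 \<omega> * G (l - k) \<omega>)) \<le> real n * (K * expectation (\<lambda>\<omega>. G 0 \<omega> * G 0 \<omega>) * mass)"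
      by (rule double_sum_le) (use Kc[OF G] K nn in auto)
    hence "(\<Sum>k\<in>{1..int n}. \<Sum>l\<in>{1..int n}. expectation (\<lambda>\<omega>. G 0 \<omega> * G (l - k) \<omega>)) / real n \<le> K * mass * expectation (\<lambda>\<omega>. G 0 \<omega> * G 0 \<omega>)"
      using K mass_nonneg nn[of "G 0"] by (cases "n = 0") (auto simp: field_simps)
    thus "expectation (\<lambda>\<omega>. ((\<Sum>k\<in>{1..int n}. G k \<omega>) / sqrt (real n))\<^sup>2) \<le> K * mass * expectation (\<lambda>\<omega>. G 0 \<omega> * G 0 \<omega>)"
      unfolding 1 .
  qed
  obtain \<sigma>2 where \<sigma>: "(\<lambda>N. \<Sum>d\<in>{- int N..int N}. \<Phi> d) \<longlonglongrightarrow> \<sigma>2"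
  proof -
    have "convergent (\<lambda>N. \<Sum>d\<in>{- int N..int N}. \<Phi> d)"
      using Kc[OF F] by (intro symmetric_sum_convergent[of \<Phi> "K * \<Phi> 0"]) (auto simp: \<Phi>_def)
    thus ?thesis using that by (auto simp: convergent_def)
  qed
  define S where "S n \<omega> = (\<Sum>k\<in>{1..int n}. F k \<omega>) / sqrt (real n)" for n \<omega>
  define v where "v n = expectation (\<lambda>\<omega>. (S n \<omega>)\<^sup>2)" for n
  have v0: "0 \<le> v n" for n unfolding v_def by (rule integral_nonneg_AE) simp
  have v\<sigma>: "v \<longlonglongrightarrow> \<sigma>2"
  proof -
    have "v = (\<lambda>n. (\<Sum>N<n. \<Sum>d\<in>{- int N..int N}. \<Phi> d) / real n)"
      unfolding v_def S_def norm2(1)[OF F] sum_diff_square_eq_sum_symmetric[symmetric] \<Phi>_def ..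
    thus ?thesis using tendsto_arithmetic_means[OF \<sigma>] by simp
  qed
  have \<sigma>0: "0 \<le> \<sigma>2" by (rule LIMSEQ_le_const[OF v\<sigma>]) (use v0 in auto)
  from F obtain N c x B where Fm[measurable]: "\<And>k. F k \<in> borel_measurable M"
    and B: "\<And>j k \<omega>. \<bar>tpoly (N j) (c j) (x j) k \<omega>\<bar> \<le> B"
    and lim: "\<And>k. AE \<omega> in M. (\<lambda>j. tpoly (N j) (c j) (x j) k \<omega>) \<longlonglongrightarrow> F k \<omega>"
    unfolding trig_limit_def by blast
  note FB = expectation_mult_limit(2)[OF Fm B lim]
  have B0: "0 \<le> B" using B[of 0 0 undefined] by linarith
  define g where "g j = tpoly (N j) (c j) (x j)" for j
  have gm[measurable]: "g j k \<in> borel_measurable M" for j k by (simp add: g_def)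
  have gl: "trig_limit (g j)" for j unfolding g_def by (rule trig_limit_tpoly)
  have dl: "trig_limit (\<lambda>k \<omega>. F k \<omega> - g j k \<omega>)" for j unfolding g_def by (rule trig_limit_diff_tpoly[OF F])
  define \<eta> where "\<eta> j = expectation (\<lambda>\<omega>. (F 0 \<omega> - g j 0 \<omega>) * (F 0 \<omega> - g j 0 \<omega>))" for j
  have \<eta>0: "\<eta> \<longlonglongrightarrow> 0"
  proof -
    have "(\<lambda>j. expectation (\<lambda>\<omega>. (F 0 \<omega> - g j 0 \<omega>) * (F 0 \<omega> - g j 0 \<omega>))) \<longlonglongrightarrow> expectation (\<lambda>\<omega>. 0)"
    proof (rule integral_dominated_convergence[where w="\<lambda>_. (2 * B) * (2 * B)"])
      show "AE \<omega> in M. (\<lambda>j. (F 0 \<omega> - g j 0 \<omega>) * (F 0 \<omega> - g j 0 \<omega>)) \<longlonglongrightarrow> 0"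
        using lim[of 0]
      proof eventually_elim
        case (elim \<omega>)
        have "(\<lambda>j. (F 0 \<omega> - g j 0 \<omega>) * (F 0 \<omega> - g j 0 \<omega>)) \<longlonglongrightarrow> (F 0 \<omega> - F 0 \<omega>) * (F 0 \<omega> - F 0 \<omega>)"
          unfolding g_def by (intro tendsto_intros elim)
        thus ?case by simp
      qed
      show "AE \<omega> in M. norm ((F 0 \<omega> - g j 0 \<omega>) * (F 0 \<omega> - g j 0 \<omega>)) \<le> 2 * B * (2 * B)" for j
        using FB[of 0]
      proof eventually_elim
        case (elim \<omega>)
        hence "\<bar>F 0 \<omega> - g j 0 \<omega>\<bar> \<le> 2 * B" using B[of j 0 \<omega>] unfolding g_def by linarith
        thus ?case unfolding real_norm_def abs_mult using B0 by (intro mult_mono) auto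
      qed
    qed auto
    thus ?thesis unfolding \<eta>_def by simp
  qed
  define T where "T j n \<omega> = (\<Sum>k\<in>{1..int n}. g j k \<omega>) / sqrt (real n)" for j n \<omega>
  have [measurable]: "S n \<in> borel_measurable M" "T j n \<in> borel_measurable M" for n j
    unfolding S_def[abs_def] T_def[abs_def] by measurable
  define \<delta> where "\<delta> j = sqrt (K * mass * \<eta> j)" for j
  \<comment> \<open>Bounds E[(S + T)^2] through (S + T)^2 <= 2 S^2 + 2 T^2. It enters when the
    difference of the variances is written as E[(S - T)(S + T)].\<close>
  define C where "C = K * mass * (2 * \<Phi> 0) + K * mass * (2 * (B * B))"
  have \<eta>n: "0 \<le> \<eta> j" for j unfolding \<eta>_def by (rule nn)
  have \<delta>n: "0 \<le> \<delta> j" for j using K mass_nonneg \<eta>n by (simp add: \<delta>_def)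
  have iS: "integrable M (\<lambda>\<omega>. (S n \<omega>)\<^sup>2)" for n unfolding S_def by (rule norm2(2)[OF F])
  have iT: "integrable M (\<lambda>\<omega>. (T j n \<omega>)\<^sup>2)" for j n unfolding T_def by (rule norm2(2)[OF gl])
  have ST: "S n \<omega> - T j n \<omega> = (\<Sum>k\<in>{1..int n}. F k \<omega> - g j k \<omega>) / sqrt (real n)" for j n \<omega>
    unfolding S_def T_def by (simp add: sum_subtractf diff_divide_distrib)
  have iD: "integrable M (\<lambda>\<omega>. (S n \<omega> - T j n \<omega>)\<^sup>2)" for j n unfolding ST by (rule norm2(2)[OF dl])
  have D: "expectation (\<lambda>\<omega>. (S n \<omega> - T j n \<omega>)\<^sup>2) \<le> (\<delta> j)\<^sup>2" for j n
    unfolding ST using norm2(3)[OF dl, of j n] K mass_nonneg \<eta>n[of j] by (simp add: \<delta>_def \<eta>_def)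
  have iP: "integrable M (\<lambda>\<omega>. (S n \<omega> + T j n \<omega>)\<^sup>2)" for j n
  proof -
    have "integrable M (\<lambda>\<omega>. 2 * (S n \<omega>)\<^sup>2 + 2 * (T j n \<omega>)\<^sup>2 - (S n \<omega> - T j n \<omega>)\<^sup>2)" using iS iT iD by simp
    thus ?thesis by (simp add: power2_eq_square algebra_simps)
  qed
  have P: "expectation (\<lambda>\<omega>. (S n \<omega> + T j n \<omega>)\<^sup>2) \<le> C" for j n
  proof -
    have "expectation (\<lambda>\<omega>. (S n \<omega> + T j n \<omega>)\<^sup>2) \<le> expectation (\<lambda>\<omega>. 2 * (S n \<omega>)\<^sup>2 + 2 * (T j n \<omega>)\<^sup>2)"
    proof (rule integral_mono)
      show "(S n \<omega> + T j n \<omega>)\<^sup>2 \<le> 2 * (S n \<omega>)\<^sup>2 + 2 * (T j n \<omega>)\<^sup>2" for \<omega>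
        using zero_le_power2[of "S n \<omega> - T j n \<omega>"] unfolding power2_sum power2_diff by linarith
    qed (use iP iS iT in auto)
    also have "\<dots> = 2 * expectation (\<lambda>\<omega>. (S n \<omega>)\<^sup>2) + 2 * expectation (\<lambda>\<omega>. (T j n \<omega>)\<^sup>2)" using iS iT by simp
    finally have e0: "expectation (\<lambda>\<omega>. (S n \<omega> + T j n \<omega>)\<^sup>2) \<le> 2 * expectation (\<lambda>\<omega>. (S n \<omega>)\<^sup>2) + 2 * expectation (\<lambda>\<omega>. (T j n \<omega>)\<^sup>2)" .
    have e1: "expectation (\<lambda>\<omega>. (S n \<omega>)\<^sup>2) \<le> K * mass * \<Phi> 0" unfolding S_def \<Phi>_def by (rule norm2(3)[OF F])
    have e2: "expectation (\<lambda>\<omega>. (T j n \<omega>)\<^sup>2) \<le> K * mass * expectation (\<lambda>\<omega>. g j 0 \<omega> * g j 0 \<omega>)" unfolding T_def by (rule norm2(3)[OF gl])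
    have "expectation (\<lambda>\<omega>. g j 0 \<omega> * g j 0 \<omega>) \<le> expectation (\<lambda>\<omega>. B * B)"
    proof (rule integral_mono)
      show "integrable M (\<lambda>\<omega>. g j 0 \<omega> * g j 0 \<omega>)" unfolding g_def by (rule tpoly_integrable_mult)
      show "g j 0 \<omega> * g j 0 \<omega> \<le> B * B" for \<omega>
        using mult_mono[OF B[of j 0 \<omega>] B[of j 0 \<omega>]] B0 unfolding g_def by (simp add: abs_mult_self_eq)
    qed simp
    hence "K * mass * expectation (\<lambda>\<omega>. g j 0 \<omega> * g j 0 \<omega>) \<le> K * mass * (B * B)"
      using K mass_nonneg by (intro mult_left_mono) (auto simp: prob_space)
    thus ?thesis using e0 e1 e2 unfolding C_def by linarith
  qed
  define w where "w j n = expectation (\<lambda>\<omega>. (T j n \<omega>)\<^sup>2)" for j n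
  have w0: "0 \<le> w j n" for j n unfolding w_def by (rule integral_nonneg_AE) simp
  have vw: "\<bar>v n - w j n\<bar> \<le> \<delta> j * sqrt C" for j n
  proof -
    have "v n - w j n = expectation (\<lambda>\<omega>. (S n \<omega> - T j n \<omega>) * (S n \<omega> + T j n \<omega>))"
    proof -
      have "v n - w j n = expectation (\<lambda>\<omega>. (S n \<omega>)\<^sup>2 - (T j n \<omega>)\<^sup>2)" unfolding v_def w_def using iS iT by simp
      also have "\<dots> = expectation (\<lambda>\<omega>. (S n \<omega> - T j n \<omega>) * (S n \<omega> + T j n \<omega>))"
        by (intro Bochner_Integration.integral_cong refl) (simp add: power2_eq_square algebra_simps)
      finally show ?thesis .
    qed
    hence "\<bar>v n - w j n\<bar> \<le> sqrt (expectation (\<lambda>\<omega>. (S n \<omega> - T j n \<omega>)\<^sup>2)) * sqrt (expectation (\<lambda>\<omega>. (S n \<omega> + T j n \<omega>)\<^sup>2))"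
      using cauchy_schwarz_expectation[OF _ _ iD[of n j] iP[of n j]] by simp
    also have "\<dots> \<le> \<delta> j * sqrt C"
    proof (intro mult_mono)
      show "sqrt (expectation (\<lambda>\<omega>. (S n \<omega> - T j n \<omega>)\<^sup>2)) \<le> \<delta> j"
        using real_sqrt_le_mono[OF D[of n j]] \<delta>n[of j] by simp
      show "sqrt (expectation (\<lambda>\<omega>. (S n \<omega> + T j n \<omega>)\<^sup>2)) \<le> sqrt C" using P by (rule real_sqrt_le_mono)
    qed (use \<delta>n in \<open>auto intro!: integral_nonneg_AE\<close>)
    finally show ?thesis .
  qed
  have main: "(\<lambda>n. expectation (\<lambda>\<omega>. cis (\<theta> * S n \<omega>))) \<longlonglongrightarrow> of_real (exp (- \<theta>\<^sup>2 * \<sigma>2 / 2))" for \<theta>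
  proof -
    let ?e = "\<lambda>y. complex_of_real (exp (- \<theta>\<^sup>2 * y / 2))"
    let ?G = "\<lambda>j n. expectation (\<lambda>\<omega>. cis (\<theta> * T j n \<omega>)) - ?e (w j n)"
    \<comment> \<open>The first summand comes from the Lipschitz bound for \<open>cis\<close>, the
      second from the one for exp applied to the two variances.\<close>
    define b where "b j = \<bar>\<theta>\<bar> * \<delta> j + \<theta>\<^sup>2 / 2 * (\<delta> j * sqrt C)" for j
    have b0: "b \<longlonglongrightarrow> 0"
    proof -
      have "\<delta> \<longlonglongrightarrow> sqrt (K * mass * 0)" unfolding \<delta>_def by (intro tendsto_intros \<eta>0)
      hence "\<delta> \<longlonglongrightarrow> 0" by simp
      hence "b \<longlonglongrightarrow> \<bar>\<theta>\<bar> * 0 + \<theta>\<^sup>2 / 2 * (0 * sqrt C)" unfolding b_def by (intro tendsto_intros)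
      thus ?thesis by simp
    qed
    have ic: "integrable M (\<lambda>\<omega>. cis (\<theta> * X \<omega>))" if "X \<in> borel_measurable M" for X
      using that by (intro bdd_rv_integrable bdd_rv_cis) measurable
    have bound: "cmod (expectation (\<lambda>\<omega>. cis (\<theta> * S n \<omega>)) - ?e (v n)) \<le> b j + cmod (?G j n)" for j n
    proof -
      have 1: "cmod (expectation (\<lambda>\<omega>. cis (\<theta> * S n \<omega>)) - expectation (\<lambda>\<omega>. cis (\<theta> * T j n \<omega>))) \<le> \<bar>\<theta>\<bar> * \<delta> j"
      proof -
        have iA: "integrable M (\<lambda>\<omega>. \<bar>S n \<omega> - T j n \<omega>\<bar>)"
          using integrable_of_square[OF _ iD[of n j]] by simp
        have "expectation (\<lambda>\<omega>. cis (\<theta> * S n \<omega>)) - expectation (\<lambda>\<omega>. cis (\<theta> * T j n \<omega>)) = expectation (\<lambda>\<omega>. cis (\<theta> * S n \<omega>) - cis (\<theta> * T j n \<omega>))"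
          using ic by simp
        also have "cmod \<dots> \<le> expectation (\<lambda>\<omega>. \<bar>\<theta>\<bar> * \<bar>S n \<omega> - T j n \<omega>\<bar>)"
        proof (rule norm_integral_le)
          show "cmod (cis (\<theta> * S n \<omega>) - cis (\<theta> * T j n \<omega>)) \<le> \<bar>\<theta>\<bar> * \<bar>S n \<omega> - T j n \<omega>\<bar>" for \<omega>
            using norm_cis_diff_le[of "\<theta> * S n \<omega>" "\<theta> * T j n \<omega>"] by (simp add: abs_mult flip: right_diff_distrib)
        qed (use ic iA in auto)
        also have "\<dots> \<le> \<bar>\<theta>\<bar> * \<delta> j"
          using expectation_abs_le_of_square[OF _ iD D \<delta>n, of n j] by (simp add: mult_left_mono)
        finally show ?thesis .
      qed
      have 2: "cmod (?e (w j n) - ?e (v n)) \<le> \<theta>\<^sup>2 / 2 * (\<delta> j * sqrt C)"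
      proof -
        have "cmod (?e (w j n) - ?e (v n)) = \<bar>exp (- (\<theta>\<^sup>2 * w j n / 2)) - exp (- (\<theta>\<^sup>2 * v n / 2))\<bar>"
          by (simp flip: of_real_diff)
        also have "\<dots> \<le> \<bar>\<theta>\<^sup>2 * w j n / 2 - \<theta>\<^sup>2 * v n / 2\<bar>" by (rule exp_minus_lipschitz) (use w0 v0 in auto)
        also have "\<dots> = \<theta>\<^sup>2 / 2 * \<bar>v n - w j n\<bar>"
          by (simp add: abs_mult abs_minus_commute flip: right_diff_distrib diff_divide_distrib)
        also have "\<dots> \<le> \<theta>\<^sup>2 / 2 * (\<delta> j * sqrt C)" by (intro mult_left_mono vw) simp
        finally show ?thesis .
      qed
      have "expectation (\<lambda>\<omega>. cis (\<theta> * S n \<omega>)) - ?e (v n) = (expectation (\<lambda>\<omega>. cis (\<theta> * S n \<omega>)) - expectation (\<lambda>\<omega>. cis (\<theta> * T j n \<omega>))) + ?G j n + (?e (w j n) - ?e (v n))"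
        by simp
      also have "cmod \<dots> \<le> \<bar>\<theta>\<bar> * \<delta> j + cmod (?G j n) + \<theta>\<^sup>2 / 2 * (\<delta> j * sqrt C)"
        by (intro norm_triangle_le add_mono 1 2 order_refl)
      finally show ?thesis by (simp add: b_def)
    qed
    have G0: "?G j \<longlonglongrightarrow> 0" for j
    proof -
      have "T j n \<omega> = (\<Sum>k\<in>{1..int n}. \<Sum>m<N j. c j m * (cos (lin (x j m) k \<omega>) - exp (- bil 0 (x j m) (x j m) / 2))) / sqrt (real n)" for n \<omega>
        unfolding T_def g_def tpoly_def ..
      thus ?thesis unfolding w_def using trig_clt[of \<theta> "c j" "x j" "N j"] by simp
    qed
    have "(\<lambda>n. expectation (\<lambda>\<omega>. cis (\<theta> * S n \<omega>)) - ?e (v n)) \<longlonglongrightarrow> 0"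
    proof (rule LIMSEQ_I)
      fix r :: real assume r: "0 < r"
      \<comment> \<open>The approximant is fixed first, and only then is n chosen large for
        it.\<close>
      obtain j where j: "\<bar>b j\<bar> < r / 2" using LIMSEQ_D[OF b0, of "r / 2"] r by (auto simp: real_norm_def)
      obtain n0 where n0: "\<And>n. n \<ge> n0 \<Longrightarrow> cmod (?G j n) < r / 2" using LIMSEQ_D[OF G0[of j], of "r / 2"] r by auto
      show "\<exists>no. \<forall>n\<ge>no. norm (expectation (\<lambda>\<omega>. cis (\<theta> * S n \<omega>)) - ?e (v n) - 0) < r"
      proof (intro exI allI impI)
        fix n assume "n0 \<le> n"
        from n0[OF this] bound[of n j] j show "norm (expectation (\<lambda>\<omega>. cis (\<theta> * S n \<omega>)) - ?e (v n) - 0) < r"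
          by simp
      qed
    qed
    moreover have "(\<lambda>n. ?e (v n)) \<longlonglongrightarrow> ?e \<sigma>2" by (intro tendsto_intros v\<sigma>) simp
    ultimately have "(\<lambda>n. (expectation (\<lambda>\<omega>. cis (\<theta> * S n \<omega>)) - ?e (v n)) + ?e (v n)) \<longlonglongrightarrow> 0 + ?e \<sigma>2"
      by (rule tendsto_add)
    thus ?thesis by simp
  qed
  have SC: "expectation (\<lambda>\<omega>. (S n \<omega>)\<^sup>2) \<le> K * mass * \<Phi> 0" for n unfolding S_def \<Phi>_def by (rule norm2(3)[OF F])
  show ?thesis
    using \<sigma> \<sigma>0 SC iS main unfolding S_def \<Phi>_def by blast
qed

end

section \<open>Signs as limits of odd trigonometric polynomials\<close>

text \<open>The iterates of this map on [-1, 1] converge to the sign function.\<close>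

definition sharpen :: "real \<Rightarrow> real" where "sharpen y = 3 / 2 * y - 1 / 2 * (y * (y * y))"

lemma sharpen_mono: assumes "0 \<le> y" "y \<le> z" "z \<le> 1" shows "sharpen y \<le> sharpen z"
proof -
  have "z\<^sup>2 \<le> 1" "y\<^sup>2 \<le> 1" "y * z \<le> 1" using assms by (auto simp: power_le_one intro!: mult_le_one)
  hence "0 \<le> (z - y) * (3 - (z\<^sup>2 + y * z + y\<^sup>2))" using assms by (intro mult_nonneg_nonneg) auto
  also have "\<dots> = 2 * (sharpen z - sharpen y)" by (simp add: sharpen_def power2_eq_square algebra_simps)
  finally show ?thesis by simp
qed

lemma tendsto_sharpen: "(f \<longlongrightarrow> L) F \<Longrightarrow> ((\<lambda>m. sharpen (f m)) \<longlongrightarrow> sharpen L) F"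
  unfolding sharpen_def by (intro tendsto_intros)

lemma sharpen_range: assumes "0 \<le> y" "y \<le> 1" shows "y \<le> sharpen y" "sharpen y \<le> 1"
proof -
  have "y * y\<^sup>2 \<le> y * 1" using assms by (intro mult_left_mono) (auto simp: power_le_one)
  thus "y \<le> sharpen y" by (simp add: sharpen_def power2_eq_square)
  show "sharpen y \<le> 1" using sharpen_mono[OF assms(1,2)] by (simp add: sharpen_def)
qed

lemma sharpen_minus: "sharpen (- y) = - sharpen y"
  by (simp add: sharpen_def)

lemma sharpen_iter_minus: "(sharpen ^^ m) (- y) = - (sharpen ^^ m) y"
  by (induction m) (auto simp: sharpen_minus)

lemma sharpen_iter_range: "0 \<le> y \<Longrightarrow> y \<le> 1 \<Longrightarrow> y \<le> (sharpen ^^ m) y \<and> (sharpen ^^ m) y \<le> 1"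
proof (induction m)
  case (Suc m)
  thus ?case using sharpen_range[of "(sharpen ^^ m) y"] by auto
qed simp

lemma sharpen_iter_mono: "0 \<le> y \<Longrightarrow> y \<le> z \<Longrightarrow> z \<le> 1 \<Longrightarrow> (sharpen ^^ m) y \<le> (sharpen ^^ m) z"
proof (induction m)
  case (Suc m)
  show ?case unfolding funpow.simps comp_def
    using Suc sharpen_iter_range[of y m] sharpen_iter_range[of z m] by (intro sharpen_mono) auto
qed simp

lemma sharpen_iter_abs_le: assumes "\<bar>y\<bar> \<le> 1" shows "\<bar>(sharpen ^^ m) y\<bar> \<le> 1"
proof (cases "0 \<le> y")
  case True
  thus ?thesis using sharpen_iter_range[of y m] assms by auto
next
  case False
  thus ?thesis using sharpen_iter_range[of "- y" m] assms by (auto simp: sharpen_iter_minus)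
qed

text \<open>The iterates increase and are bounded, so they converge to a fixed point; these are -1,
  0 and 1, and the limit is at least y > 0.\<close>

lemma sharpen_iter_tendsto:
  assumes "0 < y" "y \<le> 1" shows "(\<lambda>m. (sharpen ^^ m) y) \<longlonglongrightarrow> 1"
proof -
  have inc: "incseq (\<lambda>m. (sharpen ^^ m) y)"
  proof (rule incseq_SucI)
    fix m show "(sharpen ^^ m) y \<le> (sharpen ^^ Suc m) y"
      using sharpen_iter_range[of y m] sharpen_range(1)[of "(sharpen ^^ m) y"] assms by simp
  qed
  moreover have bd: "(sharpen ^^ m) y \<le> 1" for m using sharpen_iter_range[of y m] assms by simp
  ultimately obtain L where L: "(\<lambda>m. (sharpen ^^ m) y) \<longlonglongrightarrow> L" using incseq_convergent[of "\<lambda>m. (sharpen ^^ m) y" 1] by blast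
  have "(\<lambda>m. sharpen ((sharpen ^^ m) y)) \<longlonglongrightarrow> sharpen L"
    by (rule tendsto_sharpen[OF L])
  moreover have "(\<lambda>m. sharpen ((sharpen ^^ m) y)) \<longlonglongrightarrow> L" using LIMSEQ_Suc[OF L] by simp
  ultimately have fp: "sharpen L = L" by (rule LIMSEQ_unique)
  have Ly: "y \<le> L" by (rule LIMSEQ_le_const[OF L]) (use sharpen_iter_range[of y] assms in auto)
  have "L * (1 - L) * (1 + L) = 0" using fp by (simp add: sharpen_def algebra_simps)
  hence "L = 1" using Ly assms by auto
  thus ?thesis using L by simp
qed

text \<open>Dividing by N + 1 eventually brings any u into [-1, 1], where the sine has the sign of
  u. The number of iterations is then taken large enough to push the shrinking sine values to 1 or
  -1; at u = 0 oddness gives 0.\<close>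

lemma sgn_trig_approximation:
  obtains m :: "nat \<Rightarrow> nat" where "\<And>u. (\<lambda>N. (sharpen ^^ m N) (sin (u / real (Suc N)))) \<longlonglongrightarrow> sgn u"
proof -
  \<comment> \<open>The threshold is of smaller order than 1 / (N + 1), so u / (N + 1) eventually
    exceeds (1 / (N + 1))^2 for each u > 0, and monotonicity of the iterates applies.\<close>
  let ?y = "\<lambda>N. sin ((1 / real (Suc N))\<^sup>2)"
  have r: "0 < (1 / real (Suc N))\<^sup>2 \<and> (1 / real (Suc N))\<^sup>2 \<le> 1" for N
    by (auto simp: power_le_one)
  have y: "0 < ?y N" "?y N \<le> 1" for N
    using r[of N] pi_gt3 by (auto intro!: sin_gt_zero)
  have "\<forall>N. \<exists>m. 1 - 1 / real (Suc N) \<le> (sharpen ^^ m) (?y N)"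
  proof
    fix N
    have "eventually (\<lambda>m. 1 - 1 / real (Suc N) < (sharpen ^^ m) (?y N)) sequentially"
      by (rule order_tendstoD(1)[OF sharpen_iter_tendsto[OF y]]) simp
    thus "\<exists>m. 1 - 1 / real (Suc N) \<le> (sharpen ^^ m) (?y N)"
      by (auto simp: eventually_sequentially intro: less_imp_le)
  qed
  then obtain m where m: "\<And>N. 1 - 1 / real (Suc N) \<le> (sharpen ^^ m N) (?y N)" by metis
  have pos: "(\<lambda>N. (sharpen ^^ m N) (sin (u / real (Suc N)))) \<longlonglongrightarrow> 1" if u: "0 < u" for u
  proof (rule tendsto_sandwich)
    obtain n0 :: nat where n0: "max (1 / u) u < real n0" using reals_Archimedean2 by blast
    show "eventually (\<lambda>N. 1 - 1 / real (Suc N) \<le> (sharpen ^^ m N) (sin (u / real (Suc N)))) sequentially"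
      unfolding eventually_sequentially
    proof (intro exI allI impI)
      fix N assume N: "n0 \<le> N"
      have N1: "1 / u < real (Suc N)" "u < real (Suc N)" using n0 N by auto
      have a: "(1 / real (Suc N))\<^sup>2 \<le> u / real (Suc N)"
      proof -
        have "1 / real (Suc N) \<le> u" using N1(1) u by (simp add: field_simps)
        hence "(1 / real (Suc N)) * (1 / real (Suc N)) \<le> u * (1 / real (Suc N))" by (intro mult_right_mono) auto
        thus ?thesis by (simp only: power2_eq_square times_divide_eq_right mult_1_right)
      qed
      have b: "u / real (Suc N) \<le> 1" using N1(2) by simp
      have "?y N \<le> sin (u / real (Suc N))"
        using a b r[of N] pi_gt3 by (intro sin_monotone_2pi_le) linarith+
      hence "(sharpen ^^ m N) (?y N) \<le> (sharpen ^^ m N) (sin (u / real (Suc N)))"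
        using y[of N] by (intro sharpen_iter_mono) auto
      thus "1 - 1 / real (Suc N) \<le> (sharpen ^^ m N) (sin (u / real (Suc N)))" using m[of N] by linarith
    qed
    show "eventually (\<lambda>N. (sharpen ^^ m N) (sin (u / real (Suc N))) \<le> 1) sequentially"
    proof (rule always_eventually, rule allI)
      fix N show "(sharpen ^^ m N) (sin (u / real (Suc N))) \<le> 1"
        using sharpen_iter_abs_le[of "sin (u / real (Suc N))" "m N"] by simp
    qed
    have "(\<lambda>N. 1 - 1 / real (Suc N)) \<longlonglongrightarrow> 1 - 0"
      by (intro tendsto_intros LIMSEQ_Suc[OF lim_1_over_n])
    thus "(\<lambda>N. 1 - 1 / real (Suc N)) \<longlonglongrightarrow> 1" by simp
  qed simp
  have "(\<lambda>N. (sharpen ^^ m N) (sin (u / real (Suc N)))) \<longlonglongrightarrow> sgn u" for u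
  proof (cases u "0::real" rule: linorder_cases)
    case less
    have "(\<lambda>N. - (sharpen ^^ m N) (sin (- u / real (Suc N)))) \<longlonglongrightarrow> - 1"
      using pos[of "- u"] less by (intro tendsto_minus) auto
    thus ?thesis using less by (simp add: sharpen_iter_minus)
  next
    case equal
    have "(sharpen ^^ k) 0 = 0" for k by (induction k) (auto simp: sharpen_def)
    thus ?thesis using equal by simp
  next
    case greater
    thus ?thesis using pos by simp
  qed
  thus ?thesis by (rule that)
qed

section \<open>Parity of trigonometric polynomials and products of signs\<close>

context stationary_gaussian
begin

definition cos_or_sin :: "bool \<Rightarrow> real \<Rightarrow> real" where
  "cos_or_sin b u = (if b then cos u else sin u)"

text \<open>The Boolean is the parity, \<open>True\<close> for even and \<open>False\<close> for
  odd. Equality of Booleans then multiplies parities, which explains the index \<open>a = b\<close>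
  in the product rules.\<close>

inductive ptrig :: "bool \<Rightarrow> (int \<Rightarrow> 'a \<Rightarrow> real) \<Rightarrow> bool" for b where
  zero: "ptrig b (\<lambda>k \<omega>. 0)"
| step: "ptrig b G \<Longrightarrow> ptrig b (\<lambda>k \<omega>. c * cos_or_sin b (lin x k \<omega>) + G k \<omega>)"

lemma ptrig_single: "ptrig b (\<lambda>k \<omega>. c * cos_or_sin b (lin x k \<omega>))"
  using ptrig.step[OF ptrig.zero, of b c x] by simp

lemma ptrig_add: "ptrig b F \<Longrightarrow> ptrig b G \<Longrightarrow> ptrig b (\<lambda>k \<omega>. F k \<omega> + G k \<omega>)"
proof (induction rule: ptrig.induct)
  case (step F c x)
  thus ?case using ptrig.step[of b "\<lambda>k \<omega>. F k \<omega> + G k \<omega>" c x] by (simp add: add.assoc)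
qed simp

lemma ptrig_scale: "ptrig b F \<Longrightarrow> ptrig b (\<lambda>k \<omega>. a * F k \<omega>)"
proof (induction rule: ptrig.induct)
  case zero
  show ?case using ptrig.zero by simp
next
  case (step F c x)
  thus ?case using ptrig.step[of b "\<lambda>k \<omega>. a * F k \<omega>" "a * c" x] by (simp add: distrib_left mult.assoc)
qed

lemma lin_add: "lin (\<lambda>a. x a + y a) k \<omega> = lin x k \<omega> + lin y k \<omega>"
  by (simp add: lin_def sum.distrib distrib_right)

lemma lin_diff: "lin (\<lambda>a. x a - y a) k \<omega> = lin x k \<omega> - lin y k \<omega>"
  by (simp add: lin_def sum_subtractf left_diff_distrib)

lemma ptrig_mult_single:
  "ptrig (a = b) (\<lambda>k \<omega>. cos_or_sin a (lin x k \<omega>) * cos_or_sin b (lin y k \<omega>))"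
proof -
  let ?p = "\<lambda>k \<omega>. lin (\<lambda>a. x a + y a) k \<omega>" and ?m = "\<lambda>k \<omega>. lin (\<lambda>a. x a - y a) k \<omega>"
  obtain c1 c2 :: real where c: "\<And>u v. cos_or_sin a u * cos_or_sin b v = c1 * cos_or_sin (a = b) (u + v) + c2 * cos_or_sin (a = b) (u - v)"
  proof (cases a; cases b)
    assume "a" "b" thus ?thesis
      by (intro that[of "1/2" "1/2"]) (simp add: cos_or_sin_def cos_add cos_diff field_simps)
  next
    assume "a" "\<not> b" thus ?thesis
      by (intro that[of "1/2" "-1/2"]) (simp add: cos_or_sin_def sin_add sin_diff field_simps)
  next
    assume "\<not> a" "b" thus ?thesis
      by (intro that[of "1/2" "1/2"]) (simp add: cos_or_sin_def sin_add sin_diff field_simps)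
  next
    assume "\<not> a" "\<not> b" thus ?thesis
      by (intro that[of "-1/2" "1/2"]) (simp add: cos_or_sin_def cos_add cos_diff field_simps)
  qed
  have "ptrig (a = b) (\<lambda>k \<omega>. c1 * cos_or_sin (a = b) (?p k \<omega>) + c2 * cos_or_sin (a = b) (?m k \<omega>))"
    by (intro ptrig_add ptrig_single)
  thus ?thesis unfolding lin_add lin_diff c .
qed

lemma ptrig_mult:
  assumes F: "ptrig a F" and G: "ptrig b G"
  shows "ptrig (a = b) (\<lambda>k \<omega>. F k \<omega> * G k \<omega>)"
proof -
  have single: "ptrig (a = b) (\<lambda>k \<omega>. cos_or_sin a (lin x k \<omega>) * G k \<omega>)" for x
    using G
  proof (induction rule: ptrig.induct)
    case zero
    show ?case using ptrig.zero by simp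
  next
    case (step G c y)
    have "ptrig (a = b) (\<lambda>k \<omega>. c * (cos_or_sin a (lin x k \<omega>) * cos_or_sin b (lin y k \<omega>)) + cos_or_sin a (lin x k \<omega>) * G k \<omega>)"
      by (intro ptrig_add ptrig_scale ptrig_mult_single step)
    thus ?case by (simp add: algebra_simps)
  qed
  show ?thesis using F
  proof (induction rule: ptrig.induct)
    case zero
    show ?case using ptrig.zero by simp
  next
    case (step F c x)
    have "ptrig (a = b) (\<lambda>k \<omega>. c * (cos_or_sin a (lin x k \<omega>) * G k \<omega>) + F k \<omega> * G k \<omega>)"
      by (intro ptrig_add ptrig_scale single step)
    thus ?case by (simp add: algebra_simps)
  qed
qed

lemma ptrig_const: "ptrig True (\<lambda>k \<omega>. c)"
  using ptrig_single[of True c "\<lambda>_. 0"] by (simp add: cos_or_sin_def lin_def)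

lemma ptrig_prod: "(\<And>i. i \<in> J \<Longrightarrow> ptrig True (F i)) \<Longrightarrow> ptrig True (\<lambda>k \<omega>. \<Prod>i\<in>J. F i k \<omega>)"
proof (induction J rule: infinite_finite_induct)
  case (insert i J)
  thus ?case using ptrig_mult[of True "F i" True "\<lambda>k \<omega>. \<Prod>i\<in>J. F i k \<omega>"] by simp
qed (auto intro: ptrig_const)

lemma ptrig_sharpen:
  assumes F: "ptrig False F" shows "ptrig False (\<lambda>k \<omega>. (sharpen ^^ m) (F k \<omega>))"
proof (induction m)
  case (Suc m)
  let ?G = "\<lambda>k \<omega>. (sharpen ^^ m) (F k \<omega>)"
  \<comment> \<open>The square of an odd polynomial is even, so the cube is odd again and the
    induction stays among sines.\<close>
  have "ptrig (False = False) (\<lambda>k \<omega>. ?G k \<omega> * ?G k \<omega>)" by (rule ptrig_mult[OF Suc Suc])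
  hence "ptrig True (\<lambda>k \<omega>. ?G k \<omega> * ?G k \<omega>)" by simp
  from ptrig_mult[OF Suc this] have "ptrig False (\<lambda>k \<omega>. ?G k \<omega> * (?G k \<omega> * ?G k \<omega>))" by simp
  hence "ptrig False (\<lambda>k \<omega>. 3/2 * ?G k \<omega> + (-1/2) * (?G k \<omega> * (?G k \<omega> * ?G k \<omega>)))"
    using Suc by (intro ptrig_add ptrig_scale)
  moreover have "3/2 * y + (-1/2) * (y * (y * y)) = sharpen y" for y by (simp add: sharpen_def)
  ultimately show ?case by (simp only: funpow.simps comp_def)
qed (use F in simp)

lemma ptrig_True_normal_form:
  assumes "ptrig True G"
  shows "\<exists>(N::nat) c x. \<forall>k \<omega>. G k \<omega> = (\<Sum>m<N. c m * cos (lin (x m) k \<omega>))"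
  using assms
proof (induction rule: ptrig.induct)
  case zero
  show ?case by (intro exI[of _ 0]) simp
next
  case (step G c x)
  then obtain N :: nat and c' x' where G: "\<And>k \<omega>. G k \<omega> = (\<Sum>m<N. c' m * cos (lin (x' m) k \<omega>))" by blast
  show ?case
    by (intro exI[of _ "Suc N"] exI[of _ "c'(N := c)"] exI[of _ "x'(N := x)"]) (simp add: G cos_or_sin_def)
qed

text \<open>A vanishing linear form contributes the factor 1/2, so this is an indicator only where
  none of the forms vanishes.\<close>

definition sign_agree :: "'e set \<Rightarrow> ('e \<Rightarrow> 'i \<Rightarrow> real) \<Rightarrow> ('e \<Rightarrow> 'i \<Rightarrow> real) \<Rightarrow> int \<Rightarrow> 'a \<Rightarrow> real" where
  "sign_agree J x y k \<omega> = (\<Prod>i\<in>J. (1 + sgn (lin (x i) k \<omega>) * sgn (lin (y i) k \<omega>)) / 2)"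

text \<open>Signs are replaced by odd approximants with values in [-1, 1]. Every factor stays in
  [0, 1], which bounds the products uniformly, and products of two odd polynomials are even, so the
  whole is a sum of cosines.\<close>

lemma sign_agree_trig_limit:
  obtains \<mu> where "trig_limit (\<lambda>k \<omega>. sign_agree J x y k \<omega> - \<mu>)" "\<And>k. expectation (sign_agree J x y k) = \<mu>"
    "\<And>k. integrable M (sign_agree J x y k)"
proof -
  obtain m :: "nat \<Rightarrow> nat" where m: "\<And>u. (\<lambda>N. (sharpen ^^ m N) (sin (u / real (Suc N)))) \<longlonglongrightarrow> sgn u"
    by (rule sgn_trig_approximation) blast
  define s where "s N u = (sharpen ^^ m N) (sin (u / real (Suc N)))" for N u
  have s1: "\<bar>s N u\<bar> \<le> 1" for N u unfolding s_def by (rule sharpen_iter_abs_le) simp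
  define G where "G N k \<omega> = (\<Prod>i\<in>J. (1 + s N (lin (x i) k \<omega>) * s N (lin (y i) k \<omega>)) / 2)" for N k \<omega>
  have odd: "ptrig False (\<lambda>k \<omega>. s N (lin z k \<omega>))" for N z
  proof -
    have "lin z k \<omega> / real (Suc N) = lin (\<lambda>a. z a / real (Suc N)) k \<omega>" for k \<omega>
      unfolding lin_def sum_divide_distrib by simp
    moreover have "ptrig False (\<lambda>k \<omega>. sin (lin (\<lambda>a. z a / real (Suc N)) k \<omega>))"
      using ptrig_single[of False 1 "\<lambda>a. z a / real (Suc N)"] by (simp add: cos_or_sin_def)
    ultimately show ?thesis unfolding s_def using ptrig_sharpen by simp
  qed
  have even: "ptrig True (G N)" for N
  proof -
    have "ptrig True (\<lambda>k \<omega>. (1/2) * (1 + s N (lin (x i) k \<omega>) * s N (lin (y i) k \<omega>)))" for i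
      using ptrig_mult[OF odd odd] by (intro ptrig_scale ptrig_add ptrig_const) auto
    from ptrig_prod[of J "\<lambda>i k \<omega>. (1/2) * (1 + s N (lin (x i) k \<omega>) * s N (lin (y i) k \<omega>))", OF this]
    show ?thesis unfolding G_def by simp
  qed
  have "\<forall>N. \<exists>t :: nat \<times> (nat \<Rightarrow> real) \<times> (nat \<Rightarrow> 'i \<Rightarrow> real). \<forall>k \<omega>. G N k \<omega> = (\<Sum>m<fst t. fst (snd t) m * cos (lin (snd (snd t) m) k \<omega>))"
  proof
    fix N
    obtain n :: nat and c z where "\<forall>k \<omega>. G N k \<omega> = (\<Sum>m<n. c m * cos (lin (z m) k \<omega>))"
      using ptrig_True_normal_form[OF even[of N]] by blast
    thus "\<exists>t :: nat \<times> (nat \<Rightarrow> real) \<times> (nat \<Rightarrow> 'i \<Rightarrow> real). \<forall>k \<omega>. G N k \<omega> = (\<Sum>m<fst t. fst (snd t) m * cos (lin (snd (snd t) m) k \<omega>))"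
      by (intro exI[of _ "(n, c, z)"]) simp
  qed
  then obtain t :: "nat \<Rightarrow> nat \<times> (nat \<Rightarrow> real) \<times> (nat \<Rightarrow> 'i \<Rightarrow> real)" where t: "\<And>N k \<omega>. G N k \<omega> = (\<Sum>m<fst (t N). fst (snd (t N)) m * cos (lin (snd (snd (t N)) m) k \<omega>))"
    by metis
  define \<mu>' where "\<mu>' N = (\<Sum>m<fst (t N). fst (snd (t N)) m * exp (- bil 0 (snd (snd (t N)) m) (snd (snd (t N)) m) / 2))" for N
  have tp: "tpoly (fst (t N)) (fst (snd (t N))) (snd (snd (t N))) k \<omega> = G N k \<omega> - \<mu>' N" for N k \<omega>
    unfolding tpoly_def t \<mu>'_def by (simp add: sum_subtractf right_diff_distrib)
  have Gm[measurable]: "G N k \<in> borel_measurable M" for N k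
    unfolding t[abs_def] using H_measurable[OF lin_H] by measurable
  have f01: "\<bar>\<Prod>i\<in>J. (1 + f i) / 2\<bar> \<le> 1" if "\<And>i. \<bar>f i\<bar> \<le> 1" for f :: "'b \<Rightarrow> real"
  proof -
    have "0 \<le> (1 + f i) / 2 \<and> (1 + f i) / 2 \<le> 1" for i using that[of i] by auto
    hence "0 \<le> (\<Prod>i\<in>J. (1 + f i) / 2)" "(\<Prod>i\<in>J. (1 + f i) / 2) \<le> 1" by (auto intro!: prod_nonneg prod_le_1)
    thus ?thesis by simp
  qed
  have G1: "\<bar>G N k \<omega>\<bar> \<le> 1" for N k \<omega>
    unfolding G_def by (rule f01) (simp add: abs_mult mult_le_one s1)
  have iG: "integrable M (G N k)" for N k by (rule integrable_const_bound[of _ 1]) (auto simp: G1)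
  have EG: "expectation (G N k) = \<mu>' N" for N k
  proof -
    have "expectation (G N k) = (\<Sum>m<fst (t N). fst (snd (t N)) m * expectation (\<lambda>\<omega>. cos (lin (snd (snd (t N)) m) k \<omega>)))"
      unfolding t[abs_def] using H_integrable_cos[OF lin_H] by (subst Bochner_Integration.integral_sum) auto
    thus ?thesis unfolding \<mu>'_def expectation_cos[OF lin_H] cov_lin by simp
  qed
  have lim: "(\<lambda>N. G N k \<omega>) \<longlonglongrightarrow> sign_agree J x y k \<omega>" for k \<omega>
    unfolding G_def sign_agree_def s_def by (intro tendsto_intros m) auto
  have Sm[measurable]: "sign_agree J x y k \<in> borel_measurable M" for k
    by (rule borel_measurable_LIMSEQ_metric[OF Gm lim])
  have S1: "\<bar>sign_agree J x y k \<omega>\<bar> \<le> 1" for k \<omega>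
    unfolding sign_agree_def by (rule f01) (auto simp: abs_mult abs_sgn_eq)
  have iS: "integrable M (sign_agree J x y k)" for k by (rule integrable_const_bound[of _ 1]) (auto simp: S1)
  have \<mu>'lim: "\<mu>' \<longlonglongrightarrow> expectation (sign_agree J x y k)" for k
  proof -
    have "(\<lambda>N. expectation (G N k)) \<longlonglongrightarrow> expectation (sign_agree J x y k)"
      by (rule integral_dominated_convergence[where w="\<lambda>_. 1"]) (auto simp: G1 lim)
    thus ?thesis unfolding EG .
  qed
  \<comment> \<open>The mean of a cosine depends on \<open>bil 0\<close> only, so \<mu>' and its
    limit are the same at all times.\<close>
  define \<mu> where "\<mu> = expectation (sign_agree J x y 0)"
  have E\<mu>: "expectation (sign_agree J x y k) = \<mu>" for k
    unfolding \<mu>_def by (rule LIMSEQ_unique[OF \<mu>'lim \<mu>'lim])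
  have \<mu>'1: "\<bar>\<mu>' N\<bar> \<le> 1" for N
  proof -
    have "norm (expectation (G N 0)) \<le> expectation (\<lambda>\<omega>. 1)" by (rule norm_integral_le) (use iG G1 in auto)
    thus ?thesis unfolding EG by (simp add: prob_space)
  qed
  have "trig_limit (\<lambda>k \<omega>. sign_agree J x y k \<omega> - \<mu>)"
    unfolding trig_limit_def
  proof (intro conjI allI exI)
    show "\<bar>tpoly (fst (t N)) (fst (snd (t N))) (snd (snd (t N))) k \<omega>\<bar> \<le> 2" for N k \<omega>
      unfolding tp using G1[of N k \<omega>] \<mu>'1[of N] by linarith
    show "AE \<omega> in M. (\<lambda>N. tpoly (fst (t N)) (fst (snd (t N))) (snd (snd (t N))) k \<omega>) \<longlonglongrightarrow> sign_agree J x y k \<omega> - \<mu>" for k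
      unfolding tp \<mu>_def by (intro AE_I2 tendsto_intros lim \<mu>'lim)
  qed measurable
  thus ?thesis using E\<mu> iS by (rule that)
qed

end

section \<open>Ordinal patterns\<close>

text \<open>A new element is inserted between those preceding it and the rest; transitivity orders
  the two groups.\<close>

lemma ex_sorted_wrt_list:
  assumes "finite A" and tot: "\<And>a b. a \<in> A \<Longrightarrow> b \<in> A \<Longrightarrow> a \<noteq> b \<Longrightarrow> r a b \<or> r b a"
    and trans: "\<And>a b c. r a b \<Longrightarrow> r b c \<Longrightarrow> r a c"
  shows "\<exists>xs. distinct xs \<and> set xs = A \<and> sorted_wrt r xs"
  using assms(1) tot
proof (induction A rule: finite_induct)
  case empty
  thus ?case by (intro exI[of _ "[]"]) simp
next
  case (insert a A)
  then obtain xs where xs: "distinct xs" "set xs = A" "sorted_wrt r xs" by (metis insertI2)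
  let ?l = "filter (\<lambda>b. r b a) xs" and ?g = "filter (\<lambda>b. \<not> r b a) xs"
  have g: "r a b" if "b \<in> set ?g" for b
    using that xs insert.prems[of a b] insert.hyps by auto
  have "sorted_wrt r (?l @ a # ?g)"
    unfolding sorted_wrt_append
  proof (intro conjI ballI)
    show "sorted_wrt r ?l" using xs(3) by (rule sorted_wrt_filter)
    show "sorted_wrt r (a # ?g)" using sorted_wrt_filter[OF xs(3)] g by auto
    fix u v assume u: "u \<in> set ?l" and v: "v \<in> set (a # ?g)"
    have "r u a" using u by simp
    thus "r u v" using v g trans[of u a v] by auto
  qed
  moreover have "distinct (?l @ a # ?g)" using xs insert.hyps by auto
  moreover have "set (?l @ a # ?g) = insert a A" using xs by auto
  ultimately show ?case by blast
qed

text \<open>If the heads differed, each would have to precede the other.\<close>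

lemma sorted_wrt_unique:
  assumes asym: "\<And>a b. r a b \<Longrightarrow> \<not> r b a"
  shows "sorted_wrt r xs \<Longrightarrow> sorted_wrt r ys \<Longrightarrow> distinct xs \<Longrightarrow> distinct ys \<Longrightarrow> set xs = set ys \<Longrightarrow> xs = ys"
proof (induction xs arbitrary: ys)
  case (Cons x xs)
  then obtain y ys' where ys: "ys = y # ys'" by (cases ys) auto
  have "x = y"
  proof (rule ccontr)
    assume "x \<noteq> y"
    hence "x \<in> set ys'" "y \<in> set xs" using Cons.prems(5) ys by auto
    hence "r y x" "r x y" using Cons.prems(1,2) ys by auto
    thus False using asym by blast
  qed
  moreover have "set xs = set ys'" using Cons.prems \<open>x = y\<close> ys by auto
  ultimately show ?case using Cons ys by auto
qed simp

text \<open>Breaking ties by index makes this a strict total order, so an ordinal pattern is the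
  sorted enumeration of the indices.\<close>

definition comes_before :: "(nat \<Rightarrow> real) \<Rightarrow> nat \<Rightarrow> nat \<Rightarrow> bool" where
  "comes_before x a b \<longleftrightarrow> x b < x a \<or> (x b = x a \<and> a < b)"

lemma comes_before_trans: "comes_before x a b \<Longrightarrow> comes_before x b c \<Longrightarrow> comes_before x a c"
  by (auto simp: comes_before_def)

lemma comes_before_asym: "comes_before x a b \<Longrightarrow> \<not> comes_before x b a"
  by (auto simp: comes_before_def)

text \<open>Comparing neighbours amounts to comparing all pairs, by transitivity; the length follows
  from distinctness and the set of entries.\<close>

lemma ord_pattern_eq_THE:
  "ord_pattern h x = (THE \<pi>. distinct \<pi> \<and> set \<pi> = {0..h} \<and> sorted_wrt (comes_before x) \<pi>)"
proof -
  have "(length \<pi> = h + 1 \<and> distinct \<pi> \<and> set \<pi> = {0..h} \<and>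
      (\<forall>i\<in>{1..h}. x (\<pi> ! (i - 1)) \<ge> x (\<pi> ! i) \<and> (x (\<pi> ! (i - 1)) = x (\<pi> ! i) \<longrightarrow> \<pi> ! (i - 1) < \<pi> ! i)))
    \<longleftrightarrow> (distinct \<pi> \<and> set \<pi> = {0..h} \<and> sorted_wrt (comes_before x) \<pi>)" for \<pi>
  proof -
    have tr: "transp (comes_before x)" by (rule transpI) (rule comes_before_trans)
    have len: "length \<pi> = h + 1" if "distinct \<pi>" "set \<pi> = {0..h}"
      using distinct_card[OF that(1)] that(2) by simp
    have "(\<forall>i\<in>{1..h}. x (\<pi> ! (i - 1)) \<ge> x (\<pi> ! i) \<and> (x (\<pi> ! (i - 1)) = x (\<pi> ! i) \<longrightarrow> \<pi> ! (i - 1) < \<pi> ! i))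
       \<longleftrightarrow> sorted_wrt (comes_before x) \<pi>" if l: "length \<pi> = h + 1"
    proof -
      have "(\<forall>i\<in>{1..h}. x (\<pi> ! (i - 1)) \<ge> x (\<pi> ! i) \<and> (x (\<pi> ! (i - 1)) = x (\<pi> ! i) \<longrightarrow> \<pi> ! (i - 1) < \<pi> ! i))
        \<longleftrightarrow> (\<forall>i\<in>{1..h}. comes_before x (\<pi> ! (i - 1)) (\<pi> ! i))"
        by (intro ball_cong refl) (auto simp: comes_before_def)
      also have "\<dots> \<longleftrightarrow> (\<forall>i. Suc i < length \<pi> \<longrightarrow> comes_before x (\<pi> ! i) (\<pi> ! Suc i))"
      proof safe
        fix i assume "\<forall>i\<in>{1..h}. comes_before x (\<pi> ! (i - 1)) (\<pi> ! i)" "Suc i < length \<pi>"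
        thus "comes_before x (\<pi> ! i) (\<pi> ! Suc i)" using l by (auto dest: bspec[of _ _ "Suc i"])
      next
        fix i assume *: "\<forall>i. Suc i < length \<pi> \<longrightarrow> comes_before x (\<pi> ! i) (\<pi> ! Suc i)" "i \<in> {1..h}"
        hence "Suc (i - 1) = i" "Suc (i - 1) < length \<pi>" using l by auto
        thus "comes_before x (\<pi> ! (i - 1)) (\<pi> ! i)" using * by metis
      qed
      also have "\<dots> \<longleftrightarrow> sorted_wrt (comes_before x) \<pi>"
        using sorted_wrt_iff_nth_Suc_transp[OF tr] by blast
      finally show ?thesis .
    qed
    thus ?thesis using len by blast
  qed
  thus ?thesis unfolding ord_pattern_def by simp
qed

text \<open>Discharges the definite description through existence and uniqueness of the sorted
  enumeration.\<close>

lemma ord_pattern_sorted: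
  "distinct (ord_pattern h x) \<and> set (ord_pattern h x) = {0..h} \<and> sorted_wrt (comes_before x) (ord_pattern h x)"
proof -
  have ex: "\<exists>\<pi>. distinct \<pi> \<and> set \<pi> = {0..h} \<and> sorted_wrt (comes_before x) \<pi>"
    by (rule ex_sorted_wrt_list) (auto simp: comes_before_def)
  have "\<exists>!\<pi>. distinct \<pi> \<and> set \<pi> = {0..h} \<and> sorted_wrt (comes_before x) \<pi>"
    using ex sorted_wrt_unique[of "comes_before x", OF comes_before_asym] by metis
  from theI'[OF this] show ?thesis unfolding ord_pattern_eq_THE .
qed

text \<open>For a < b the tie rule puts a before b exactly when x b <= x a. A pattern is thus
  equivalent to finitely many weak inequalities.\<close>

lemma ord_pattern_eq_iff:
  "ord_pattern h x = ord_pattern h y \<longleftrightarrow> (\<forall>a b. a < b \<and> b \<le> h \<longrightarrow> (x b \<le> x a \<longleftrightarrow> y b \<le> y a))"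
proof
  assume eq: "ord_pattern h x = ord_pattern h y"
  let ?\<pi> = "ord_pattern h x"
  have key: "comes_before y a b" if ab: "comes_before x a b" "a \<le> h" "b \<le> h"
    and X: "sorted_wrt (comes_before x) \<pi>" and Y: "sorted_wrt (comes_before y) \<pi>" and S: "set \<pi> = {0..h}" for x y a b \<pi>
  proof -
    obtain i j where ij: "i < length \<pi>" "\<pi> ! i = a" "j < length \<pi>" "\<pi> ! j = b"
      using ab(2,3) S by (metis atLeastAtMost_iff in_set_conv_nth le0)
    have "i < j"
    proof (rule ccontr)
      assume "\<not> i < j"
      moreover have "i \<noteq> j" using ab(1) ij by (auto simp: comes_before_def)
      ultimately have "comes_before x b a" using sorted_wrt_nth_less[OF X, of j i] ij by simp
      thus False using comes_before_asym ab(1) by blast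
    qed
    thus ?thesis using sorted_wrt_nth_less[OF Y, of i j] ij by simp
  qed
  show "\<forall>a b. a < b \<and> b \<le> h \<longrightarrow> (x b \<le> x a \<longleftrightarrow> y b \<le> y a)"
  proof (intro allI impI)
    fix a b :: nat assume ab: "a < b \<and> b \<le> h"
    have "comes_before x a b \<longleftrightarrow> comes_before y a b"
      using key[of x a b ?\<pi> y] key[of y a b ?\<pi> x] ord_pattern_sorted[of h x] ord_pattern_sorted[of h y] ab
      unfolding eq by auto
    thus "x b \<le> x a \<longleftrightarrow> y b \<le> y a" using ab by (auto simp: comes_before_def)
  qed
next
  assume *: "\<forall>a b. a < b \<and> b \<le> h \<longrightarrow> (x b \<le> x a \<longleftrightarrow> y b \<le> y a)"
  have cb: "comes_before x a b \<longleftrightarrow> comes_before y a b" if "a \<le> h" "b \<le> h" for a b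
  proof (cases a b rule: linorder_cases)
    case less
    thus ?thesis using *[rule_format, of a b] that by (auto simp: comes_before_def)
  next
    case greater
    thus ?thesis using *[rule_format, of b a] that by (auto simp: comes_before_def)
  qed (auto simp: comes_before_def)
  have "sorted_wrt (comes_before x) \<pi> \<longleftrightarrow> sorted_wrt (comes_before y) \<pi>" if "set \<pi> = {0..h}" for \<pi>
    using that cb by (auto intro: sorted_wrt_mono_rel[rotated])
  hence "(distinct \<pi> \<and> set \<pi> = {0..h} \<and> sorted_wrt (comes_before x) \<pi>) = (distinct \<pi> \<and> set \<pi> = {0..h} \<and> sorted_wrt (comes_before y) \<pi>)" for \<pi>
    by blast
  thus "ord_pattern h x = ord_pattern h y" unfolding ord_pattern_eq_THE by simp
qed

text \<open>The difference of two partial sums is a sum over an interval of increments, so each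
  inequality becomes a sign condition.\<close>

lemma ord_pattern_incr_eq_iff:
  "ord_pattern_incr h y = ord_pattern_incr h z \<longleftrightarrow>
    (\<forall>a b. a < b \<and> b \<le> h \<longrightarrow> ((\<Sum>m\<in>{a<..b}. y m) \<le> 0 \<longleftrightarrow> (\<Sum>m\<in>{a<..b}. z m) \<le> 0))"
proof -
  have split: "(\<Sum>m\<in>{1..b}. w m) = (\<Sum>m\<in>{1..a}. w m) + (\<Sum>m\<in>{a<..b}. w m)" if "a < b" for w :: "nat \<Rightarrow> real" and a b
  proof -
    have "{1..b} = {1..a} \<union> {a<..b}" using that by auto
    thus ?thesis by (simp add: sum.union_disjoint ivl_disj_int)
  qed
  show ?thesis unfolding ord_pattern_incr_def ord_pattern_eq_iff
  proof (intro all_cong1 imp_cong refl, goal_cases)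
    case (1 a b)
    thus ?case using split[of a b y] split[of a b z] by simp
  qed
qed

lemma indicator_eq_sign_product:
  assumes "\<And>a b. a < b \<Longrightarrow> b \<le> h \<Longrightarrow> (\<Sum>m\<in>{a<..b}. y m) \<noteq> 0" "\<And>a b. a < b \<Longrightarrow> b \<le> h \<Longrightarrow> (\<Sum>m\<in>{a<..b}. z m) \<noteq> 0"
  shows "(if ord_pattern_incr h y = ord_pattern_incr h z then 1 else 0) =
    (\<Prod>(a,b)\<in>{(a,b). a < b \<and> b \<le> h}. (1 + sgn (\<Sum>m\<in>{a<..b}. y m) * sgn (\<Sum>m\<in>{a<..b}. z m)) / (2::real))"
proof -
  let ?J = "{(a,b). a < b \<and> b \<le> h}"
  have fin: "finite ?J" by (rule finite_subset[of _ "{..h} \<times> {..h}"]) auto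
  have factor: "(1 + sgn (\<Sum>m\<in>{a<..b}. y m) * sgn (\<Sum>m\<in>{a<..b}. z m)) / (2::real) =
     (if (\<Sum>m\<in>{a<..b}. y m) \<le> 0 \<longleftrightarrow> (\<Sum>m\<in>{a<..b}. z m) \<le> 0 then 1 else 0)" if "a < b" "b \<le> h" for a b
    using assms(1)[OF that] assms(2)[OF that] by (auto simp: sgn_if)
  have "(\<Prod>(a,b)\<in>?J. (1 + sgn (\<Sum>m\<in>{a<..b}. y m) * sgn (\<Sum>m\<in>{a<..b}. z m)) / (2::real))
     = (\<Prod>(a,b)\<in>?J. if (\<Sum>m\<in>{a<..b}. y m) \<le> 0 \<longleftrightarrow> (\<Sum>m\<in>{a<..b}. z m) \<le> 0 then 1 else 0)"
    using factor by (intro prod.cong refl) auto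
  also have "\<dots> = (if ord_pattern_incr h y = ord_pattern_incr h z then 1 else 0)"
  proof (cases "ord_pattern_incr h y = ord_pattern_incr h z")
    case True
    thus ?thesis unfolding ord_pattern_incr_eq_iff by (intro trans[OF prod.neutral]) auto
  next
    case False
    then obtain a b where "a < b" "b \<le> h" "\<not> ((\<Sum>m\<in>{a<..b}. y m) \<le> 0 \<longleftrightarrow> (\<Sum>m\<in>{a<..b}. z m) \<le> 0)"
      unfolding ord_pattern_incr_eq_iff by blast
    hence "(\<Prod>(a,b)\<in>?J. if (\<Sum>m\<in>{a<..b}. y m) \<le> 0 \<longleftrightarrow> (\<Sum>m\<in>{a<..b}. z m) \<le> 0 then 1 else 0) = (0::real)"
      using fin by (intro prod_zero) (auto intro!: bexI[of _ "(a, b)"])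
    thus ?thesis using False by simp
  qed
  finally show ?thesis by simp
qed

section \<open>Gaussian processes\<close>

text \<open>One representation covers positive variance and the point mass, so later computations
  need no case distinction.\<close>

lemma normal_distr_eq_distr:
  assumes "0 \<le> v"
  shows "normal_distr v = distr std_normal_distribution borel (\<lambda>x. sqrt v * x)"
proof (cases "v = 0")
  case True
  interpret prob_space std_normal_distribution by (rule prob_space_normal_density) simp
  show ?thesis using True by (simp add: normal_distr_def)
next
  case False
  hence v: "0 < sqrt v" using assms by simp
  interpret prob_space std_normal_distribution by (rule prob_space_normal_density) simp
  have d: "distributed std_normal_distribution lborel (\<lambda>x. x) std_normal_density"
    unfolding distributed_def by (auto intro!: measure_eqI simp: emeasure_distr)
  have "distributed std_normal_distribution lborel (\<lambda>x. 0 + sqrt v * x) (normal_density (0 + sqrt v * 0) (\<bar>sqrt v\<bar> * 1))"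
    by (rule normal_density_affine[OF d]) (use v in auto)
  hence "distr std_normal_distribution lborel (\<lambda>x. sqrt v * x) = density lborel (normal_density 0 (sqrt v))"
    using v by (simp add: distributed_def)
  moreover have "distr std_normal_distribution lborel (\<lambda>x. sqrt v * x) = distr std_normal_distribution borel (\<lambda>x. sqrt v * x)"
    by (rule distr_cong) auto
  ultimately show ?thesis using False by (simp add: normal_distr_def)
qed

lemma real_distribution_normal_distr: "0 \<le> v \<Longrightarrow> real_distribution (normal_distr v)"
proof -
  assume v: "0 \<le> v"
  interpret prob_space std_normal_distribution by (rule prob_space_normal_density) simp
  show ?thesis unfolding normal_distr_eq_distr[OF v] by (rule real_distribution_distr) simp
qed

lemma char_normal_distr:
  assumes "0 \<le> v" shows "char (normal_distr v) \<theta> = of_real (exp (- \<theta>\<^sup>2 * v / 2))"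
proof -
  have "char (normal_distr v) \<theta> = char std_normal_distribution (\<theta> * sqrt v)"
    unfolding char_def normal_distr_eq_distr[OF assms] by (subst integral_distr) (auto simp: mult.assoc)
  also have "\<dots> = of_real (exp (- \<theta>\<^sup>2 * v / 2))"
    unfolding char_std_normal_distribution using assms by (simp add: power_mult_distrib)
  finally show ?thesis .
qed

lemma normal_distr_square:
  assumes "0 \<le> v"
  shows "integrable (normal_distr v) (\<lambda>x. x\<^sup>2)" "(LINT x|normal_distr v. x\<^sup>2) = v"
proof -
  have i: "integrable std_normal_distribution (\<lambda>x. x\<^sup>2)" by (rule integrable_std_normal_distribution_moment)
  have e: "(LINT x|std_normal_distribution. x\<^sup>2) = 1"
    using std_normal_distribution_even_moments(1)[of 1] by simp
  show "integrable (normal_distr v) (\<lambda>x. x\<^sup>2)"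
    unfolding normal_distr_eq_distr[OF assms] by (subst integrable_distr_eq) (use i in \<open>auto simp: power_mult_distrib\<close>)
  show "(LINT x|normal_distr v. x\<^sup>2) = v"
    unfolding normal_distr_eq_distr[OF assms] by (subst integral_distr) (use e assms in \<open>auto simp: power_mult_distrib\<close>)
qed

lemma AE_normal_distr_nonzero: "0 < v \<Longrightarrow> AE x in normal_distr v. x \<noteq> 0"
  unfolding normal_distr_def using AE_lborel_singleton[of "0::real"]
  by (auto simp: AE_density elim: eventually_mono)

lemma (in prob_space) centered_gaussian_rvD:
  assumes "centered_gaussian_rv M X"
  shows "X \<in> borel_measurable M" "integrable M (\<lambda>\<omega>. (X \<omega>)\<^sup>2)"
    "expectation (\<lambda>\<omega>. cis (X \<omega>)) = of_real (exp (- expectation (\<lambda>\<omega>. (X \<omega>)\<^sup>2) / 2))"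
    "expectation (\<lambda>\<omega>. (X \<omega>)\<^sup>2) \<noteq> 0 \<Longrightarrow> AE \<omega> in M. X \<omega> \<noteq> 0"
proof -
  from assms obtain v where X[measurable]: "X \<in> borel_measurable M" and v: "0 \<le> v" and d: "distr M borel X = normal_distr v"
    unfolding centered_gaussian_rv_def by auto
  show "X \<in> borel_measurable M" by (rule X)
  show "integrable M (\<lambda>\<omega>. (X \<omega>)\<^sup>2)"
    using normal_distr_square(1)[OF v] unfolding d[symmetric] by (subst (asm) integrable_distr_eq) auto
  have e: "expectation (\<lambda>\<omega>. (X \<omega>)\<^sup>2) = v"
    using normal_distr_square(2)[OF v] unfolding d[symmetric] by (subst (asm) integral_distr) auto
  have "expectation (\<lambda>\<omega>. cis (X \<omega>)) = char (normal_distr v) 1"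
    unfolding char_def d[symmetric] by (subst integral_distr) (auto simp: cis_conv_exp)
  thus "expectation (\<lambda>\<omega>. cis (X \<omega>)) = of_real (exp (- expectation (\<lambda>\<omega>. (X \<omega>)\<^sup>2) / 2))"
    unfolding e char_normal_distr[OF v] by simp
  assume "expectation (\<lambda>\<omega>. (X \<omega>)\<^sup>2) \<noteq> 0"
  hence "0 < v" using e v by simp
  from AE_normal_distr_nonzero[OF this] show "AE \<omega> in M. X \<omega> \<noteq> 0"
    unfolding d[symmetric] by (subst (asm) AE_distr_iff) auto
qed

text \<open>The algebraic span, without closure, suffices: only finite combinations of windows
  occur.\<close>

definition process_span :: "(nat \<Rightarrow> int \<Rightarrow> 'a \<Rightarrow> real) \<Rightarrow> ('a \<Rightarrow> real) set" where
  "process_span Y = {X. \<exists>J c. finite J \<and> J \<subseteq> {1,2} \<times> UNIV \<and> X = (\<lambda>\<omega>. \<Sum>(p,j)\<in>J. c (p,j) * Y p j \<omega>)}"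

lemma process_span_single: assumes "p \<in> {1,2}" shows "Y p j \<in> process_span Y"
  unfolding process_span_def using assms
  by (intro CollectI exI[of _ "{(p,j)}"] exI[of _ "\<lambda>_. 1"]) auto

lemma gaussian_space_process_span:
  assumes "prob_space M" and gauss: "centered_gaussian_process M Y"
  shows "gaussian_space M (process_span Y)"
proof -
  interpret prob_space M by fact
  have g: "centered_gaussian_rv M X" if "X \<in> process_span Y" for X
    using that gauss unfolding process_span_def centered_gaussian_process_def by auto
  show ?thesis
  proof (unfold_locales)
    fix X X' assume "X \<in> process_span Y" "X' \<in> process_span Y"
    then obtain J c J' c' where J: "finite J" "J \<subseteq> {1,2} \<times> UNIV" "X = (\<lambda>\<omega>. \<Sum>(p,j)\<in>J. c (p,j) * Y p j \<omega>)"
      and J': "finite J'" "J' \<subseteq> {1,2} \<times> UNIV" "X' = (\<lambda>\<omega>. \<Sum>(p,j)\<in>J'. c' (p,j) * Y p j \<omega>)"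
      unfolding process_span_def by blast
    \<comment> \<open>Both coefficient families are extended by 0 to the union of the index
      sets.\<close>
    define e where "e q = (if q \<in> J then c q else 0) + (if q \<in> J' then c' q else 0)" for q
    have "(\<Sum>(p,j)\<in>J \<union> J'. e (p,j) * Y p j \<omega>) = X \<omega> + X' \<omega>" for \<omega>
    proof -
      have "(\<Sum>(p,j)\<in>J \<union> J'. e (p,j) * Y p j \<omega>) = (\<Sum>q\<in>J \<union> J'. (if q \<in> J then c q * Y (fst q) (snd q) \<omega> else 0))
          + (\<Sum>q\<in>J \<union> J'. (if q \<in> J' then c' q * Y (fst q) (snd q) \<omega> else 0))"
        unfolding sum.distrib[symmetric] by (intro sum.cong refl) (auto simp: e_def algebra_simps)
      also have "(\<Sum>q\<in>J \<union> J'. (if q \<in> J then c q * Y (fst q) (snd q) \<omega> else 0)) = (\<Sum>q\<in>J. c q * Y (fst q) (snd q) \<omega>)"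
        using J J' by (intro sum.mono_neutral_cong_right) auto
      also have "(\<Sum>q\<in>J \<union> J'. (if q \<in> J' then c' q * Y (fst q) (snd q) \<omega> else 0)) = (\<Sum>q\<in>J'. c' q * Y (fst q) (snd q) \<omega>)"
        using J J' by (intro sum.mono_neutral_cong_right) auto
      finally show ?thesis using J J' by (simp add: case_prod_beta)
    qed
    thus "(\<lambda>\<omega>. X \<omega> + X' \<omega>) \<in> process_span Y" unfolding process_span_def
      using J J' by (intro CollectI exI[of _ "J \<union> J'"] exI[of _ e]) auto
  next
    fix X a assume "X \<in> process_span Y"
    then obtain J c where J: "finite J" "J \<subseteq> {1,2} \<times> UNIV" "X = (\<lambda>\<omega>. \<Sum>(p,j)\<in>J. c (p,j) * Y p j \<omega>)"
      unfolding process_span_def by blast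
    thus "(\<lambda>\<omega>. a * X \<omega>) \<in> process_span Y" unfolding process_span_def
      by (intro CollectI exI[of _ J] exI[of _ "\<lambda>q. a * c q"]) (auto simp: sum_distrib_left case_prod_beta mult.assoc)
  qed (use centered_gaussian_rvD[OF g] in auto)
qed

text \<open>The joint law of the two coordinates at times 0 and l - j is unchanged by a shift
  through j, and the expectation of the product depends on that law only.\<close>

lemma stationary_cross_corr:
  assumes "prob_space M" and meas: "\<And>p j. p \<in> {1,2} \<Longrightarrow> Y p j \<in> borel_measurable M"
    and stat: "stationary_process M Y" and pq: "p \<in> {1,2}" "q \<in> {1,2}"
  shows "prob_space.expectation M (\<lambda>\<omega>. Y p j \<omega> * Y q l \<omega>) = cross_corr M Y p q (l - j)"
proof -
  interpret prob_space M by fact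
  let ?J = "{(p, 0), (q, l - j)}"
  let ?D = "\<lambda>m. distr M (PiM ?J (\<lambda>_. borel)) (\<lambda>\<omega>. restrict (\<lambda>(p,j). Y p (j + m) \<omega>) ?J)"
  have eq: "?D j = ?D 0"
  proof -
    have "?D j = distr M (PiM ?J (\<lambda>_. borel)) (\<lambda>\<omega>. restrict (\<lambda>(p,j). Y p j \<omega>) ?J)"
      by (rule stat[unfolded stationary_process_def, rule_format]) (use pq in auto)
    thus ?thesis by simp
  qed
  have m: "(\<lambda>\<omega>. restrict (\<lambda>(p,j). Y p (j + m) \<omega>) ?J) \<in> measurable M (PiM ?J (\<lambda>_. borel))" for m
    by (rule measurable_restrict) (use meas pq in auto)
  have f: "(\<lambda>x. x (p, 0) * x (q, l - j)) \<in> borel_measurable (PiM ?J (\<lambda>_. borel :: real measure))"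
    by (intro borel_measurable_times measurable_component_singleton) auto
  have "expectation (\<lambda>\<omega>. Y p (0 + m) \<omega> * Y q (l - j + m) \<omega>) = integral\<^sup>L (?D m) (\<lambda>x. x (p, 0) * x (q, l - j))" for m
    by (subst integral_distr[OF m f]) simp
  from this[of j] this[of 0] show ?thesis unfolding eq cross_corr_def by simp
qed

lemma summable_square_add:
  fixes f g :: "nat \<Rightarrow> real"
  assumes "summable (\<lambda>n. (f n)\<^sup>2)" "summable (\<lambda>n. (g n)\<^sup>2)"
  shows "summable (\<lambda>n. (f n + g n)\<^sup>2)"
proof (rule summable_comparison_test'[of "\<lambda>n. 2 * (f n)\<^sup>2 + 2 * (g n)\<^sup>2" 0])
  show "summable (\<lambda>n. 2 * (f n)\<^sup>2 + 2 * (g n)\<^sup>2)" using assms by (intro summable_add summable_mult)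
  fix n show "norm ((f n + g n)\<^sup>2) \<le> 2 * (f n)\<^sup>2 + 2 * (g n)\<^sup>2"
  proof -
    have "(f n + g n)\<^sup>2 \<le> 2 * (f n)\<^sup>2 + 2 * (g n)\<^sup>2"
      using zero_le_power2[of "f n - g n"] unfolding power2_sum power2_diff by linarith
    thus ?thesis by simp
  qed
qed

lemma summable_square_sum:
  fixes f :: "'b \<Rightarrow> nat \<Rightarrow> real"
  assumes "\<And>i. i \<in> J \<Longrightarrow> summable (\<lambda>n. (f i n)\<^sup>2)"
  shows "summable (\<lambda>n. (\<Sum>i\<in>J. f i n)\<^sup>2)"
  using assms by (induction J rule: infinite_finite_induct) (auto intro: summable_square_add)

lemma summable_int_shift:
  fixes g :: "int \<Rightarrow> real"
  assumes "summable (\<lambda>n. g (int n))"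
  shows "summable (\<lambda>n. g (int n + e))"
proof (cases "0 \<le> e")
  case True
  have "summable (\<lambda>n. g (int (n + nat e)))" using assms by (rule summable_ignore_initial_segment)
  thus ?thesis using True by simp
next
  case False
  have "summable (\<lambda>n. g (int (n + nat (- e)) + e))" using assms False by simp
  thus ?thesis using summable_iff_shift[of "\<lambda>n. g (int n + e)" "nat (- e)"] by simp
qed

text \<open>The slowly varying factor is bounded because it converges, and d < 1/2 makes the squared
  exponent 2 (d - 1) smaller than -1. Here d stands for a sum of two memory parameters, each below
  1/4.\<close>

lemma summable_square_power_decay:
  fixes L :: "nat \<Rightarrow> real"
  assumes L: "convergent L" and d: "d < 1 / 2" and r: "\<And>k. k \<ge> 1 \<Longrightarrow> r (int k) = real k powr (d - 1) * L k"
  shows "summable (\<lambda>n. (r (int n))\<^sup>2)"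
proof -
  obtain B where B: "\<And>k. \<bar>L k\<bar> \<le> B"
    using convergent_imp_Bseq[OF L] by (auto simp: Bseq_def)
  show ?thesis
  proof (rule summable_comparison_test'[of "\<lambda>n. B\<^sup>2 * real n powr (2 * (d - 1))" 1])
    show "summable (\<lambda>n. B\<^sup>2 * real n powr (2 * (d - 1)))"
      using d by (intro summable_mult) (simp add: summable_real_powr_iff)
    fix n :: nat assume n: "1 \<le> n"
    have "(r (int n))\<^sup>2 = (L n)\<^sup>2 * (real n powr (d - 1))\<^sup>2" using r[OF n] by (simp add: power_mult_distrib mult.commute)
    also have "(real n powr (d - 1))\<^sup>2 = real n powr (2 * (d - 1))"
      unfolding mult_2 powr_add by (simp add: power2_eq_square)
    also have "(L n)\<^sup>2 * real n powr (2 * (d - 1)) \<le> B\<^sup>2 * real n powr (2 * (d - 1))"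
    proof (rule mult_right_mono)
      show "(L n)\<^sup>2 \<le> B\<^sup>2" using B[of n] by (metis abs_ge_zero power2_abs power_mono)
    qed simp
    finally show "norm ((r (int n))\<^sup>2) \<le> B\<^sup>2 * real n powr (2 * (d - 1))" by simp
  qed
qed

section \<open>Application to the coincidence frequency of two series\<close>

theorem theorem5:
  fixes M :: "'a measure" and Y :: "nat \<Rightarrow> int \<Rightarrow> 'a \<Rightarrow> real"
    and h :: nat and d :: "nat \<Rightarrow> real"
    and L :: "nat \<Rightarrow> nat \<Rightarrow> nat \<Rightarrow> real" and Llim :: "nat \<Rightarrow> nat \<Rightarrow> real"
  assumes "prob_space M"
    and meas: "\<And>p j. p \<in> {1,2} \<Longrightarrow> Y p j \<in> borel_measurable M"
    and gauss: "centered_gaussian_process M Y"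
    and stat: "stationary_process M Y"
    and std: "\<And>p j. p \<in> {1,2} \<Longrightarrow> distr M borel (Y p j) = std_normal_distribution"
    and corr_lt1: "\<And>p q k. p \<in> {1,2} \<Longrightarrow> q \<in> {1,2} \<Longrightarrow> k \<ge> 1 \<Longrightarrow> \<bar>cross_corr M Y p q k\<bar> < 1"
    and d_range: "\<And>p. p \<in> {1,2} \<Longrightarrow> d p \<in> {..<0} \<union> {0<..<1/4}"
    and S_decay: "\<And>p q k. p \<in> {1,2} \<Longrightarrow> q \<in> {1,2} \<Longrightarrow> k \<ge> 1 \<Longrightarrow>
                     cross_corr M Y p q (int k) = real k powr (d p + d q - 1) * L p q k"
    and S_lim: "\<And>p q. p \<in> {1,2} \<Longrightarrow> q \<in> {1,2} \<Longrightarrow> L p q \<longlonglongrightarrow> Llim p q"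
  defines "prob_p \<equiv> prob_space.prob M {\<omega>\<in>space M.
             ord_pattern_incr h (\<lambda>m. Y 1 (int m) \<omega>) = ord_pattern_incr h (\<lambda>m. Y 2 (int m) \<omega>)}"
  shows "\<exists>\<sigma>2. (\<lambda>N. \<Sum>k\<in>{- int N..int N}.
              prob_space.expectation M (\<lambda>\<omega>. (coinc h Y 1 \<omega> - prob_p) * (coinc h Y (1 + k) \<omega> - prob_p)))
            \<longlonglongrightarrow> \<sigma>2
         \<and> weak_conv_m (\<lambda>n. distr M borel (\<lambda>\<omega>. sqrt (real n) * (p_hat h Y n \<omega> - prob_p)))
              (normal_distr \<sigma>2)"
proof -
  interpret prob_space M by fact
  have corr: "expectation (\<lambda>\<omega>. Y p j \<omega> * Y q l \<omega>) = cross_corr M Y p q (l - j)"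
    if "p \<in> {1,2}" "q \<in> {1,2}" for p q j l
    by (rule stationary_cross_corr[OF assms(1) _ stat that]) (rule meas)
  have corr_swap: "cross_corr M Y p q (- k) = cross_corr M Y q p k" if "p \<in> {1,2}" "q \<in> {1,2}" for p q k
    using corr[of p q k 0] corr[of q p 0 k] that by (simp add: mult.commute)
  have r2: "summable (\<lambda>n. (cross_corr M Y p q (int n))\<^sup>2)" if "p \<in> {1,2}" "q \<in> {1,2}" for p q
  proof (rule summable_square_power_decay)
    show "convergent (L p q)" using S_lim[OF that] by (auto simp: convergent_def)
    show "d p + d q < 1 / 2" using d_range[OF that(1)] d_range[OF that(2)] by auto
  qed (use S_decay[OF that] in auto)
  \<comment> \<open>The window of length \<open>h\<close> of both series is treated as one vector,
    indexed by series and offset.\<close>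
  define I where "I = {1,2::nat} \<times> {1..h}"
  \<comment> \<open>Offsets start at 1, so the window at time k covers the times k to k + h - 1, as
    in \<open>coinc\<close>.\<close>
  define V where "V a k = Y (fst a) (k + int (snd a) - 1)" for a :: "nat \<times> nat" and k
  define C where "C a b k = cross_corr M Y (fst a) (fst b) (k + int (snd b) - int (snd a))" for a b :: "nat \<times> nat" and k
  \<comment> \<open>Summing over all pairs of coordinates and both signs of the lag gives a
    symmetric majorant.\<close>
  define \<rho> where "\<rho> k = (\<Sum>(a,b)\<in>I\<times>I. \<bar>C a b k\<bar> + \<bar>C a b (- k)\<bar>)" for k
  have I12: "fst a \<in> {1,2}" if "a \<in> I" for a using that by (auto simp: I_def)
  have finI: "finite I" by (simp add: I_def)
  have C2: "summable (\<lambda>n. (C a b (int n))\<^sup>2)" "summable (\<lambda>n. (C a b (- int n))\<^sup>2)" if "a \<in> I" "b \<in> I" for a b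
  proof -
    have "summable (\<lambda>n. (cross_corr M Y (fst a) (fst b) (int n + (int (snd b) - int (snd a))))\<^sup>2)"
      by (rule summable_int_shift[of "\<lambda>k. (cross_corr M Y (fst a) (fst b) k)\<^sup>2"]) (rule r2[OF I12[OF that(1)] I12[OF that(2)]])
    thus "summable (\<lambda>n. (C a b (int n))\<^sup>2)" unfolding C_def by (simp add: algebra_simps)
    have "C a b (- k) = cross_corr M Y (fst b) (fst a) (k + (int (snd a) - int (snd b)))" for k
      unfolding C_def using corr_swap[OF I12[OF that(1)] I12[OF that(2)], of "k + (int (snd a) - int (snd b))"]
      by (simp add: algebra_simps)
    moreover have "summable (\<lambda>n. (cross_corr M Y (fst b) (fst a) (int n + (int (snd a) - int (snd b))))\<^sup>2)"
      by (rule summable_int_shift[of "\<lambda>k. (cross_corr M Y (fst b) (fst a) k)\<^sup>2"]) (rule r2[OF I12[OF that(2)] I12[OF that(1)]])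
    ultimately show "summable (\<lambda>n. (C a b (- int n))\<^sup>2)" by simp
  qed
  interpret S: gaussian_space M "process_span Y"
    using assms(1) gauss by (rule gaussian_space_process_span)
  have VH: "V a k \<in> process_span Y" if "a \<in> I" for a k
    unfolding V_def by (rule process_span_single[OF I12[OF that]])
  interpret S: stationary_gaussian M "process_span Y" \<rho> I V C
  proof
    show "0 \<le> \<rho> k" for k unfolding \<rho>_def by (intro sum_nonneg) auto
    show "\<rho> (- k) = \<rho> k" for k unfolding \<rho>_def by (simp add: add.commute)
    show "summable (\<lambda>n. (\<rho> (int n))\<^sup>2)"
      unfolding \<rho>_def case_prod_beta
      by (intro summable_square_sum summable_square_add) (use C2 in auto)
    show "finite I" by (rule finI)
    show "(\<lambda>\<omega>. 0) \<in> process_span Y"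
      using S.H_scale[OF process_span_single[of 1 Y 0], of 0] by simp
    show "V a k \<in> process_span Y" if "a \<in> I" for a k using that by (rule VH)
    show "S.cov (V a k) (V b l) = C a b (l - k)" if "a \<in> I" "b \<in> I" for a b k l
      unfolding S.cov_def V_def C_def using corr[OF I12[OF that(1)] I12[OF that(2)]] by (simp add: algebra_simps)
    show "\<bar>C a b k\<bar> \<le> \<rho> k" if "a \<in> I" "b \<in> I" for a b k
    proof -
      have "\<bar>C a b k\<bar> \<le> (case (a, b) of (a, b) \<Rightarrow> \<bar>C a b k\<bar> + \<bar>C a b (- k)\<bar>)" by simp
      also have "\<dots> \<le> \<rho> k" unfolding \<rho>_def using that finI by (intro member_le_sum) auto
      finally show ?thesis .
    qed
  qed
  \<comment> \<open>Selects the increments with offsets from a + 1 to b, whose sum compares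
    positions a and b of the window.\<close>
  define xc :: "nat \<Rightarrow> nat \<times> nat \<Rightarrow> nat \<times> nat \<Rightarrow> real" where "xc p e a = (if fst a = p \<and> fst e < snd a \<and> snd a \<le> snd e then 1 else 0)" for p e a
  define J where "J = {(a, b). a < b \<and> b \<le> h}"
  have finJ: "finite J" unfolding J_def by (rule finite_subset[of _ "{..h} \<times> {..h}"]) auto
  have lin_xc: "S.lin (xc p (a, b)) k \<omega> = (\<Sum>m\<in>{a<..b}. Y p (k + int m - 1) \<omega>)" if "p \<in> {1,2}" "b \<le> h" for p a b k \<omega>
  proof -
    have "S.lin (xc p (a, b)) k \<omega> = (\<Sum>q\<in>Pair p ` {a<..b}. V q k \<omega>)"
      unfolding S.lin_def using that finI by (intro sum.mono_neutral_cong_right) (auto simp: I_def xc_def)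
    also have "\<dots> = (\<Sum>m\<in>{a<..b}. Y p (k + int m - 1) \<omega>)"
      by (subst sum.reindex) (auto simp: inj_on_def V_def)
    finally show ?thesis .
  qed
  have var1: "expectation (\<lambda>\<omega>. Y p j \<omega> * Y p j \<omega>) = 1" if "p \<in> {1,2}" for p j
  proof -
    have "(LINT x|distr M borel (Y p j). x\<^sup>2) = 1"
      unfolding std[OF that] using std_normal_distribution_even_moments(1)[of 1] by simp
    thus ?thesis using meas[OF that] by (subst (asm) integral_distr) (auto simp: power2_eq_square)
  qed
  have gaussH: "centered_gaussian_rv M X" if "X \<in> process_span Y" for X
    using that gauss unfolding process_span_def centered_gaussian_process_def by auto
  \<comment> \<open>If a partial sum of b - a terms vanished almost surely, subtracting its shift would give
    correlation 1 at lag b - a.\<close>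
  have nonzero: "AE \<omega> in M. S.lin (xc p (a, b)) k \<omega> \<noteq> 0" if p: "p \<in> {1,2}" and ab: "a < b" "b \<le> h" for p a b k
  proof -
    let ?X = "\<lambda>k. S.lin (xc p (a, b)) k"
    have E: "expectation (\<lambda>\<omega>. (?X k \<omega>)\<^sup>2) = S.bil 0 (xc p (a, b)) (xc p (a, b))" for k
      using S.cov_lin[of "xc p (a, b)" k "xc p (a, b)" k] by (simp add: S.cov_def power2_eq_square)
    have "S.bil 0 (xc p (a, b)) (xc p (a, b)) \<noteq> 0"
    proof
      assume bil0: "S.bil 0 (xc p (a, b)) (xc p (a, b)) = 0"
      have z: "AE \<omega> in M. ?X k \<omega> = 0" for k
      proof -
        have "expectation (\<lambda>\<omega>. (?X k \<omega>)\<^sup>2) = 0" using E[of k] bil0 by simp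
        hence "AE \<omega> in M. (?X k \<omega>)\<^sup>2 = 0"
          using S.H_square[OF S.lin_H, of "xc p (a, b)" k] by (subst (asm) integral_nonneg_eq_0_iff_AE) auto
        thus ?thesis by simp
      qed
      have tel: "?X 1 \<omega> - ?X 0 \<omega> = Y p (int b) \<omega> - Y p (int a) \<omega>" for \<omega>
      proof -
        have "(\<Sum>m\<in>{a<..c}. Y p (1 + int m - 1) \<omega>) - (\<Sum>m\<in>{a<..c}. Y p (0 + int m - 1) \<omega>) = Y p (int c) \<omega> - Y p (int a) \<omega>" if "a \<le> c" for c
          using that
        proof (induction c rule: dec_induct)
          case (step c)
          have "{a<..Suc c} = insert (Suc c) {a<..c}" using step by auto
          thus ?case using step by simp
        qed simp
        thus ?thesis unfolding lin_xc[OF p ab(2)] using ab by simp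
      qed
      have "AE \<omega> in M. Y p (int b) \<omega> = Y p (int a) \<omega>"
        using z[of 1] z[of 0]
      proof eventually_elim
        case (elim \<omega>)
        thus ?case using tel[of \<omega>] by simp
      qed
      hence "AE \<omega> in M. Y p (int a) \<omega> * Y p (int b) \<omega> = Y p (int a) \<omega> * Y p (int a) \<omega>"
        by eventually_elim simp
      hence "expectation (\<lambda>\<omega>. Y p (int a) \<omega> * Y p (int b) \<omega>) = expectation (\<lambda>\<omega>. Y p (int a) \<omega> * Y p (int a) \<omega>)"
        using meas[OF p] by (intro integral_cong_AE) auto
      hence "cross_corr M Y p p (int b - int a) = 1" using corr[OF p p, of "int a" "int b"] var1[OF p] by simp
      thus False using corr_lt1[OF p p, of "int b - int a"] ab by simp
    qed
    \<comment> \<open>A centred Gaussian variable of positive variance has no atom at 0.\<close>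
    thus ?thesis using centered_gaussian_rvD(4)[OF gaussH[OF S.lin_H]] E by metis
  qed
  let ?A = "S.sign_agree J (xc 1) (xc 2)"
  have coinc_AE: "AE \<omega> in M. coinc h Y k \<omega> = ?A k \<omega>" for k
  proof -
    have "AE \<omega> in M. \<forall>e\<in>J. S.lin (xc 1 e) k \<omega> \<noteq> 0 \<and> S.lin (xc 2 e) k \<omega> \<noteq> 0"
      by (rule AE_finite_allI[OF finJ]) (auto simp: J_def intro!: AE_conjI nonzero)
    thus ?thesis
    proof eventually_elim
      case (elim \<omega>)
      have nz: "(\<Sum>m\<in>{a<..b}. Y p (k + int m - 1) \<omega>) \<noteq> 0" if "a < b" "b \<le> h" "p \<in> {1,2}" for a b p
        using elim that lin_xc[of p b a k \<omega>] by (auto simp: J_def)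
      have "coinc h Y k \<omega> = (\<Prod>(a,b)\<in>J. (1 + sgn (\<Sum>m\<in>{a<..b}. Y 1 (k + int m - 1) \<omega>) * sgn (\<Sum>m\<in>{a<..b}. Y 2 (k + int m - 1) \<omega>)) / 2)"
        unfolding coinc_def J_def by (rule indicator_eq_sign_product) (use nz in auto)
      also have "\<dots> = ?A k \<omega>"
        unfolding S.sign_agree_def by (intro prod.cong refl) (auto simp: J_def lin_xc)
      finally show ?case .
    qed
  qed
  \<comment> \<open>Measurability is read off from the sign conditions on sums of increments, since
    the definite description gives no access to it.\<close>
  have coinc_set: "{\<omega>\<in>space M. ord_pattern_incr h (\<lambda>m. Y 1 (k + int m - 1) \<omega>) = ord_pattern_incr h (\<lambda>m. Y 2 (k + int m - 1) \<omega>)} \<in> sets M" for k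
  proof -
    have "{\<omega>\<in>space M. ord_pattern_incr h (\<lambda>m. Y 1 (k + int m - 1) \<omega>) = ord_pattern_incr h (\<lambda>m. Y 2 (k + int m - 1) \<omega>)}
      = {\<omega>\<in>space M. \<forall>a b. a < b \<and> b \<le> h \<longrightarrow> ((\<Sum>m\<in>{a<..b}. Y 1 (k + int m - 1) \<omega>) \<le> 0 \<longleftrightarrow> (\<Sum>m\<in>{a<..b}. Y 2 (k + int m - 1) \<omega>) \<le> 0)}"
      unfolding ord_pattern_incr_eq_iff ..
    also have "\<dots> \<in> sets M" using meas[of 1] meas[of 2] by measurable
    finally show ?thesis .
  qed
  have coinc_m[measurable]: "coinc h Y k \<in> borel_measurable M" for k
    unfolding coinc_def[abs_def] by (rule measurable_If) (use coinc_set in auto)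
  obtain \<mu> where lim: "S.trig_limit (\<lambda>k \<omega>. ?A k \<omega> - \<mu>)" and E\<mu>: "\<And>k. expectation (?A k) = \<mu>" and iA: "\<And>k. integrable M (?A k)"
    by (rule S.sign_agree_trig_limit[of J "xc 1" "xc 2"]) blast
  note Am[measurable] = borel_measurable_integrable[OF iA]
  have p\<mu>: "prob_p = \<mu>"
  proof -
    \<comment> \<open>Index \<open>1 + int m - 1\<close> instead of \<open>int m\<close>, to match
      \<open>coinc\<close> at time 1.\<close>
    let ?B = "{\<omega>\<in>space M. ord_pattern_incr h (\<lambda>m. Y 1 (1 + int m - 1) \<omega>) = ord_pattern_incr h (\<lambda>m. Y 2 (1 + int m - 1) \<omega>)}"
    have "prob_p = prob ?B" unfolding prob_p_def by simp
    also have "\<dots> = expectation (indicator ?B)" using coinc_set[of 1] by simp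
    also have "\<dots> = expectation (coinc h Y 1)"
      by (intro Bochner_Integration.integral_cong refl) (auto simp: coinc_def indicator_def)
    also have "\<dots> = expectation (?A 1)" by (rule integral_cong_AE[OF coinc_m Am coinc_AE])
    finally show ?thesis using E\<mu> by simp
  qed
  define F where "F k \<omega> = ?A k \<omega> - \<mu>" for k \<omega>
  have F: "S.trig_limit F" using lim unfolding F_def[abs_def] .
  have [measurable]: "F k \<in> borel_measurable M" for k unfolding F_def[abs_def] by measurable
  have FA: "AE \<omega> in M. coinc h Y k \<omega> - prob_p = F k \<omega>" for k
    using coinc_AE[of k] by eventually_elim (simp add: F_def p\<mu>)
  obtain \<sigma>2 B where \<sigma>: "(\<lambda>N. \<Sum>d\<in>{- int N..int N}. expectation (\<lambda>\<omega>. F 0 \<omega> * F d \<omega>)) \<longlonglongrightarrow> \<sigma>2" "0 \<le> \<sigma>2"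
    and B: "\<And>n. expectation (\<lambda>\<omega>. ((\<Sum>k\<in>{1..int n}. F k \<omega>) / sqrt (real n))\<^sup>2) \<le> B"
    and i2: "\<And>n. integrable M (\<lambda>\<omega>. ((\<Sum>k\<in>{1..int n}. F k \<omega>) / sqrt (real n))\<^sup>2)"
    and clt: "\<And>\<theta>. (\<lambda>n. expectation (\<lambda>\<omega>. cis (\<theta> * ((\<Sum>k\<in>{1..int n}. F k \<omega>) / sqrt (real n))))) \<longlonglongrightarrow> of_real (exp (- \<theta>\<^sup>2 * \<sigma>2 / 2))"
    using S.trig_limit_clt[OF F] by (elim exE conjE) blast
  \<comment> \<open>The sum in the claim is anchored at time 1 and the general theorem at time 0;
    stationarity of covariances bridges this.\<close>
  have cov_eq: "expectation (\<lambda>\<omega>. (coinc h Y 1 \<omega> - prob_p) * (coinc h Y (1 + k) \<omega> - prob_p)) = expectation (\<lambda>\<omega>. F 0 \<omega> * F k \<omega>)" for k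
  proof -
    have "expectation (\<lambda>\<omega>. (coinc h Y 1 \<omega> - prob_p) * (coinc h Y (1 + k) \<omega> - prob_p)) = expectation (\<lambda>\<omega>. F 1 \<omega> * F (1 + k) \<omega>)"
    proof (rule integral_cong_AE)
      show "AE \<omega> in M. (coinc h Y 1 \<omega> - prob_p) * (coinc h Y (1 + k) \<omega> - prob_p) = F 1 \<omega> * F (1 + k) \<omega>"
        using FA[of 1] FA[of "1 + k"] by eventually_elim simp
    qed measurable
    also obtain K :: real where "\<And>F. S.trig_limit F \<Longrightarrow> \<forall>k l. expectation (\<lambda>\<omega>. F k \<omega> * F l \<omega>) = expectation (\<lambda>\<omega>. F 0 \<omega> * F (l - k) \<omega>)"
      by (rule S.trig_limit_cov) blast
    from this[OF F] have "expectation (\<lambda>\<omega>. F 1 \<omega> * F (1 + k) \<omega>) = expectation (\<lambda>\<omega>. F 0 \<omega> * F (1 + k - 1) \<omega>)" by blast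
    finally show ?thesis by simp
  qed
  define S where "S n \<omega> = (\<Sum>k\<in>{1..int n}. F k \<omega>) / sqrt (real n)" for n \<omega>
  define Z where "Z n \<omega> = sqrt (real n) * (p_hat h Y n \<omega> - prob_p)" for n \<omega>
  \<comment> \<open>The average runs over n - h windows while the normalisation is by the root of n;
    this ratio compensates and tends to 1.\<close>
  define r where "r n = sqrt (real n) / sqrt (real (n - h))" for n
  have Sm[measurable]: "S n \<in> borel_measurable M" for n unfolding S_def[abs_def] by measurable
  have Zm[measurable]: "Z n \<in> borel_measurable M" for n unfolding Z_def[abs_def] p_hat_def[abs_def] by measurable
  \<comment> \<open>Subtraction of naturals is truncated, so the identity needs h < n; only finitely
    many null sets are discarded.\<close>
  have ZS: "AE \<omega> in M. Z n \<omega> = r n * S (n - h) \<omega>" if n: "h < n" for n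
  proof -
    have "AE \<omega> in M. \<forall>k\<in>{1..int (n - h)}. coinc h Y k \<omega> - prob_p = F k \<omega>"
      by (rule AE_finite_allI) (auto intro: FA)
    thus ?thesis
    proof eventually_elim
      case (elim \<omega>)
      let ?m = "real (n - h)"
      have m: "0 < ?m" using n by simp
      have "(\<Sum>j\<in>{1..n - h}. coinc h Y (int j) \<omega>) = (\<Sum>k\<in>{1..int (n - h)}. coinc h Y k \<omega>)"
        by (rule sum.reindex_bij_witness[of _ nat int]) auto
      also have "\<dots> = (\<Sum>k\<in>{1..int (n - h)}. F k \<omega> + prob_p)"
      proof (intro sum.cong refl)
        fix k assume "k \<in> {1..int (n - h)}"
        with elim have "coinc h Y k \<omega> - prob_p = F k \<omega>" by blast
        thus "coinc h Y k \<omega> = F k \<omega> + prob_p" by simp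
      qed
      also have "\<dots> = (\<Sum>k\<in>{1..int (n - h)}. F k \<omega>) + ?m * prob_p" by (simp add: sum.distrib)
      finally have "Z n \<omega> = sqrt (real n) * ((\<Sum>k\<in>{1..int (n - h)}. F k \<omega>) / ?m)"
        unfolding Z_def p_hat_def using m by (simp add: field_simps)
      also have "\<dots> = sqrt (real n) * ((\<Sum>k\<in>{1..int (n - h)}. F k \<omega>) / (sqrt ?m * sqrt ?m))" by simp
      also have "\<dots> = r n * S (n - h) \<omega>" unfolding r_def S_def by simp
      finally show ?case .
    qed
  qed
  have r1: "r \<longlonglongrightarrow> 1"
  proof -
    have "(\<lambda>n. r (n + h)) \<longlonglongrightarrow> 1"
    proof -
      have "(\<lambda>n. sqrt (1 + real h * (1 / real n))) \<longlonglongrightarrow> sqrt (1 + real h * 0)"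
        by (intro tendsto_intros lim_1_over_n)
      moreover have "eventually (\<lambda>n. sqrt (1 + real h * (1 / real n)) = r (n + h)) sequentially"
        using eventually_gt_at_top[of 0]
      proof eventually_elim
        case (elim n)
        thus ?case unfolding r_def real_sqrt_divide[symmetric] by (simp add: field_simps)
      qed
      ultimately show ?thesis by (simp add: tendsto_cong)
    qed
    thus ?thesis by (rule LIMSEQ_offset)
  qed
  have char: "(\<lambda>n. char (distr M borel (Z n)) \<theta>) \<longlonglongrightarrow> char (normal_distr \<sigma>2) \<theta>" for \<theta>
  proof -
    have ic: "integrable M (\<lambda>\<omega>. cis (a * X \<omega>))" if "X \<in> borel_measurable M" for X a
      using that by (intro bdd_rv_integrable bdd_rv_cis) measurable
    have c: "char (distr M borel (Z n)) \<theta> = expectation (\<lambda>\<omega>. cis (\<theta> * Z n \<omega>))" for n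
      unfolding char_def by (subst integral_distr) (auto simp: cis_conv_exp)
    \<comment> \<open>The Lipschitz bound for \<open>cis\<close> and the uniform second moment bound
      show that the factor \<open>r n\<close> does not affect the limit.\<close>
    have bound: "cmod (char (distr M borel (Z n)) \<theta> - expectation (\<lambda>\<omega>. cis (\<theta> * S (n - h) \<omega>))) \<le> \<bar>\<theta>\<bar> * \<bar>r n - 1\<bar> * sqrt B" if n: "h < n" for n
    proof -
      let ?S = "S (n - h)"
      have iS2: "integrable M (\<lambda>\<omega>. (?S \<omega>)\<^sup>2)" unfolding S_def by (rule i2)
      have iS: "integrable M ?S" by (rule integrable_of_square[OF Sm iS2])
      have B0: "0 \<le> B" using order_trans[OF _ B[of 0]] by simp
      have ES: "expectation (\<lambda>\<omega>. \<bar>?S \<omega>\<bar>) \<le> sqrt B"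
        by (rule expectation_abs_le_of_square[OF Sm iS2]) (use B[of "n - h"] B0 in \<open>auto simp: S_def\<close>)
      have "char (distr M borel (Z n)) \<theta> = expectation (\<lambda>\<omega>. cis ((\<theta> * r n) * ?S \<omega>))"
        unfolding c
      proof (rule integral_cong_AE)
        show "AE \<omega> in M. cis (\<theta> * Z n \<omega>) = cis (\<theta> * r n * ?S \<omega>)"
          using ZS[OF n] by eventually_elim (simp add: mult.assoc)
      qed measurable
      hence "char (distr M borel (Z n)) \<theta> - expectation (\<lambda>\<omega>. cis (\<theta> * ?S \<omega>)) = expectation (\<lambda>\<omega>. cis ((\<theta> * r n) * ?S \<omega>) - cis (\<theta> * ?S \<omega>))"
        using ic[OF Sm] by simp
      also have "cmod \<dots> \<le> expectation (\<lambda>\<omega>. \<bar>\<theta>\<bar> * \<bar>r n - 1\<bar> * \<bar>?S \<omega>\<bar>)"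
      proof (rule norm_integral_le)
        show "cmod (cis ((\<theta> * r n) * ?S \<omega>) - cis (\<theta> * ?S \<omega>)) \<le> \<bar>\<theta>\<bar> * \<bar>r n - 1\<bar> * \<bar>?S \<omega>\<bar>" for \<omega>
        proof -
          have "(\<theta> * r n) * ?S \<omega> - \<theta> * ?S \<omega> = \<theta> * (r n - 1) * ?S \<omega>" by (simp add: algebra_simps)
          thus ?thesis using norm_cis_diff_le[of "(\<theta> * r n) * ?S \<omega>" "\<theta> * ?S \<omega>"] by (simp add: abs_mult)
        qed
      qed (use ic[OF Sm] iS in auto)
      also have "\<dots> = \<bar>\<theta>\<bar> * \<bar>r n - 1\<bar> * expectation (\<lambda>\<omega>. \<bar>?S \<omega>\<bar>)" by simp
      also have "\<dots> \<le> \<bar>\<theta>\<bar> * \<bar>r n - 1\<bar> * sqrt B" by (intro mult_left_mono ES) auto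
      finally show ?thesis .
    qed
    have "(\<lambda>n. \<bar>\<theta>\<bar> * \<bar>r n - 1\<bar> * sqrt B) \<longlonglongrightarrow> \<bar>\<theta>\<bar> * \<bar>1 - 1\<bar> * sqrt B" by (intro tendsto_intros r1)
    hence "(\<lambda>n. \<bar>\<theta>\<bar> * \<bar>r n - 1\<bar> * sqrt B) \<longlonglongrightarrow> 0" by simp
    moreover have "\<forall>\<^sub>F n in sequentially. norm (char (distr M borel (Z n)) \<theta> - expectation (\<lambda>\<omega>. cis (\<theta> * S (n - h) \<omega>))) \<le> \<bar>\<theta>\<bar> * \<bar>r n - 1\<bar> * sqrt B"
      using eventually_gt_at_top[of h] by eventually_elim (rule bound)
    ultimately have A: "(\<lambda>n. char (distr M borel (Z n)) \<theta> - expectation (\<lambda>\<omega>. cis (\<theta> * S (n - h) \<omega>))) \<longlonglongrightarrow> 0"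
      by (rule Lim_null_comparison[rotated])
    have "(\<lambda>n. expectation (\<lambda>\<omega>. cis (\<theta> * S (n - h) \<omega>))) \<longlonglongrightarrow> of_real (exp (- \<theta>\<^sup>2 * \<sigma>2 / 2))"
      by (rule LIMSEQ_offset[where k=h]) (use clt[of \<theta>] in \<open>simp add: S_def\<close>)
    from tendsto_add[OF A this] show ?thesis unfolding char_normal_distr[OF \<sigma>(2)] by simp
  qed
  \<comment> \<open>Levy's continuity theorem, which also covers the degenerate case where the limit
    is the point mass at 0.\<close>
  have "weak_conv_m (\<lambda>n. distr M borel (Z n)) (normal_distr \<sigma>2)"
    by (rule levy_continuity[OF _ real_distribution_normal_distr[OF \<sigma>(2)] char]) (rule real_distribution_distr[OF Zm])
  thus ?thesis using \<sigma>(1) unfolding cov_eq Z_def[abs_def] by blast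
qed

end
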